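(* Let $p\in(1,\infty)$ and let $G$ be a locally compact group. For a subset $C\subset G$ the following statements are equivalent. (1) $C$ is an open left coset (i.e. a left coset of an open subgroup of $G$). (2) $\chi_C\in B(G)$ with $\|\chi_C\|_{B(G)}=1$. (3) $\chi_C\neq 0$ is a normalized coefficient function of a representation $(\pi,E)$ of $G$ where $E$ or $E^*$ is smooth. (4) $\chi_C\in B_p(G)$ with $\|\chi_C\|_{B_p(G)}=1$.
   Context: $\chi_C$ is the indicator function of $C$. A representation of $G$ is a pair $(\pi,E)$ with $E$ a Banach space and $\pi$ a group homomorphism from $G$ into the invertible isometries on $E$, continuous from $G$ to the strong operator topology of $\mathcal{B}(E)$. A coefficient function of $(\pi,E)$ is a function $x\mapsto\langle\pi(x)\xi,\eta\rangle$ with $\xi\in E$, $\eta\in E^*$; it is normalized if $\xi,\eta$ can be chosen with $\|\xi\|=\|\eta\|=1$. A Banach space $E$ is smooth if for each $\xi\in E\setminus\{0\}$ there is a unique $\eta\in E^*$ with $\|\eta\|=1$ and $\langle\xi,\eta\rangle=\|\xi\|$. $B(G)$ is the Fourier–Stieltjes algebra: the coefficient functions of the (strongly continuous) unitary representations of $G$ on Hilbert spaces, with norm $\|u\|_{B(G)}=\inf\|\xi\|\|\eta\|$ over all ways of writing $u=\langle\pi(\cdot)\xi,\eta\rangle$ with $\pi$ unitary. An $L_p$-space is a Banach space of the form $L_p(X)$, $X$ a measure space; a $QSL_p$-space is a Banach space isometrically isomorphic to a quotient of a subspace of an $L_p$-space. $\mathrm{Rep}_p(G)$ is the collection of (equivalence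 classes of) representations of $G$ on $QSL_p$-spaces. For $f\in L_1(G)$, $\pi(f)=\int_G f(x)\pi(x)\,dx$ (strong operator convergence, left Haar measure). $(\pi,E)\in\mathrm{Rep}_p(G)$ is cyclic if there is $\xi_0\in E$ with $\pi(L_1(G))\xi_0$ dense in $E$; $\mathrm{Cyc}_p(G)$ is the set of cyclic representations in $\mathrm{Rep}_p(G)$. $B_p(G)$ is the set of all coefficient functions of representations in $\mathrm{Rep}_p(G)$, with norm $$\|u\|_{B_p(G)}=\inf\Big\{\sum_{n=1}^\infty\|\xi_n\|\|\eta_n\| : u(\cdot)=\sum_{n=1}^\infty\langle\pi_n(\cdot)\xi_n,\eta_n\rangle\Big\},$$ the infimum being over all $(\pi_n,E_n)\in\mathrm{Cyc}_p(G)$, $\xi_n\in E_n$, $\eta_n\in E_n^*$ with $\sum_n\|\xi_n\|\|\eta_n\|<\infty$. It is a commutative unital Banach algebra under pointwise operations. *)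

theory Defs
  imports
    "HOL-Analysis.Analysis"
    "HOL-Algebra.Group_Action"
    "HOL-Algebra.AbelCoset"
    "HOL-Algebra.Module"
    "HOL-Algebra.Algebraic_Closure_Type"
begin

section \<open>Complex Banach spaces with explicit carriers\<close>

text \<open>
  The theorem quantifies existentially over Banach spaces, so a Banach space cannot be a type here.
  It is a module record over the complex field, extended by a norm; only the values on the carrier
  matter, and the fields \<open>mult\<close> and \<open>one\<close> inherited from the record type are unused.
\<close>

record 'a cnspace = "(complex, 'a) module" +
  nrm :: "'a \<Rightarrow> real"

abbreviation complex_field :: "complex ring" where
  "complex_field \<equiv> ring_of_type_algebra"

locale cnormed_space = module complex_field E for E :: "'a cnspace" (structure) +
  assumes nrm_nonneg: "x \<in> carrier E \<Longrightarrow> 0 \<le> nrm E x"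
    and nrm_eq_0_iff: "x \<in> carrier E \<Longrightarrow> nrm E x = 0 \<longleftrightarrow> x = \<zero>\<^bsub>E\<^esub>"
    and nrm_smult: "x \<in> carrier E \<Longrightarrow> nrm E (c \<odot>\<^bsub>E\<^esub> x) = cmod c * nrm E x"
    and nrm_triangle: "\<lbrakk>x \<in> carrier E; y \<in> carrier E\<rbrakk> \<Longrightarrow> nrm E (x \<oplus>\<^bsub>E\<^esub> y) \<le> nrm E x + nrm E y"

text \<open>The locale \<open>Metric_space\<close> wants nonnegativity and symmetry off the carrier as well,
  hence the value 0 there.\<close>

definition ndist :: "'a cnspace \<Rightarrow> 'a \<Rightarrow> 'a \<Rightarrow> real" where
  "ndist E x y = (if x \<in> carrier E \<and> y \<in> carrier E then nrm E (x \<ominus>\<^bsub>E\<^esub> y) else 0)"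

definition norm_topology :: "'a cnspace \<Rightarrow> 'a topology" where
  "norm_topology E = Metric_space.mtopology (carrier E) (ndist E)"

locale cbanach_space = cnormed_space +
  assumes complete: "Metric_space.mcomplete (carrier E) (ndist E)"

text \<open>The dual space. Functionals are extensional, so that equality in the dual is equality
  of functionals on the carrier.\<close>

definition bounded_functionals :: "'a cnspace \<Rightarrow> ('a \<Rightarrow> complex) set" where
  "bounded_functionals E = {\<phi> \<in> extensional (carrier E).
     (\<forall>x\<in>carrier E. \<forall>y\<in>carrier E. \<phi> (x \<oplus>\<^bsub>E\<^esub> y) = \<phi> x + \<phi> y) \<and>
     (\<forall>c. \<forall>x\<in>carrier E. \<phi> (c \<odot>\<^bsub>E\<^esub> x) = c * \<phi> x) \<and>
     (\<exists>B. \<forall>x\<in>carrier E. cmod (\<phi> x) \<le> B * nrm E x)}"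

definition dual :: "'a cnspace \<Rightarrow> ('a \<Rightarrow> complex) cnspace" where
  "dual E = \<lparr>carrier = bounded_functionals E,
     mult = undefined, one = undefined,
     zero = (\<lambda>x\<in>carrier E. 0),
     add = (\<lambda>\<phi> \<psi>. \<lambda>x\<in>carrier E. \<phi> x + \<psi> x),
     smult = (\<lambda>c \<phi>. \<lambda>x\<in>carrier E. c * \<phi> x),
     nrm = (\<lambda>\<phi>. Sup {cmod (\<phi> x) |x. x \<in> carrier E \<and> nrm E x \<le> 1})\<rparr>"

definition smooth :: "'a cnspace \<Rightarrow> bool" where
  "smooth E \<longleftrightarrow> (\<forall>\<xi>\<in>carrier E - {\<zero>\<^bsub>E\<^esub>}.
     \<exists>!\<eta>. \<eta> \<in> carrier (dual E) \<and> nrm (dual E) \<eta> = 1 \<and> \<eta> \<xi> = complex_of_real (nrm E \<xi>))"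

definition linear_isometry :: "'a cnspace \<Rightarrow> 'b cnspace \<Rightarrow> ('a \<Rightarrow> 'b) \<Rightarrow> bool" where
  "linear_isometry E F f \<longleftrightarrow> f \<in> carrier E \<rightarrow> carrier F \<and>
     (\<forall>x\<in>carrier E. \<forall>y\<in>carrier E. f (x \<oplus>\<^bsub>E\<^esub> y) = f x \<oplus>\<^bsub>F\<^esub> f y) \<and>
     (\<forall>c. \<forall>x\<in>carrier E. f (c \<odot>\<^bsub>E\<^esub> x) = c \<odot>\<^bsub>F\<^esub> f x) \<and>
     (\<forall>x\<in>carrier E. nrm F (f x) = nrm E x)"

definition isometrically_isomorphic :: "'a cnspace \<Rightarrow> 'b cnspace \<Rightarrow> bool" where
  "isometrically_isomorphic E F \<longleftrightarrow>
     (\<exists>f. linear_isometry E F f \<and> bij_betw f (carrier E) (carrier F))"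

definition closed_subspace :: "'a set \<Rightarrow> 'a cnspace \<Rightarrow> bool" where
  "closed_subspace S E \<longleftrightarrow> submodule S complex_field E \<and> closedin (norm_topology E) S"

definition subspace_of :: "'a cnspace \<Rightarrow> 'a set \<Rightarrow> 'a cnspace" where
  "subspace_of E S = E\<lparr>carrier := S\<rparr>"

definition quotient_space :: "'a cnspace \<Rightarrow> 'a set \<Rightarrow> 'a set cnspace" where
  "quotient_space E N = \<lparr>carrier = a_rcosets\<^bsub>E\<^esub> N,
     mult = undefined, one = undefined,
     zero = N,
     add = set_add E,
     smult = (\<lambda>c A. \<Union>a\<in>A. N +>\<^bsub>E\<^esub> (c \<odot>\<^bsub>E\<^esub> a)),
     nrm = (\<lambda>A. Inf (nrm E ` A))\<rparr>"


section \<open>Spaces \<open>L\<^sub>p\<close> and \<open>QSL\<^sub>p\<close>\<close>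

definition ae_class :: "'x measure \<Rightarrow> ('x \<Rightarrow> complex) \<Rightarrow> ('x \<Rightarrow> complex) set" where
  "ae_class M f = {g \<in> borel_measurable M. AE x in M. g x = f x}"

text \<open>In the norm, all representatives of a class give the same integral.\<close>

definition Lp :: "real \<Rightarrow> 'x measure \<Rightarrow> ('x \<Rightarrow> complex) set cnspace" where
  "Lp p M = \<lparr>carrier = {ae_class M f |f. f \<in> borel_measurable M \<and> integrable M (\<lambda>x. cmod (f x) powr p)},
     mult = undefined, one = undefined,
     zero = ae_class M (\<lambda>_. 0),
     add = (\<lambda>A B. \<Union>f\<in>A. \<Union>g\<in>B. ae_class M (\<lambda>x. f x + g x)),
     smult = (\<lambda>c A. \<Union>f\<in>A. ae_class M (\<lambda>x. c * f x)),
     nrm = (\<lambda>A. the_elem ((\<lambda>f. (\<integral>x. cmod (f x) powr p \<partial>M) powr (1 / p)) ` A))\<rparr>"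

text \<open>The measure space ranges over measures on the same type that carries \<open>E\<close>.\<close>

definition QSLp :: "real \<Rightarrow> 'a cnspace \<Rightarrow> bool" where
  "QSLp p E \<longleftrightarrow> cbanach_space E \<and>
     (\<exists>(M :: 'a measure) S N. closed_subspace S (Lp p M) \<and>
        closed_subspace N (subspace_of (Lp p M) S) \<and>
        isometrically_isomorphic E (quotient_space (subspace_of (Lp p M) S) N))"


section \<open>Hilbert spaces\<close>

text \<open>Inner products are linear in the first and conjugate linear in the second variable.\<close>

definition hilbert_space :: "'a cnspace \<Rightarrow> ('a \<Rightarrow> 'a \<Rightarrow> complex) \<Rightarrow> bool" where
  "hilbert_space H ip \<longleftrightarrow> cbanach_space H \<and>
     (\<forall>x\<in>carrier H. \<forall>y\<in>carrier H. \<forall>z\<in>carrier H. ip (x \<oplus>\<^bsub>H\<^esub> y) z = ip x z + ip y z) \<and>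
     (\<forall>c. \<forall>x\<in>carrier H. \<forall>y\<in>carrier H. ip (c \<odot>\<^bsub>H\<^esub> x) y = c * ip x y) \<and>
     (\<forall>x\<in>carrier H. \<forall>y\<in>carrier H. ip y x = cnj (ip x y)) \<and>
     (\<forall>x\<in>carrier H. ip x x = complex_of_real ((nrm H x)\<^sup>2))"


section \<open>Locally compact groups and Haar measure\<close>

locale locally_compact_group = group G for G :: "('g, 'r) monoid_scheme" (structure) +
  fixes T :: "'g topology"
  assumes topspace_eq: "topspace T = carrier G"
    and continuous_mult: "continuous_map (prod_topology T T) T (\<lambda>(x, y). x \<otimes> y)"
    and continuous_inv: "continuous_map T T (\<lambda>x. inv x)"
    and Hausdorff: "Hausdorff_space T"
    and locally_compact: "locally_compact_space T"

definition left_haar_measure :: "('g, 'r) monoid_scheme \<Rightarrow> 'g topology \<Rightarrow> 'g measure \<Rightarrow> bool" where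
  "left_haar_measure G T \<mu> \<longleftrightarrow>
     space \<mu> = carrier G \<and> sets \<mu> = sigma_sets (carrier G) {U. openin T U} \<and>
     emeasure \<mu> (carrier G) \<noteq> 0 \<and>
     (\<forall>g\<in>carrier G. \<forall>A\<in>sets \<mu>. emeasure \<mu> (g <#\<^bsub>G\<^esub> A) = emeasure \<mu> A) \<and>
     (\<forall>K. compactin T K \<longrightarrow> emeasure \<mu> K < \<infinity>) \<and>
     (\<forall>A\<in>sets \<mu>. emeasure \<mu> A = (INF U\<in>{U. openin T U \<and> A \<subseteq> U}. emeasure \<mu> U)) \<and>
     (\<forall>U. openin T U \<longrightarrow> emeasure \<mu> U = (SUP K\<in>{K. compactin T K \<and> K \<subseteq> U}. emeasure \<mu> K))"

definition open_left_coset :: "('g, 'r) monoid_scheme \<Rightarrow> 'g topology \<Rightarrow> 'g set \<Rightarrow> bool" where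
  "open_left_coset G T C \<longleftrightarrow>
     (\<exists>H a. subgroup H G \<and> openin T H \<and> a \<in> carrier G \<and> C = a <#\<^bsub>G\<^esub> H)"


section \<open>Representations and coefficient functions\<close>

text \<open>\<open>group_action G (carrier E) \<pi>\<close> says that \<open>\<pi>\<close> is a homomorphism from \<open>G\<close> to the
  group of bijections of the carrier.\<close>

definition representation ::
  "('g, 'r) monoid_scheme \<Rightarrow> 'g topology \<Rightarrow> 'a cnspace \<Rightarrow> ('g \<Rightarrow> 'a \<Rightarrow> 'a) \<Rightarrow> bool" where
  "representation G T E \<pi> \<longleftrightarrow> cbanach_space E \<and> group_action G (carrier E) \<pi> \<and>
     (\<forall>x\<in>carrier G. linear_isometry E E (\<pi> x)) \<and>
     (\<forall>\<xi>\<in>carrier E. continuous_map T (norm_topology E) (\<lambda>x. \<pi> x \<xi>))"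

definition normalized_coefficient ::
  "('g, 'r) monoid_scheme \<Rightarrow> 'a cnspace \<Rightarrow> ('g \<Rightarrow> 'a \<Rightarrow> 'a) \<Rightarrow> ('g \<Rightarrow> complex) \<Rightarrow> bool" where
  "normalized_coefficient G E \<pi> u \<longleftrightarrow>
     (\<exists>\<xi>\<in>carrier E. \<exists>\<eta>\<in>carrier (dual E). nrm E \<xi> = 1 \<and> nrm (dual E) \<eta> = 1 \<and>
        (\<forall>x\<in>carrier G. u x = \<eta> (\<pi> x \<xi>)))"

text \<open>
  Below, a first argument of type \<open>'a itself\<close> names the type in which the carriers of the
  Banach spaces live. Functions on \<open>G\<close> are compared on the carrier of \<open>G\<close> only. The norms
  take values in \<open>[0, \<infinity>]\<close>, so that the infimum of the empty set is \<open>\<infinity>\<close>.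
\<close>

definition unitary_representation ::
  "('g, 'r) monoid_scheme \<Rightarrow> 'g topology \<Rightarrow> 'a cnspace \<Rightarrow> ('a \<Rightarrow> 'a \<Rightarrow> complex) \<Rightarrow> ('g \<Rightarrow> 'a \<Rightarrow> 'a) \<Rightarrow> bool" where
  "unitary_representation G T H ip \<pi> \<longleftrightarrow> hilbert_space H ip \<and> representation G T H \<pi> \<and>
     (\<forall>x\<in>carrier G. \<forall>\<xi>\<in>carrier H. \<forall>\<eta>\<in>carrier H. ip (\<pi> x \<xi>) (\<pi> x \<eta>) = ip \<xi> \<eta>)"

definition fourier_stieltjes ::
  "'a itself \<Rightarrow> ('g, 'r) monoid_scheme \<Rightarrow> 'g topology \<Rightarrow> ('g \<Rightarrow> complex) set" where
  "fourier_stieltjes (_ :: 'a itself) G T =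
     {u. \<exists>(H :: 'a cnspace) ip \<pi>. unitary_representation G T H ip \<pi> \<and>
           (\<exists>\<xi>\<in>carrier H. \<exists>\<eta>\<in>carrier H. \<forall>x\<in>carrier G. u x = ip (\<pi> x \<xi>) \<eta>)}"

definition fourier_stieltjes_norm ::
  "'a itself \<Rightarrow> ('g, 'r) monoid_scheme \<Rightarrow> 'g topology \<Rightarrow> ('g \<Rightarrow> complex) \<Rightarrow> ennreal" where
  "fourier_stieltjes_norm (_ :: 'a itself) G T u =
     Inf {ennreal (nrm H \<xi> * nrm H \<eta>) |(H :: 'a cnspace) ip \<pi> \<xi> \<eta>.
            unitary_representation G T H ip \<pi> \<and> \<xi> \<in> carrier H \<and> \<eta> \<in> carrier H \<and>
            (\<forall>x\<in>carrier G. u x = ip (\<pi> x \<xi>) \<eta>)}"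


section \<open>Bochner integral and cyclic representations\<close>

text \<open>The library's \<open>has_bochner_integral\<close>, transcribed to explicit carriers. Measurability is
  asked of \<open>\<parallel>F - s\<^sub>i\<parallel>\<close> only; with convergence in mean, this makes \<open>F\<close> an almost
  everywhere limit of simple functions.\<close>

definition simple_integrable_in :: "'a cnspace \<Rightarrow> 'x measure \<Rightarrow> ('x \<Rightarrow> 'a) \<Rightarrow> bool" where
  "simple_integrable_in E M s \<longleftrightarrow> s \<in> space M \<rightarrow> carrier E \<and> simple_function M s \<and>
     emeasure M {x \<in> space M. s x \<noteq> \<zero>\<^bsub>E\<^esub>} \<noteq> \<infinity>"

definition simple_integral_in :: "'a cnspace \<Rightarrow> 'x measure \<Rightarrow> ('x \<Rightarrow> 'a) \<Rightarrow> 'a" where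
  "simple_integral_in E M s =
     (\<Oplus>\<^bsub>E\<^esub>v\<in>s ` space M. complex_of_real (measure M {x \<in> space M. s x = v}) \<odot>\<^bsub>E\<^esub> v)"

definition has_bochner_integral_in :: "'a cnspace \<Rightarrow> 'x measure \<Rightarrow> ('x \<Rightarrow> 'a) \<Rightarrow> 'a \<Rightarrow> bool" where
  "has_bochner_integral_in E M F v \<longleftrightarrow> F \<in> space M \<rightarrow> carrier E \<and>
     (\<exists>s. (\<forall>i. simple_integrable_in E M (s i)) \<and>
        (\<forall>i. (\<lambda>x. nrm E (F x \<ominus>\<^bsub>E\<^esub> s i x)) \<in> borel_measurable M) \<and>
        (\<lambda>i::nat. \<integral>\<^sup>+x. ennreal (nrm E (F x \<ominus>\<^bsub>E\<^esub> s i x)) \<partial>M) \<longlonglongrightarrow> 0 \<and>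
        limitin (norm_topology E) (\<lambda>i. simple_integral_in E M (s i)) v sequentially)"

text \<open>The set \<open>\<pi>(L\<^sub>1(G))\<xi>\<close>.\<close>

definition L1_orbit ::
  "'g measure \<Rightarrow> 'a cnspace \<Rightarrow> ('g \<Rightarrow> 'a \<Rightarrow> 'a) \<Rightarrow> 'a \<Rightarrow> 'a set" where
  "L1_orbit \<mu> E \<pi> \<xi> = {v. \<exists>f :: 'g \<Rightarrow> complex. integrable \<mu> f \<and>
     has_bochner_integral_in E \<mu> (\<lambda>x. f x \<odot>\<^bsub>E\<^esub> \<pi> x \<xi>) v}"

definition Rep_p ::
  "real \<Rightarrow> ('g, 'r) monoid_scheme \<Rightarrow> 'g topology \<Rightarrow> 'a cnspace \<Rightarrow> ('g \<Rightarrow> 'a \<Rightarrow> 'a) \<Rightarrow> bool" where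
  "Rep_p p G T E \<pi> \<longleftrightarrow> QSLp p E \<and> representation G T E \<pi>"

definition Cyc_p ::
  "real \<Rightarrow> ('g, 'r) monoid_scheme \<Rightarrow> 'g topology \<Rightarrow> 'g measure \<Rightarrow> 'a cnspace \<Rightarrow> ('g \<Rightarrow> 'a \<Rightarrow> 'a) \<Rightarrow> bool" where
  "Cyc_p p G T \<mu> E \<pi> \<longleftrightarrow> Rep_p p G T E \<pi> \<and>
     (\<exists>\<xi>\<^sub>0\<in>carrier E. norm_topology E closure_of L1_orbit \<mu> E \<pi> \<xi>\<^sub>0 = carrier E)"

definition B_p ::
  "'a itself \<Rightarrow> real \<Rightarrow> ('g, 'r) monoid_scheme \<Rightarrow> 'g topology \<Rightarrow> ('g \<Rightarrow> complex) set" where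
  "B_p (_ :: 'a itself) p G T =
     {u. \<exists>(E :: 'a cnspace) \<pi>. Rep_p p G T E \<pi> \<and>
           (\<exists>\<xi>\<in>carrier E. \<exists>\<eta>\<in>carrier (dual E). \<forall>x\<in>carrier G. u x = \<eta> (\<pi> x \<xi>))}"

definition B_p_norm ::
  "'a itself \<Rightarrow> real \<Rightarrow> ('g, 'r) monoid_scheme \<Rightarrow> 'g topology \<Rightarrow> 'g measure \<Rightarrow> ('g \<Rightarrow> complex) \<Rightarrow> ennreal" where
  "B_p_norm (_ :: 'a itself) p G T \<mu> u =
     Inf {ennreal (\<Sum>n. nrm (E n) (\<xi> n) * nrm (dual (E n)) (\<eta> n)) |
            (E :: nat \<Rightarrow> 'a cnspace) \<pi> \<xi> \<eta>.
            (\<forall>n. Cyc_p p G T \<mu> (E n) (\<pi> n) \<and> \<xi> n \<in> carrier (E n) \<and> \<eta> n \<in> carrier (dual (E n))) \<and>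
            summable (\<lambda>n. nrm (E n) (\<xi> n) * nrm (dual (E n)) (\<eta> n)) \<and>
            (\<forall>x\<in>carrier G. (\<lambda>n. \<eta> n (\<pi> n x (\<xi> n))) sums u x)}"

text \<open>
  The type in which Banach spaces are taken. The parameter \<open>'u\<close> is arbitrary, so that spaces of
  any size occur; the left summand keeps the type large enough to contain, for instance, a copy of
  \<open>l\<^sub>p(G/H)\<close> for every subgroup \<open>H\<close>, whatever \<open>'u\<close> is.
\<close>

type_synonym ('g, 'u) universe = "('g \<Rightarrow> complex) + 'u"

end

theory Submission
  imports Defs "HOL-Algebra.Left_Coset"
begin

text \<open>
  If \<open>\<chi>\<^sub>C = \<langle>\<pi>(\<cdot>)\<xi>, \<eta>\<rangle>\<close> is normalized then, for \<open>x \<in> C\<close>, the unit functional \<open>\<pi>(x)\<^sup>*\<eta>\<close> norms \<open>\<xi>\<close> and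
  \<open>\<pi>(x)\<xi>\<close> norms \<open>\<eta>\<close>. Smoothness of \<open>E\<close> (of its dual) makes \<open>\<pi>(x)\<^sup>*\<eta>\<close> (\<open>\<pi>(x)\<xi>\<close>) independent of \<open>x \<in> C\<close>,
  which says that \<open>C\<close> is a coset; it is open by continuity.

  For the norm conditions the infimum need not be attained. If \<open>\<chi>\<^sub>C = \<Sum>\<^sub>n \<langle>\<pi>\<^sub>n(\<cdot>)\<xi>\<^sub>n, \<eta>\<^sub>n\<rangle>\<close> with
  \<open>\<Sum>\<^sub>n \<parallel>\<xi>\<^sub>n\<parallel> \<parallel>\<eta>\<^sub>n\<parallel> \<le> 1 + \<epsilon>\<close> and \<open>x, y \<in> C\<close>, then \<open>\<Sum>\<^sub>n \<parallel>\<pi>\<^sub>n(x)\<xi>\<^sub>n + \<pi>\<^sub>n(y)\<xi>\<^sub>n\<parallel> \<parallel>\<eta>\<^sub>n\<parallel> \<ge> 2\<close>, and uniform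
  convexity, uniform over all \<open>QSL\<^sub>p\<close>-spaces, gives \<open>\<Sum>\<^sub>n \<parallel>\<pi>\<^sub>n(x)\<xi>\<^sub>n - \<pi>\<^sub>n(y)\<xi>\<^sub>n\<parallel> \<parallel>\<eta>\<^sub>n\<parallel> < 1\<close> for small \<open>\<epsilon>\<close>.
  Hence \<open>\<bar>\<chi>\<^sub>C(zx) - \<chi>\<^sub>C(zy)\<bar> < 1\<close> for all \<open>z\<close>, so \<open>zx \<in> C\<close> iff \<open>zy \<in> C\<close>, and \<open>C\<close> is a left coset.

  Conversely, for \<open>C = aH\<close> the function \<open>\<chi>\<^sub>C\<close> is the coefficient of the basis vectors at \<open>H\<close> and \<open>aH\<close>
  in the permutation representation of \<open>G\<close> on \<open>l\<^sub>p(G/H)\<close>, which is cyclic, and unitary for \<open>p = 2\<close>.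
\<close>

section \<open>Normed spaces and representations\<close>

text \<open>The convexity is therefore stated with the defect 2 |x| - |x + y| entering linearly and
  with one constant for all spaces, so that it can be weighted and summed. The indicator takes only
  the values 0 and 1, so an error below 1 already decides membership: approximate invariance becomes
  exact, and one fixed \<epsilon> suffices.

  Both norm conditions also exclude the empty set, for which zero vectors make the infimum 0. In the
  converse direction the lower bound 1 for the norms comes from evaluating at a point of the coset,
  the upper bound from unit basis vectors.

  A space has to live inside a prescribed type, and the measure witnessing that it is a
  \<open>QSLp\<close> space has to live on that same type. This is why \<open>l_p(G/H)\<close> is
  described by coordinates and copied twice, once as vectors and once over a counting measure on
  codes of cosets.\<close>

lemma complex_field_simps [simp]:
  "carrier complex_field = UNIV" "add complex_field = (+)" "monoid.mult complex_field = (*)"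
  "monoid.one complex_field = 1" "ring.zero complex_field = 0"
  by (simp_all add: ring_of_type_algebra_def fun_eq_iff)

lemma complex_field_a_inv [simp]: "a_inv complex_field c = - c"
proof -
  interpret R: cring complex_field by (rule cring_from_type_algebra)
  show ?thesis
    using R.minus_equality[of "-c" c] by simp
qed

section \<open>Norm, metric and topology of a normed space\<close>

context cnormed_space
begin

lemma smult_in_carrier [simp, intro]: "x \<in> carrier E \<Longrightarrow> c \<odot>\<^bsub>E\<^esub> x \<in> carrier E"
  using smult_closed by simp

lemma smult_minus_one: "x \<in> carrier E \<Longrightarrow> (-1) \<odot>\<^bsub>E\<^esub> x = \<ominus>\<^bsub>E\<^esub> x"
  using smult_l_minus[of 1 x] smult_one[of x] by simp

lemma minus_eq_smult: "x \<in> carrier E \<Longrightarrow> y \<in> carrier E \<Longrightarrow> x \<ominus>\<^bsub>E\<^esub> y = x \<oplus>\<^bsub>E\<^esub> (-1) \<odot>\<^bsub>E\<^esub> y"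
  by (simp add: smult_minus_one a_minus_def)

lemma nrm_zero [simp]: "nrm E \<zero>\<^bsub>E\<^esub> = 0"
  using nrm_eq_0_iff by blast

lemma nrm_uminus: "x \<in> carrier E \<Longrightarrow> nrm E (\<ominus>\<^bsub>E\<^esub> x) = nrm E x"
  using nrm_smult[of x "-1"] by (simp add: smult_minus_one)

lemma nrm_minus_commute:
  assumes "x \<in> carrier E" "y \<in> carrier E"
  shows "nrm E (x \<ominus>\<^bsub>E\<^esub> y) = nrm E (y \<ominus>\<^bsub>E\<^esub> x)"
proof -
  have "\<ominus>\<^bsub>E\<^esub> (x \<ominus>\<^bsub>E\<^esub> y) = y \<ominus>\<^bsub>E\<^esub> x"
    using assms by (simp add: a_minus_def M.minus_add M.a_comm)
  then show ?thesis
    using nrm_uminus[of "x \<ominus>\<^bsub>E\<^esub> y"] assms by simp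
qed

lemma nrm_minus_triangle:
  assumes "x \<in> carrier E" "y \<in> carrier E" "z \<in> carrier E"
  shows "nrm E (x \<ominus>\<^bsub>E\<^esub> z) \<le> nrm E (x \<ominus>\<^bsub>E\<^esub> y) + nrm E (y \<ominus>\<^bsub>E\<^esub> z)"
proof -
  have "(\<ominus>\<^bsub>E\<^esub> y) \<oplus>\<^bsub>E\<^esub> (y \<oplus>\<^bsub>E\<^esub> \<ominus>\<^bsub>E\<^esub> z) = \<ominus>\<^bsub>E\<^esub> z"
    using assms by (simp add: M.a_assoc[symmetric] M.l_neg)
  then have "x \<ominus>\<^bsub>E\<^esub> z = (x \<ominus>\<^bsub>E\<^esub> y) \<oplus>\<^bsub>E\<^esub> (y \<ominus>\<^bsub>E\<^esub> z)"
    using assms by (simp add: a_minus_def M.a_assoc)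
  then show ?thesis
    using nrm_triangle[of "x \<ominus>\<^bsub>E\<^esub> y" "y \<ominus>\<^bsub>E\<^esub> z"] assms by simp
qed

lemma nrm_minus_eq_0_iff:
  assumes "x \<in> carrier E" "y \<in> carrier E"
  shows "nrm E (x \<ominus>\<^bsub>E\<^esub> y) = 0 \<longleftrightarrow> x = y"
proof -
  have "x = y" if "x \<ominus>\<^bsub>E\<^esub> y = \<zero>\<^bsub>E\<^esub>"
    using that assms M.minus_equality[of "x" "\<ominus>\<^bsub>E\<^esub> y"] by (simp add: a_minus_def)
  moreover have "y \<ominus>\<^bsub>E\<^esub> y = \<zero>\<^bsub>E\<^esub>"
    using assms by (simp add: a_minus_def M.r_neg)
  ultimately show ?thesis
    using assms nrm_eq_0_iff[of "x \<ominus>\<^bsub>E\<^esub> y"] by auto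
qed

lemma Metric_space_ndist: "Metric_space (carrier E) (ndist E)"
  by unfold_locales
    (auto simp: ndist_def nrm_nonneg nrm_minus_commute nrm_minus_eq_0_iff nrm_minus_triangle)

sublocale metric: Metric_space "carrier E" "ndist E"
  rewrites "Metric_space.mtopology (carrier E) (ndist E) = norm_topology E"
  by (auto simp: Metric_space_ndist norm_topology_def)

lemma topspace_norm_topology [simp]: "topspace (norm_topology E) = carrier E"
  by (rule metric.topspace_mtopology)

text \<open>The norm topology comes from a metric, while the source is an arbitrary topological
  space. This neighbourhood form serves the openness of \<open>C\<close> in one direction and the
  strong continuity of permutation representations in the other.\<close>

lemma continuous_map_norm_topology:
  "continuous_map T (norm_topology E) f \<longleftrightarrow> f \<in> topspace T \<rightarrow> carrier E \<and>
     (\<forall>x\<in>topspace T. \<forall>\<epsilon>>0. \<exists>U. openin T U \<and> x \<in> U \<and> (\<forall>y\<in>U. nrm E (f y \<ominus>\<^bsub>E\<^esub> f x) < \<epsilon>))"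
  (is "_ \<longleftrightarrow> _ \<and> ?C")
proof safe
  assume c: "continuous_map T (norm_topology E) f"
  then show f: "\<And>x. x \<in> topspace T \<Longrightarrow> f x \<in> carrier E"
    by (auto simp: continuous_map_def)
  fix x :: 'b and \<epsilon> :: real assume x: "x \<in> topspace T" and "\<epsilon> > 0"
  have "openin T {y \<in> topspace T. f y \<in> metric.mball (f x) \<epsilon>}"
    by (rule openin_continuous_map_preimage[OF c metric.openin_mball])
  moreover have "x \<in> {y \<in> topspace T. f y \<in> metric.mball (f x) \<epsilon>}"
    using x f \<open>\<epsilon> > 0\<close> by simp
  moreover have "nrm E (f y \<ominus>\<^bsub>E\<^esub> f x) < \<epsilon>" if "y \<in> {y \<in> topspace T. f y \<in> metric.mball (f x) \<epsilon>}" for y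
    using that f x by (auto simp: ndist_def nrm_minus_commute)
  ultimately show "\<exists>U. openin T U \<and> x \<in> U \<and> (\<forall>y\<in>U. nrm E (f y \<ominus>\<^bsub>E\<^esub> f x) < \<epsilon>)"
    by blast
next
  assume f: "f \<in> topspace T \<rightarrow> carrier E" and c: ?C
  show "continuous_map T (norm_topology E) f"
    unfolding continuous_map_def
  proof safe
    fix x assume "x \<in> topspace T"
    then show "f x \<in> topspace (norm_topology E)" using f by auto
  next
    fix V assume V: "openin (norm_topology E) V"
    show "openin T {x \<in> topspace T. f x \<in> V}"
    proof (subst openin_subopen, safe)
      fix x assume x: "x \<in> topspace T" "f x \<in> V"
      then have "\<exists>r>0. metric.mball (f x) r \<subseteq> V"
        using V by (simp only: metric.openin_mtopology)
      then obtain r where r: "r > 0" "metric.mball (f x) r \<subseteq> V" by blast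
      obtain U where U: "openin T U" "x \<in> U" "\<forall>y\<in>U. nrm E (f y \<ominus>\<^bsub>E\<^esub> f x) < r"
        using c[rule_format, OF x(1) r(1)] by blast
      have "f y \<in> V" if "y \<in> U" for y
      proof -
        have "y \<in> topspace T" using U that openin_subset by blast
        then have fy: "f y \<in> carrier E" "f x \<in> carrier E" using f x by auto
        then have "f y \<in> metric.mball (f x) r"
          using U(3) that by (simp add: ndist_def nrm_minus_commute[of "f x"])
        then show ?thesis using r(2) by (rule subsetD[rotated])
      qed
      moreover have "U \<subseteq> topspace T" using U openin_subset by blast
      ultimately show "\<exists>U. openin T U \<and> x \<in> U \<and> U \<subseteq> {x \<in> topspace T. f x \<in> V}"
        using U by blast
    qed
  qed
qed

section \<open>Bounded functionals and the dual norm\<close>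

lemma bounded_functional_add:
  "\<phi> \<in> bounded_functionals E \<Longrightarrow> x \<in> carrier E \<Longrightarrow> y \<in> carrier E \<Longrightarrow> \<phi> (x \<oplus>\<^bsub>E\<^esub> y) = \<phi> x + \<phi> y"
  by (auto simp: bounded_functionals_def)

lemma bounded_functional_smult:
  "\<phi> \<in> bounded_functionals E \<Longrightarrow> x \<in> carrier E \<Longrightarrow> \<phi> (c \<odot>\<^bsub>E\<^esub> x) = c * \<phi> x"
  by (auto simp: bounded_functionals_def)

lemma bounded_functional_diff:
  "\<phi> \<in> bounded_functionals E \<Longrightarrow> x \<in> carrier E \<Longrightarrow> y \<in> carrier E \<Longrightarrow> \<phi> (x \<ominus>\<^bsub>E\<^esub> y) = \<phi> x - \<phi> y"
  by (simp add: minus_eq_smult bounded_functional_add bounded_functional_smult)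

lemma bounded_functional_zero: "\<phi> \<in> bounded_functionals E \<Longrightarrow> \<phi> \<zero>\<^bsub>E\<^esub> = 0"
  using bounded_functional_smult[of \<phi> "\<zero>\<^bsub>E\<^esub>" 0] by simp

lemma carrier_dual [simp]: "carrier (dual E) = bounded_functionals E"
  by (simp add: dual_def)

lemma nrm_dual: "nrm (dual E) \<phi> = Sup {cmod (\<phi> x) |x. x \<in> carrier E \<and> nrm E x \<le> 1}"
  by (simp add: dual_def)

text \<open>\<open>Sup\<close> on the reals is meaningful only for nonempty sets that are bounded
  above; this and the next lemma make the dual norm usable.\<close>

lemma dual_norm_set_nonempty: "{cmod (\<phi> x) |x. x \<in> carrier E \<and> nrm E x \<le> 1} \<noteq> {}"
  using nrm_zero by (auto intro!: exI[of _ "\<zero>\<^bsub>E\<^esub>"])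

lemma dual_norm_set_bdd:
  assumes "\<phi> \<in> bounded_functionals E"
  shows "bdd_above {cmod (\<phi> x) |x. x \<in> carrier E \<and> nrm E x \<le> 1}"
proof -
  obtain B where B: "\<forall>x\<in>carrier E. cmod (\<phi> x) \<le> B * nrm E x"
    using assms by (auto simp: bounded_functionals_def)
  have "cmod (\<phi> x) \<le> \<bar>B\<bar>" if "x \<in> carrier E" "nrm E x \<le> 1" for x
  proof -
    have "cmod (\<phi> x) \<le> \<bar>B\<bar> * nrm E x"
      using B that nrm_nonneg[OF that(1)] by (meson abs_ge_self mult_right_mono order_trans)
    also have "\<dots> \<le> \<bar>B\<bar> * 1" using that by (intro mult_left_mono) auto
    finally show ?thesis by simp
  qed
  then show ?thesis by (auto intro!: bdd_aboveI)
qed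

lemma nrm_dual_nonneg: "\<phi> \<in> bounded_functionals E \<Longrightarrow> 0 \<le> nrm (dual E) \<phi>"
proof -
  assume \<phi>: "\<phi> \<in> bounded_functionals E"
  have "cmod (\<phi> \<zero>\<^bsub>E\<^esub>) \<le> nrm (dual E) \<phi>"
    unfolding nrm_dual by (rule cSup_upper[OF _ dual_norm_set_bdd[OF \<phi>]]) (auto intro!: exI[of _ "\<zero>\<^bsub>E\<^esub>"])
  then show ?thesis using bounded_functional_zero[OF \<phi>] by simp
qed

lemma bounded_functional_le:
  assumes \<phi>: "\<phi> \<in> bounded_functionals E" and x: "x \<in> carrier E"
  shows "cmod (\<phi> x) \<le> nrm (dual E) \<phi> * nrm E x"
proof (cases "nrm E x = 0")
  case True
  then show ?thesis using nrm_eq_0_iff[OF x] bounded_functional_zero[OF \<phi>] by simp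
next
  case False
  then have pos: "nrm E x > 0" using nrm_nonneg[OF x] by simp
  let ?y = "complex_of_real (1 / nrm E x) \<odot>\<^bsub>E\<^esub> x"
  have "nrm E ?y = 1" using pos x by (simp add: nrm_smult norm_divide)
  then have "cmod (\<phi> ?y) \<le> nrm (dual E) \<phi>"
    unfolding nrm_dual using x by (intro cSup_upper[OF _ dual_norm_set_bdd[OF \<phi>]]) auto
  then show ?thesis
    using pos x by (simp add: bounded_functional_smult[OF \<phi>] norm_mult norm_divide field_simps)
qed

lemma nrm_dual_le:
  assumes "\<And>x. x \<in> carrier E \<Longrightarrow> cmod (\<phi> x) \<le> B * nrm E x" and "0 \<le> B"
  shows "nrm (dual E) \<phi> \<le> B"
  unfolding nrm_dual
proof (rule cSup_least[OF dual_norm_set_nonempty])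
  fix z assume "z \<in> {cmod (\<phi> x) |x. x \<in> carrier E \<and> nrm E x \<le> 1}"
  then obtain x where x: "x \<in> carrier E" "nrm E x \<le> 1" "z = cmod (\<phi> x)" by blast
  have "z \<le> B * nrm E x" using assms x by simp
  also have "\<dots> \<le> B * 1" using x assms by (intro mult_left_mono) auto
  finally show "z \<le> B" by simp
qed

lemma bounded_functionalsI:
  assumes "\<And>x y. x \<in> carrier E \<Longrightarrow> y \<in> carrier E \<Longrightarrow> \<phi> (x \<oplus>\<^bsub>E\<^esub> y) = \<phi> x + \<phi> y"
    and "\<And>c x. x \<in> carrier E \<Longrightarrow> \<phi> (c \<odot>\<^bsub>E\<^esub> x) = c * \<phi> x"
    and "\<And>x. x \<in> carrier E \<Longrightarrow> cmod (\<phi> x) \<le> B * nrm E x"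
  shows "restrict \<phi> (carrier E) \<in> bounded_functionals E"
  using assms by (auto simp: bounded_functionals_def intro: exI[of _ B])

end

section \<open>Representations and their coefficient functions\<close>

lemma cbanach_spaceD: "cbanach_space E \<Longrightarrow> cnormed_space E"
  by (simp add: cbanach_space_def)

lemma representationD:
  assumes "representation G T E \<pi>"
  shows "cbanach_space E" "cnormed_space E" "group_action G (carrier E) \<pi>"
    "\<And>x. x \<in> carrier G \<Longrightarrow> linear_isometry E E (\<pi> x)"
    "\<And>\<xi>. \<xi> \<in> carrier E \<Longrightarrow> continuous_map T (norm_topology E) (\<lambda>x. \<pi> x \<xi>)"
    "\<And>x \<xi>. x \<in> carrier G \<Longrightarrow> \<xi> \<in> carrier E \<Longrightarrow> \<pi> x \<xi> \<in> carrier E"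
    "\<And>x \<xi>. x \<in> carrier G \<Longrightarrow> \<xi> \<in> carrier E \<Longrightarrow> nrm E (\<pi> x \<xi>) = nrm E \<xi>"
    "\<And>x \<xi> \<zeta>. x \<in> carrier G \<Longrightarrow> \<xi> \<in> carrier E \<Longrightarrow> \<zeta> \<in> carrier E \<Longrightarrow>
       \<pi> x (\<xi> \<oplus>\<^bsub>E\<^esub> \<zeta>) = \<pi> x \<xi> \<oplus>\<^bsub>E\<^esub> \<pi> x \<zeta>"
    "\<And>x \<xi> c. x \<in> carrier G \<Longrightarrow> \<xi> \<in> carrier E \<Longrightarrow> \<pi> x (c \<odot>\<^bsub>E\<^esub> \<xi>) = c \<odot>\<^bsub>E\<^esub> \<pi> x \<xi>"
    "\<And>x y \<xi>. x \<in> carrier G \<Longrightarrow> y \<in> carrier G \<Longrightarrow> \<xi> \<in> carrier E \<Longrightarrow>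
       \<pi> (x \<otimes>\<^bsub>G\<^esub> y) \<xi> = \<pi> x (\<pi> y \<xi>)"
  using assms group_action.composition_rule[of G "carrier E" \<pi>]
  by (auto simp: representation_def linear_isometry_def cbanach_space_def)

lemma representation_minus:
  assumes "representation G T E \<pi>" "x \<in> carrier G" "\<xi> \<in> carrier E" "\<zeta> \<in> carrier E"
  shows "\<pi> x (\<xi> \<ominus>\<^bsub>E\<^esub> \<zeta>) = \<pi> x \<xi> \<ominus>\<^bsub>E\<^esub> \<pi> x \<zeta>"
proof -
  interpret cnormed_space E using representationD(2)[OF assms(1)] .
  show ?thesis using assms representationD[OF assms(1)] by (simp add: minus_eq_smult)
qed

text \<open>A continuous function with values 0 and 1 is locally constant: a change of modulus below
  1 is no change at all.\<close>

lemma openin_coefficient_eq_1: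
  assumes rep: "representation G T E \<pi>" and T: "topspace T = carrier G"
    and \<xi>: "\<xi> \<in> carrier E" and \<eta>: "\<eta> \<in> bounded_functionals E" and C: "C \<subseteq> carrier G"
    and u: "\<And>x. x \<in> carrier G \<Longrightarrow> indicator C x = \<eta> (\<pi> x \<xi>)"
  shows "openin T C"
proof (subst openin_subopen, safe)
  interpret cnormed_space E using representationD(2)[OF rep] .
  note rep' = representationD[OF rep]
  fix x assume x: "x \<in> C"
  \<comment> \<open>The added 1 makes \<open>B\<close> positive, so that \<open>1 / B\<close> is a
    radius even if \<open>\<eta>\<close> has norm 0.\<close>
  define B where "B = nrm (dual E) \<eta> + 1"
  have B: "B > 0" using nrm_dual_nonneg[OF \<eta>] by (simp add: B_def)
  obtain U where U: "openin T U" "x \<in> U" "\<forall>y\<in>U. nrm E (\<pi> y \<xi> \<ominus>\<^bsub>E\<^esub> \<pi> x \<xi>) < 1 / B"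
  proof -
    have "x \<in> topspace T" "1 / B > 0" using x C T B by auto
    then show ?thesis
      using rep'(5)[OF \<xi>] that unfolding continuous_map_norm_topology by blast
  qed
  have "y \<in> C" if y: "y \<in> U" for y
  proof -
    have yx: "y \<in> carrier G" "x \<in> carrier G" using y U x C T openin_subset by blast+
    have "indicator C y - indicator C x = \<eta> (\<pi> y \<xi> \<ominus>\<^bsub>E\<^esub> \<pi> x \<xi>)"
      using yx \<xi> u rep'(6) by (simp add: bounded_functional_diff[OF \<eta>])
    also have "cmod \<dots> \<le> nrm (dual E) \<eta> * nrm E (\<pi> y \<xi> \<ominus>\<^bsub>E\<^esub> \<pi> x \<xi>)"
      using yx \<xi> rep'(6) by (intro bounded_functional_le[OF \<eta>]) simp
    also have "\<dots> \<le> B * nrm E (\<pi> y \<xi> \<ominus>\<^bsub>E\<^esub> \<pi> x \<xi>)"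
      using yx \<xi> rep'(6) by (intro mult_right_mono nrm_nonneg) (auto simp: B_def)
    also have "\<dots> < 1" using U(3) y B by (simp add: field_simps)
    finally show ?thesis using x by (cases "y \<in> C") auto
  qed
  then show "\<exists>U. openin T U \<and> x \<in> U \<and> U \<subseteq> C" using U by blast
qed

section \<open>Left cosets in a topological group\<close>

context locally_compact_group
begin

lemma continuous_map_left_mult: "a \<in> carrier G \<Longrightarrow> continuous_map T T (\<lambda>x. a \<otimes> x)"
  using continuous_map_compose[OF _ continuous_mult, of T "\<lambda>x. (a, x)"] topspace_eq
  by (simp add: o_def continuous_map_pairedI)

lemma openin_left_coset: 
  assumes "openin T U" "a \<in> carrier G"
  shows "openin T (a <# U)"
proof -
  have U: "U \<subseteq> carrier G" using openin_subset[OF assms(1)] topspace_eq by simp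
  have "a <# U = {x \<in> topspace T. inv a \<otimes> x \<in> U}"
  proof (intro equalityI subsetI)
    fix x assume "x \<in> a <# U"
    then obtain y where "y \<in> U" "x = a \<otimes> y" by (auto simp: l_coset_def)
    then show "x \<in> {x \<in> topspace T. inv a \<otimes> x \<in> U}"
      using assms U topspace_eq by (auto simp: m_assoc[symmetric] subsetD)
  next
    fix x assume x: "x \<in> {x \<in> topspace T. inv a \<otimes> x \<in> U}"
    then have "x = a \<otimes> (inv a \<otimes> x)"
      using assms topspace_eq by (simp add: m_assoc[symmetric])
    then show "x \<in> a <# U" using x by (auto simp: l_coset_def)
  qed
  then show ?thesis
    using openin_continuous_map_preimage[OF continuous_map_left_mult assms(1), of "inv a"] assms by simp
qed

lemma inv_mult_cancel: "x \<in> carrier G \<Longrightarrow> y \<in> carrier G \<Longrightarrow> inv x \<otimes> (x \<otimes> y) = y"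
  by (simp add: m_assoc[symmetric])

text \<open>The hypothesis says that the set S of all \<open>z\<close> with
  \<open>z \<otimes> x \<in> C\<close> is the same for every \<open>x\<close> in \<open>C\<close>.
  This makes S closed under products and inverses, and \<open>H\<close> is its conjugate by
  \<open>c\<close>. Both sources of such invariance, smoothness and uniform convexity, end
  here.\<close>

lemma open_left_cosetI:
  assumes C: "openin T C" "c \<in> C"
    and inv: "\<And>x y z. x \<in> C \<Longrightarrow> y \<in> C \<Longrightarrow> z \<in> carrier G \<Longrightarrow> z \<otimes> x \<in> C \<Longrightarrow> z \<otimes> y \<in> C"
  shows "open_left_coset G T C"
proof -
  have sub: "C \<subseteq> carrier G" using openin_subset[OF C(1)] topspace_eq by simp
  have c: "c \<in> carrier G" using C sub by blast
  define H where "H = inv c <# C"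
  have memH: "h \<in> H \<longleftrightarrow> h \<in> carrier G \<and> c \<otimes> h \<in> C" for h
  proof
    assume "h \<in> H"
    then obtain x where "x \<in> C" "h = inv c \<otimes> x" by (auto simp: H_def l_coset_def)
    then show "h \<in> carrier G \<and> c \<otimes> h \<in> C"
      using c sub by (auto simp: m_assoc[symmetric] subsetD)
  next
    assume h: "h \<in> carrier G \<and> c \<otimes> h \<in> C"
    then have "h = inv c \<otimes> (c \<otimes> h)" using c by (simp add: m_assoc[symmetric])
    then show "h \<in> H" using h by (auto simp: H_def l_coset_def)
  qed
  have "subgroup H G"
  proof (rule subgroupI)
    show "H \<subseteq> carrier G" using memH by blast
    show "H \<noteq> {}" using memH[of \<one>] c C by auto
    fix h assume h: "h \<in> H"
    then have h': "h \<in> carrier G" "c \<otimes> h \<in> C" using memH by auto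
    \<comment> \<open>The multiplier \<open>c \<otimes> inv h \<otimes> inv c\<close> carries
      \<open>c \<otimes> h\<close> to \<open>c\<close>, hence it must also carry \<open>c\<close>
      into \<open>C\<close>.\<close>
    have "c \<otimes> inv h \<otimes> inv c \<otimes> (c \<otimes> h) = c"
      using h' c by (simp add: m_assoc inv_mult_cancel)
    moreover have "c \<otimes> inv h \<otimes> inv c \<otimes> c = c \<otimes> inv h"
      using h' c by (simp add: m_assoc)
    ultimately have "c \<otimes> inv h \<in> C"
      using inv[of "c \<otimes> h" c "c \<otimes> inv h \<otimes> inv c"] h' C c by simp
    then show "inv h \<in> H" using h' memH by simp
    fix k assume "k \<in> H"
    then have k: "k \<in> carrier G" "c \<otimes> k \<in> C" using memH by auto
    \<comment> \<open>Here the multiplier is \<open>c \<otimes> h \<otimes> inv c\<close>: it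
      carries \<open>c\<close> to \<open>c \<otimes> h\<close>, hence also
      \<open>c \<otimes> k\<close> into \<open>C\<close>.\<close>
    have "c \<otimes> h \<otimes> inv c \<otimes> c = c \<otimes> h"
      using h' c by (simp add: m_assoc)
    moreover have "c \<otimes> h \<otimes> inv c \<otimes> (c \<otimes> k) = c \<otimes> h \<otimes> k"
      using h' c k by (simp add: m_assoc inv_mult_cancel)
    ultimately have "c \<otimes> h \<otimes> k \<in> C"
      using inv[of c "c \<otimes> k" "c \<otimes> h \<otimes> inv c"] h' k C c by simp
    then show "h \<otimes> k \<in> H" using h' k c memH by (simp add: m_assoc)
  qed
  moreover have "openin T H" unfolding H_def using C c by (intro openin_left_coset) auto
  moreover have "C = c <# H"
  proof (intro equalityI subsetI)
    fix x assume x: "x \<in> C"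
    then have "x = c \<otimes> (inv c \<otimes> x)" using c sub by (simp add: m_assoc[symmetric] subsetD)
    moreover have "inv c \<otimes> x \<in> H" using x by (auto simp: H_def l_coset_def)
    ultimately show "x \<in> c <# H" by (auto simp: l_coset_def)
  qed (auto simp: l_coset_def memH)
  ultimately show ?thesis using c unfolding open_left_coset_def by blast
qed

end

section \<open>Uniform convexity of \<open>QSL\<^sub>p\<close>-spaces\<close>

text \<open>Strict convexity of the power function: its graph lies above the tangent at 1. The point
  0 is treated apart because the derivative is taken at positive points only.\<close>

lemma powr_Bernoulli_strict:
  fixes x p :: real
  assumes "0 \<le> x" "x \<noteq> 1" "1 < p"
  shows "1 + p * (x - 1) < x powr p"
proof -
  have D: "((\<lambda>z. z powr p) has_real_derivative p * z powr (p - 1)) (at z)" if "0 < z" for z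
    using has_real_derivative_powr[OF that] .
  consider "x = 0" | "0 < x" "x < 1" | "1 < x" using assms by linarith
  then show ?thesis
  proof cases
    case 1
    then show ?thesis using assms by simp
  next
    case 2
    then obtain z where z: "x < z" "z < 1" "1 powr p - x powr p = (1 - x) * (p * z powr (p - 1))"
      using MVT2[of x 1 "\<lambda>z. z powr p" "\<lambda>z. p * z powr (p - 1)"] D by auto
    have "z powr (p - 1) < 1 powr (p - 1)"
      using z 2 assms by (intro powr_less_mono2) auto
    then have "(1 - x) * (p * z powr (p - 1)) < (1 - x) * (p * 1)"
      using 2 assms by (intro mult_strict_left_mono) auto
    then show ?thesis using z by (simp add: algebra_simps)
  next
    case 3
    then obtain z where z: "1 < z" "z < x" "x powr p - 1 powr p = (x - 1) * (p * z powr (p - 1))"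
      using MVT2[of 1 x "\<lambda>z. z powr p" "\<lambda>z. p * z powr (p - 1)"] D by auto
    have "1 powr (p - 1) < z powr (p - 1)"
      using z assms by (intro powr_less_mono2) auto
    then have "(x - 1) * (p * 1) < (x - 1) * (p * z powr (p - 1))"
      using 3 assms by (intro mult_strict_left_mono) auto
    then show ?thesis using z by (simp add: algebra_simps)
  qed
qed

lemma powr_Bernoulli:
  fixes x p :: real
  assumes "0 \<le> x" "1 < p"
  shows "1 + p * (x - 1) \<le> x powr p"
  using powr_Bernoulli_strict[of x p] assms by (cases "x = 1") auto

text \<open>After division by the midpoint \<open>m\<close> both arguments are compared with the
  tangent at 1; the linear terms cancel because \<open>s / m + t / m = 2\<close>.\<close>

lemma powr_midpoint_strict:
  fixes s t p :: real
  assumes "0 \<le> s" "0 \<le> t" "s \<noteq> t" "1 < p"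
  shows "((s + t) / 2) powr p < (s powr p + t powr p) / 2"
proof -
  define m where "m = (s + t) / 2"
  have m: "m > 0" using assms by (simp add: m_def)
  have "s / m \<noteq> 1" "t / m \<noteq> 1" using m assms by (auto simp: m_def field_simps)
  then have "1 + p * (s / m - 1) < (s / m) powr p" "1 + p * (t / m - 1) < (t / m) powr p"
    using assms m by (auto intro!: powr_Bernoulli_strict)
  moreover have "s / m + t / m = 2"
  proof -
    have "s + t = 2 * m" by (simp add: m_def)
    then show ?thesis using m unfolding add_divide_distrib[symmetric] by simp
  qed
  then have "p * (s / m + t / m) = p * 2" by simp
  then have "1 + p * (s / m - 1) + (1 + p * (t / m - 1)) = 2"
    by (simp add: algebra_simps)
  ultimately have "2 < s powr p / m powr p + t powr p / m powr p"
    using m assms by (simp add: powr_divide)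
  then show ?thesis
    using m by (simp add: field_simps flip: m_def)
qed

text \<open>Strictness has two sources. If the moduli agree, the parallelogram identity makes the
  midpoint strictly shorter; if they differ, the power function is strictly convex.\<close>

lemma cmod_powr_midpoint_strict:
  fixes a b :: complex
  assumes "a \<noteq> b" "1 < p"
  shows "cmod ((a + b) / 2) powr p < (cmod a powr p + cmod b powr p) / 2"
proof (cases "cmod a = cmod b")
  case True
  have "(cmod (a + b))\<^sup>2 + (cmod (a - b))\<^sup>2 = 2 * (cmod a)\<^sup>2 + 2 * (cmod b)\<^sup>2"
    unfolding cmod_power2 by (simp add: power2_eq_square algebra_simps)
  moreover have "(cmod (a - b))\<^sup>2 > 0" using assms by simp
  ultimately have "(cmod (a + b))\<^sup>2 < 4 * (cmod a)\<^sup>2" unfolding True by linarith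
  then have "(cmod (a + b))\<^sup>2 < (2 * cmod a)\<^sup>2" by (simp add: power_mult_distrib)
  then have "cmod (a + b) < 2 * cmod a" by (rule power_less_imp_less_base) simp
  then have "cmod ((a + b) / 2) < cmod a" by (simp add: norm_divide)
  then have "cmod ((a + b) / 2) powr p < cmod a powr p"
    using assms by (intro powr_less_mono2) auto
  then show ?thesis using True by simp
next
  case False
  have "cmod ((a + b) / 2) powr p \<le> ((cmod a + cmod b) / 2) powr p"
    using assms norm_triangle_ineq[of a b] by (intro powr_mono2) (auto simp: norm_divide)
  also have "\<dots> < (cmod a powr p + cmod b powr p) / 2"
    using False assms by (intro powr_midpoint_strict) auto
  finally show ?thesis .
qed

lemma cmod_powr_midpoint:
  fixes a b :: complex
  assumes "1 < p"
  shows "cmod ((a + b) / 2) powr p \<le> (cmod a powr p + cmod b powr p) / 2"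
  using cmod_powr_midpoint_strict[of a b p] assms by (cases "a = b") auto

text \<open>
  Uniform convexity in a form linear in \<open>p\<close>-th powers of norms, with the only negative term
  \<open>\<bar>a + b\<bar>\<close>: the inequality can then be integrated, and it passes to quotients because representatives
  only increase norms.
\<close>

definition midpoint_bound :: "real \<Rightarrow> real \<Rightarrow> real \<Rightarrow> bool" where
  "midpoint_bound p \<epsilon> K \<longleftrightarrow> (\<forall>a b :: complex. cmod (a - b) powr p \<le>
     \<epsilon> * (cmod a powr p + cmod b powr p) +
     K * ((cmod a powr p + cmod b powr p) / 2 - cmod ((a + b) / 2) powr p))"

text \<open>Compactness turns strict convexity into a uniform estimate. Everything is homogeneous of
  degree \<open>p\<close>, so it is enough to treat pairs whose p-th powers of moduli add up to
  1.\<close>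

lemma midpoint_bound_exists:
  assumes p: "1 < p" and \<epsilon>: "0 < \<epsilon>"
  shows "\<exists>K\<ge>0. midpoint_bound p \<epsilon> K"
proof -
  let ?N = "\<lambda>a b :: complex. cmod a powr p + cmod b powr p"
  let ?F = "\<lambda>a b :: complex. ?N a b / 2 - cmod ((a + b) / 2) powr p"
  have F: "0 \<le> ?F a b" for a b using cmod_powr_midpoint[OF p, of a b] by simp
  have le1: "cmod a \<le> 1" if "cmod a powr p \<le> 1" for a :: complex
    using that p gr_one_powr[of "cmod a" p] by (intro leI) linarith
  have le2: "cmod (a - b) powr p \<le> 2 powr p" if "?N a b = 1" for a b
  proof -
    have "cmod a powr p \<le> 1" "cmod b powr p \<le> 1"
      using that powr_ge_zero[of "cmod a" p] powr_ge_zero[of "cmod b" p] by linarith+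
    then have "cmod (a - b) \<le> 2"
      using le1[of a] le1[of b] norm_triangle_ineq4[of a b] by linarith
    then show ?thesis using p by (intro powr_mono2) auto
  qed
  \<comment> \<open>Pairs in \<open>D\<close> are normalised and stay apart, so the convexity defect
    is positive on \<open>D\<close> and, by compactness, bounded away from 0.\<close>
  define D where "D = {z :: complex \<times> complex. ?N (fst z) (snd z) = 1 \<and> \<epsilon> \<le> cmod (fst z - snd z) powr p}"
  have "\<exists>K\<ge>0. \<forall>a b. ?N a b = 1 \<longrightarrow> cmod (a - b) powr p \<le> \<epsilon> + K * ?F a b"
  proof (cases "D = {}")
    case True
    then have "cmod (a - b) powr p \<le> \<epsilon>" if "?N a b = 1" for a b
      using that by (force simp: D_def)
    then show ?thesis by (intro exI[of _ 0]) auto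
  next
    case False
    have "closed D"
      unfolding D_def Collect_conj_eq using p
      by (intro closed_Int closed_Collect_eq closed_Collect_le continuous_intros continuous_on_powr') auto
    moreover have "bounded D"
    proof (rule boundedI)
      fix z assume "z \<in> D"
      then have "cmod (fst z) powr p \<le> 1" "cmod (snd z) powr p \<le> 1"
        using powr_ge_zero[of "cmod (fst z)" p] powr_ge_zero[of "cmod (snd z)" p]
        unfolding D_def mem_Collect_eq by linarith+
      then have "cmod (fst z) \<le> 1" "cmod (snd z) \<le> 1" using le1 by blast+
      then show "norm z \<le> 2" using norm_Pair_le[of "fst z" "snd z"] by simp
    qed
    ultimately have "compact D" by (simp add: compact_eq_bounded_closed)
    moreover have "continuous_on D (\<lambda>z. ?F (fst z) (snd z))"
      using p by (intro continuous_intros continuous_on_powr') auto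
    ultimately have "\<exists>z\<in>D. \<forall>w\<in>D. ?F (fst z) (snd z) \<le> ?F (fst w) (snd w)"
      using False by (intro continuous_attains_inf)
    then obtain z where z: "z \<in> D" "\<And>w. w \<in> D \<Longrightarrow> ?F (fst z) (snd z) \<le> ?F (fst w) (snd w)"
      by blast
    define m where "m = ?F (fst z) (snd z)"
    have "fst z \<noteq> snd z" using z(1) \<epsilon> p by (auto simp: D_def)
    then have m: "m > 0" using cmod_powr_midpoint_strict[OF _ p, of "fst z" "snd z"] by (simp add: m_def)
    \<comment> \<open>On \<open>D\<close> the defect is at least \<open>m\<close> and the left side
      at most \<open>2 powr p\<close>, so the defect term alone suffices; off \<open>D\<close> the
      term \<open>\<epsilon>\<close> does.\<close>
    have "cmod (a - b) powr p \<le> \<epsilon> + 2 powr p / m * ?F a b" if N: "?N a b = 1" for a b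
    proof (cases "(a, b) \<in> D")
      case True
      then have "m \<le> ?F a b" using z(2)[of "(a, b)"] by (simp add: m_def)
      then have "2 powr p / m * m \<le> 2 powr p / m * ?F a b"
        using m by (intro mult_left_mono) auto
      then show ?thesis using le2[OF N] m \<epsilon> by simp
    next
      case False
      then have "cmod (a - b) powr p \<le> \<epsilon>" using N by (auto simp: D_def)
      moreover have "0 \<le> 2 powr p / m * ?F a b"
        using m F by (intro mult_nonneg_nonneg) auto
      ultimately show ?thesis by linarith
    qed
    then show ?thesis using m by (intro exI[of _ "2 powr p / m"]) auto
  qed
  then obtain K where K: "0 \<le> K"
    "\<And>a b. ?N a b = 1 \<Longrightarrow> cmod (a - b) powr p \<le> \<epsilon> + K * ?F a b" by blast
  have "cmod (a - b) powr p \<le> \<epsilon> * ?N a b + K * ?F a b" for a b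
  proof (cases "?N a b = 0")
    case True
    then have "cmod a powr p = 0" "cmod b powr p = 0"
      using powr_ge_zero[of "cmod a" p] powr_ge_zero[of "cmod b" p] by linarith+
    then have "a = 0" "b = 0" by auto
    then show ?thesis by simp
  next
    case False
    define N where "N = ?N a b"
    have N: "N > 0"
      using False powr_ge_zero[of "cmod a" p] powr_ge_zero[of "cmod b" p] unfolding N_def by linarith
    \<comment> \<open>Scaling by \<open>1 / t\<close> divides each p-th power by \<open>N\<close>
      and so reduces to the normalised case.\<close>
    define t where "t = N powr (1 / p)"
    have t: "t > 0" "t powr p = N" using N p by (auto simp: t_def powr_powr)
    have sc: "cmod (x / complex_of_real t) powr p = cmod x powr p / N" for x
      using t by (simp add: norm_divide powr_divide)
    have "?N (a / t) (b / t) = 1" using N by (simp add: sc flip: add_divide_distrib N_def)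
    note K(2)[OF this]
    moreover have "a / t - b / t = (a - b) / t" "(a / t + b / t) / 2 = ((a + b) / 2) / t"
      by (simp_all add: diff_divide_distrib add_divide_distrib mult.commute)
    ultimately have "cmod (a - b) powr p / N \<le>
        \<epsilon> + K * ((cmod a powr p / N + cmod b powr p / N) / 2 - cmod ((a + b) / 2) powr p / N)"
      by (simp only: sc)
    then have "cmod (a - b) powr p / N * N \<le>
        (\<epsilon> + K * ((cmod a powr p / N + cmod b powr p / N) / 2 - cmod ((a + b) / 2) powr p / N)) * N"
      using N by (intro mult_right_mono) auto
    also have "\<dots> = \<epsilon> * N + K * ((cmod a powr p + cmod b powr p) / 2 - cmod ((a + b) / 2) powr p)"
      using N by (simp add: field_simps)
    finally show ?thesis using N by (simp add: N_def)
  qed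
  then show ?thesis using K(1) unfolding midpoint_bound_def by blast
qed

section \<open>The operations and the norm of \<open>Lp\<close> on representatives\<close>

lemma ae_class_self: "f \<in> borel_measurable M \<Longrightarrow> f \<in> ae_class M f"
  by (simp add: ae_class_def)

lemma ae_class_cong: "AE x in M. f x = g x \<Longrightarrow> ae_class M f = ae_class M g"
  unfolding ae_class_def by (intro Collect_cong conj_cong refl) (auto elim: AE_mp)

lemma nrm_Lp:
  assumes f: "f \<in> borel_measurable M"
  shows "nrm (Lp p M) (ae_class M f) = (\<integral>x. cmod (f x) powr p \<partial>M) powr (1 / p)"
proof -
  have "(\<integral>x. cmod (g x) powr p \<partial>M) = (\<integral>x. cmod (f x) powr p \<partial>M)" if "g \<in> ae_class M f" for g
    using that f unfolding ae_class_def by (intro integral_cong_AE) auto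
  then have "(\<lambda>f. (\<integral>x. cmod (f x) powr p \<partial>M) powr (1 / p)) ` ae_class M f
      = (\<lambda>_. (\<integral>x. cmod (f x) powr p \<partial>M) powr (1 / p)) ` ae_class M f"
    by (intro image_cong) simp_all
  also have "\<dots> = {(\<integral>x. cmod (f x) powr p \<partial>M) powr (1 / p)}"
    by (rule image_constant[OF ae_class_self[OF f]])
  finally have "(\<lambda>f. (\<integral>x. cmod (f x) powr p \<partial>M) powr (1 / p)) ` ae_class M f
      = {(\<integral>x. cmod (f x) powr p \<partial>M) powr (1 / p)}" .
  then show ?thesis by (simp add: Lp_def)
qed

lemma add_Lp:
  assumes f: "f \<in> borel_measurable M" and g: "g \<in> borel_measurable M"
  shows "ae_class M f \<oplus>\<^bsub>Lp p M\<^esub> ae_class M g = ae_class M (\<lambda>x. f x + g x)"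
proof -
  have "ae_class M (\<lambda>x. f' x + g' x) = ae_class M (\<lambda>x. f x + g x)"
    if "f' \<in> ae_class M f" "g' \<in> ae_class M g" for f' g'
    using that unfolding ae_class_def[of M f] ae_class_def[of M g] by (intro ae_class_cong) auto
  then have "(\<Union>f'\<in>ae_class M f. \<Union>g'\<in>ae_class M g. ae_class M (\<lambda>x. f' x + g' x))
      = (\<Union>f'\<in>ae_class M f. \<Union>g'\<in>ae_class M g. ae_class M (\<lambda>x. f x + g x))"
    by (intro SUP_cong refl)
  also have "\<dots> = ae_class M (\<lambda>x. f x + g x)"
    using ae_class_self[OF f] ae_class_self[OF g] by (subst UN_constant, subst UN_constant) auto
  finally show ?thesis by (simp add: Lp_def)
qed

lemma smult_Lp:
  assumes f: "f \<in> borel_measurable M"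
  shows "c \<odot>\<^bsub>Lp p M\<^esub> ae_class M f = ae_class M (\<lambda>x. c * f x)"
proof -
  have "ae_class M (\<lambda>x. c * f' x) = ae_class M (\<lambda>x. c * f x)" if "f' \<in> ae_class M f" for f'
    using that unfolding ae_class_def[of M f] by (intro ae_class_cong) auto
  then have "(\<Union>f'\<in>ae_class M f. ae_class M (\<lambda>x. c * f' x))
      = (\<Union>f'\<in>ae_class M f. ae_class M (\<lambda>x. c * f x))"
    by (intro SUP_cong refl)
  also have "\<dots> = ae_class M (\<lambda>x. c * f x)"
    using ae_class_self[OF f] by (subst UN_constant) auto
  finally show ?thesis by (simp add: Lp_def)
qed

lemma carrier_Lp:
  "carrier (Lp p M) = {ae_class M f |f. f \<in> borel_measurable M \<and> integrable M (\<lambda>x. cmod (f x) powr p)}"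
  by (simp add: Lp_def)

lemma zero_Lp: "\<zero>\<^bsub>Lp p M\<^esub> = ae_class M (\<lambda>_. 0)"
  by (simp add: Lp_def)

text \<open>A crude constant is enough here: the purpose is to dominate the p-th power of a sum by
  an integrable function.\<close>

lemma cmod_add_powr_le:
  fixes a b :: complex
  assumes "0 \<le> p"
  shows "cmod (a + b) powr p \<le> 2 powr p * (cmod a powr p + cmod b powr p)"
proof -
  have "cmod (a + b) powr p \<le> (2 * max (cmod a) (cmod b)) powr p"
    using norm_triangle_ineq[of a b] assms by (intro powr_mono2) auto
  also have "\<dots> = 2 powr p * max (cmod a) (cmod b) powr p"
    by (subst powr_mult) auto
  also have "\<dots> \<le> 2 powr p * (cmod a powr p + cmod b powr p)"
    by (intro mult_left_mono) (auto simp: max_def)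
  finally show ?thesis .
qed

lemma integrable_cmod_add_powr:
  fixes f g :: "'a \<Rightarrow> complex"
  assumes "0 \<le> p" "f \<in> borel_measurable M" "g \<in> borel_measurable M"
    and "integrable M (\<lambda>x. cmod (f x) powr p)" "integrable M (\<lambda>x. cmod (g x) powr p)"
  shows "integrable M (\<lambda>x. cmod (f x + g x) powr p)"
proof (rule Bochner_Integration.integrable_bound)
  show "integrable M (\<lambda>x. 2 powr p * (cmod (f x) powr p + cmod (g x) powr p))"
    using assms by simp
  show "(\<lambda>x. cmod (f x + g x) powr p) \<in> borel_measurable M"
    using assms by measurable
  show "AE x in M. norm (cmod (f x + g x) powr p) \<le> norm (2 powr p * (cmod (f x) powr p + cmod (g x) powr p))"
    using cmod_add_powr_le[OF assms(1)] by simp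
qed

lemma integral_midpoint_bound:
  fixes f g :: "'a \<Rightarrow> complex"
  assumes p: "1 < p" and K: "midpoint_bound p \<epsilon> K"
    and f: "f \<in> borel_measurable M" "integrable M (\<lambda>x. cmod (f x) powr p)"
    and g: "g \<in> borel_measurable M" "integrable M (\<lambda>x. cmod (g x) powr p)"
  shows "(\<integral>x. cmod (f x - g x) powr p \<partial>M) \<le>
     \<epsilon> * ((\<integral>x. cmod (f x) powr p \<partial>M) + (\<integral>x. cmod (g x) powr p \<partial>M)) +
     K * (((\<integral>x. cmod (f x) powr p \<partial>M) + (\<integral>x. cmod (g x) powr p \<partial>M)) / 2
       - (\<integral>x. cmod (f x + g x) powr p \<partial>M) / 2 powr p)"
proof -
  have i1: "integrable M (\<lambda>x. cmod (f x + g x) powr p)"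
    using p f g by (intro integrable_cmod_add_powr) auto
  have i2: "integrable M (\<lambda>x. cmod (f x - g x) powr p)"
    using integrable_cmod_add_powr[of p f M "\<lambda>x. - g x"] p f g by simp
  have "(\<integral>x. cmod (f x - g x) powr p \<partial>M) \<le> (\<integral>x. \<epsilon> * (cmod (f x) powr p + cmod (g x) powr p) +
      K * ((cmod (f x) powr p + cmod (g x) powr p) / 2 - cmod (f x + g x) powr p / 2 powr p) \<partial>M)"
  proof (rule integral_mono[OF i2])
    fix x
    have "cmod ((f x + g x) / 2) powr p = cmod (f x + g x) powr p / 2 powr p"
      by (simp add: norm_divide powr_divide)
    then show "cmod (f x - g x) powr p \<le> \<epsilon> * (cmod (f x) powr p + cmod (g x) powr p) +
      K * ((cmod (f x) powr p + cmod (g x) powr p) / 2 - cmod (f x + g x) powr p / 2 powr p)"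
      using K unfolding midpoint_bound_def by metis
  qed (use f g i1 in simp)
  also have "\<dots> = \<epsilon> * ((\<integral>x. cmod (f x) powr p \<partial>M) + (\<integral>x. cmod (g x) powr p \<partial>M)) +
     K * (((\<integral>x. cmod (f x) powr p \<partial>M) + (\<integral>x. cmod (g x) powr p \<partial>M)) / 2
       - (\<integral>x. cmod (f x + g x) powr p \<partial>M) / 2 powr p)"
    using f g i1 by simp
  finally show ?thesis .
qed

text \<open>The quotient norm is an infimum over a coset and need not be attained, so
  representatives within \<open>\<delta>\<close> are chosen and \<open>\<delta>\<close> tends to 0.
  The signs fit: the norm of \<open>a - b\<close> dominates that of \<open>x - y\<close> on the
  left, and the norm of \<open>a + b\<close>, which is subtracted on the right, dominates that of
  \<open>x + y\<close>.\<close>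

lemma QSLp_midpoint_bound:
  assumes p: "1 < p" and E: "QSLp p E" and K: "midpoint_bound p \<epsilon> K" "0 \<le> K" "0 \<le> \<epsilon>"
    and x: "x \<in> carrier E" and y: "y \<in> carrier E"
  shows "nrm E (x \<ominus>\<^bsub>E\<^esub> y) powr p \<le> \<epsilon> * (nrm E x powr p + nrm E y powr p)
     + K * ((nrm E x powr p + nrm E y powr p) / 2 - nrm E (x \<oplus>\<^bsub>E\<^esub> y) powr p / 2 powr p)"
proof -
  from E obtain M :: "'a measure" and S N f where S: "closed_subspace S (Lp p M)"
    and N: "closed_subspace N (subspace_of (Lp p M) S)"
    and f: "linear_isometry E (quotient_space (subspace_of (Lp p M) S) N) f"
    unfolding QSLp_def isometrically_isomorphic_def by blast
  interpret cnormed_space E using E by (simp add: QSLp_def cbanach_spaceD)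
  let ?L = "Lp p M"
  let ?Q = "quotient_space (subspace_of ?L S) N"
  have S: "submodule S complex_field ?L" using S by (simp add: closed_subspace_def)
  have N: "submodule N complex_field (subspace_of ?L S)" using N by (simp add: closed_subspace_def)
  have Ssub: "S \<subseteq> carrier ?L"
    using subgroup.subset[OF submodule.axioms(1)[OF S]] by simp
  have Sadd: "a \<oplus>\<^bsub>?L\<^esub> b \<in> S" if "a \<in> S" "b \<in> S" for a b
    using subgroup.m_closed[OF submodule.axioms(1)[OF S]] that by simp
  have Nsub: "N \<subseteq> S"
    using subgroup.subset[OF submodule.axioms(1)[OF N]] by (simp add: subspace_of_def)
  have N0: "\<zero>\<^bsub>?L\<^esub> \<in> N"
    using subgroup.one_closed[OF submodule.axioms(1)[OF N]] by (simp add: subspace_of_def)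
  have Q: "carrier ?Q = {{n \<oplus>\<^bsub>?L\<^esub> s |n. n \<in> N} |s. s \<in> S}" "add ?Q = (\<lambda>A B. {a \<oplus>\<^bsub>?L\<^esub> b |a b. a \<in> A \<and> b \<in> B})"
    "smult ?Q = (\<lambda>c A. {n \<oplus>\<^bsub>?L\<^esub> c \<odot>\<^bsub>?L\<^esub> a |n a. n \<in> N \<and> a \<in> A})" "nrm ?Q = (\<lambda>A. Inf (nrm ?L ` A))"
    by (auto simp: quotient_space_def subspace_of_def A_RCOSETS_def RCOSETS_def a_r_coset_def r_coset_def
        set_add_def set_mult_def fun_eq_iff)
  have cL: "\<exists>h. a = ae_class M h \<and> h \<in> borel_measurable M \<and> integrable M (\<lambda>x. cmod (h x) powr p)"
    if "a \<in> S" for a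
    using that Ssub by (auto simp: carrier_Lp)
  have nonneg: "0 \<le> nrm ?L a" if "a \<in> S" for a
    using cL[OF that] by (auto simp: nrm_Lp)
  have bdd: "bdd_below (nrm ?L ` A)" if "A \<subseteq> S" for A
    using nonneg that by (auto intro!: bdd_belowI[of _ 0])
  have fS: "f z \<subseteq> S" "f z \<noteq> {}" if "z \<in> carrier E" for z
  proof -
    have "f z \<in> carrier ?Q" using f that by (auto simp: linear_isometry_def)
    then obtain s where s: "s \<in> S" "f z = {n \<oplus>\<^bsub>?L\<^esub> s |n. n \<in> N}" unfolding Q by blast
    show "f z \<subseteq> S" unfolding s using Sadd s Nsub by auto
    show "f z \<noteq> {}" unfolding s using N0 by blast
  qed
  have nrm_f: "nrm E z = Inf (nrm ?L ` f z)" if "z \<in> carrier E" for z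
    using f that unfolding linear_isometry_def Q(4) by auto
  have near: "\<exists>a\<in>f z. nrm ?L a < nrm E z + \<delta>" if "z \<in> carrier E" "0 < \<delta>" for z \<delta>
    using cInf_lessD[of "nrm ?L ` f z" "nrm E z + \<delta>"] nrm_f[OF that(1)] fS[OF that(1)] that by auto
  \<comment> \<open>The bound as a function of the norms of the two representatives; the norm of the
    sum in it is already that of \<open>E\<close>.\<close>
  define R where "R = (\<lambda>s t. \<epsilon> * (s powr p + t powr p)
     + K * ((s powr p + t powr p) / 2 - nrm E (x \<oplus>\<^bsub>E\<^esub> y) powr p / 2 powr p))"
  have main: "nrm E (x \<ominus>\<^bsub>E\<^esub> y) powr p \<le> R (nrm E x + \<delta>) (nrm E y + \<delta>)" if \<delta>: "0 < \<delta>" for \<delta>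
  proof -
    obtain a b where a: "a \<in> f x" "nrm ?L a < nrm E x + \<delta>" and b: "b \<in> f y" "nrm ?L b < nrm E y + \<delta>"
      using near[OF x \<delta>] near[OF y \<delta>] by blast
    have abS: "a \<in> S" "b \<in> S" using a b fS x y by blast+
    obtain u where u: "a = ae_class M u" "u \<in> borel_measurable M" "integrable M (\<lambda>x. cmod (u x) powr p)"
      using cL[OF abS(1)] by blast
    obtain v where v: "b = ae_class M v" "v \<in> borel_measurable M" "integrable M (\<lambda>x. cmod (v x) powr p)"
      using cL[OF abS(2)] by blast
    let ?I = "\<lambda>h :: 'a \<Rightarrow> complex. \<integral>x. cmod (h x) powr p \<partial>M"
    have pow: "nrm ?L (ae_class M h) powr p = ?I h" if "h \<in> borel_measurable M" for h
      using that p by (simp add: nrm_Lp powr_powr)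
    have "f (x \<oplus>\<^bsub>E\<^esub> y) = {a \<oplus>\<^bsub>?L\<^esub> b |a b. a \<in> f x \<and> b \<in> f y}"
      using f x y unfolding linear_isometry_def Q(2) by auto
    moreover have "ae_class M (\<lambda>x. u x + v x) = a \<oplus>\<^bsub>?L\<^esub> b"
      using u v by (simp add: add_Lp)
    ultimately have "ae_class M (\<lambda>x. u x + v x) \<in> f (x \<oplus>\<^bsub>E\<^esub> y)"
      using a(1) b(1) by blast
    then have "nrm E (x \<oplus>\<^bsub>E\<^esub> y) \<le> nrm ?L (ae_class M (\<lambda>x. u x + v x))"
      using x y fS by (subst nrm_f) (auto intro!: cINF_lower bdd)
    then have s: "nrm E (x \<oplus>\<^bsub>E\<^esub> y) powr p \<le> ?I (\<lambda>x. u x + v x)"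
      using p x y u v nrm_nonneg by (subst pow[symmetric]) (auto intro!: powr_mono2)
    \<comment> \<open>A scalar multiple of a coset absorbs \<open>N\<close> again, so the difference
      of \<open>a\<close> and \<open>b\<close> is reached through the zero of
      \<open>N\<close>.\<close>
    have "f (x \<ominus>\<^bsub>E\<^esub> y) = {a \<oplus>\<^bsub>?L\<^esub> b |a b. a \<in> f x \<and> b \<in> {n \<oplus>\<^bsub>?L\<^esub> (-1) \<odot>\<^bsub>?L\<^esub> a |n a. n \<in> N \<and> a \<in> f y}}"
      using f x y unfolding minus_eq_smult[OF x y] linear_isometry_def Q(2,3) by auto
    moreover have "ae_class M (\<lambda>x. u x - v x) = a \<oplus>\<^bsub>?L\<^esub> (\<zero>\<^bsub>?L\<^esub> \<oplus>\<^bsub>?L\<^esub> (-1) \<odot>\<^bsub>?L\<^esub> b)"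
      using u v by (simp add: zero_Lp smult_Lp add_Lp)
    ultimately have "ae_class M (\<lambda>x. u x - v x) \<in> f (x \<ominus>\<^bsub>E\<^esub> y)"
      using a(1) b(1) N0 by blast
    then have "nrm E (x \<ominus>\<^bsub>E\<^esub> y) \<le> nrm ?L (ae_class M (\<lambda>x. u x - v x))"
      using x y fS by (subst nrm_f) (auto intro!: cINF_lower bdd)
    then have "nrm E (x \<ominus>\<^bsub>E\<^esub> y) powr p \<le> ?I (\<lambda>x. u x - v x)"
      using p x y u v nrm_nonneg by (subst pow[symmetric]) (auto intro!: powr_mono2)
    also have "\<dots> \<le> \<epsilon> * (?I u + ?I v) + K * ((?I u + ?I v) / 2 - ?I (\<lambda>x. u x + v x) / 2 powr p)"
      using u v by (intro integral_midpoint_bound p K) auto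
    also have "\<dots> \<le> \<epsilon> * (?I u + ?I v) + K * ((?I u + ?I v) / 2 - nrm E (x \<oplus>\<^bsub>E\<^esub> y) powr p / 2 powr p)"
      using s K by (intro add_left_mono mult_left_mono diff_left_mono divide_right_mono) auto
    also have "\<dots> \<le> R (nrm E x + \<delta>) (nrm E y + \<delta>)"
    proof -
      have "?I u \<le> (nrm E x + \<delta>) powr p" "?I v \<le> (nrm E y + \<delta>) powr p"
        using a b u v p nonneg abS by (auto simp flip: pow intro!: powr_mono2)
      then show ?thesis unfolding R_def using K
        by (intro add_mono mult_left_mono diff_right_mono divide_right_mono) auto
    qed
    finally show ?thesis .
  qed
  have "((\<lambda>\<delta>. R (nrm E x + \<delta>) (nrm E y + \<delta>)) \<longlongrightarrow> R (nrm E x + 0) (nrm E y + 0)) (at_right 0)"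
  proof -
    have "((\<lambda>\<delta>. (nrm E z + \<delta>) powr p) \<longlongrightarrow> (nrm E z + 0) powr p) (at_right 0)" if z: "z \<in> carrier E" for z
      using p nrm_nonneg[OF z]
      by (intro tendsto_powr2 tendsto_intros) (auto simp: eventually_at_right_less intro!: eventually_mono[OF eventually_at_right_less])
    then show ?thesis unfolding R_def using x y
      by (intro tendsto_add tendsto_mult tendsto_diff tendsto_divide tendsto_const) auto
  qed
  moreover have "\<forall>\<^sub>F \<delta> in at_right 0. nrm E (x \<ominus>\<^bsub>E\<^esub> y) powr p \<le> R (nrm E x + \<delta>) (nrm E y + \<delta>)"
    using main by (auto intro!: eventually_mono[OF eventually_at_right_less])
  ultimately have "nrm E (x \<ominus>\<^bsub>E\<^esub> y) powr p \<le> R (nrm E x + 0) (nrm E y + 0)"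
    by (intro tendsto_lowerbound) auto
  then show ?thesis by (simp add: R_def)
qed

text \<open>A modulus of convexity in linear form: the inequality survives multiplication by a dual
  norm and summation over many spaces with the same constants. Vectors of equal norm are the
  relevant ones, since both will be images of one vector under isometries.\<close>

definition convexity_constant :: "real \<Rightarrow> real \<Rightarrow> 'a cnspace \<Rightarrow> bool" where
  "convexity_constant \<delta> K E \<longleftrightarrow> (\<forall>x\<in>carrier E. \<forall>y\<in>carrier E. nrm E x = nrm E y \<longrightarrow>
     nrm E (x \<ominus>\<^bsub>E\<^esub> y) \<le> \<delta> * nrm E x + K * (2 * nrm E x - nrm E (x \<oplus>\<^bsub>E\<^esub> y)))"

text \<open>\<open>K\<close> precedes the quantifier over \<open>E\<close>, which is the uniformity
  that a series of unrelated spaces requires. The passage from p-th powers to norms rests on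
  \<open>1 - \<sigma> powr p \<le> p * (1 - \<sigma>)\<close>.\<close>

lemma QSLp_uniformly_convex:
  assumes p: "1 < p" and \<delta>: "0 < \<delta>"
  shows "\<exists>K\<ge>0. \<forall>E :: 'a cnspace. QSLp p E \<longrightarrow> convexity_constant \<delta> K E"
proof -
  \<comment> \<open>With this \<open>\<epsilon>\<close> the first term of the bound is half of
    \<open>(\<delta> * r) powr p\<close>; if the distance exceeds \<open>\<delta> * r\<close>, the
    other half must come from the convexity defect.\<close>
  define \<epsilon> where "\<epsilon> = \<delta> powr p / 4"
  have "\<epsilon> > 0" using \<delta> by (simp add: \<epsilon>_def)
  then obtain K where K: "0 \<le> K" "midpoint_bound p \<epsilon> K"
    using midpoint_bound_exists[OF p] by blast
  \<comment> \<open>Chosen so that \<open>\<delta> powr p / 2 \<le> K * (p * (1 - \<sigma>))\<close>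
    becomes \<open>1 \<le> K' * (1 - \<sigma>)\<close>.\<close>
  define K' where "K' = 2 * p * K / \<delta> powr p"
  have K': "0 \<le> K'" using K p \<delta> by (simp add: K'_def)
  have "nrm E (x \<ominus>\<^bsub>E\<^esub> y) \<le> \<delta> * nrm E x + K' * (2 * nrm E x - nrm E (x \<oplus>\<^bsub>E\<^esub> y))"
    if E: "QSLp p E" and x: "x \<in> carrier E" and y: "y \<in> carrier E" and xy: "nrm E x = nrm E y"
    for E :: "'a cnspace" and x y
  proof -
    interpret cnormed_space E using E by (simp add: QSLp_def cbanach_spaceD)
    define r where "r = nrm E x"
    have r: "0 \<le> r" using x nrm_nonneg by (simp add: r_def)
    define d where "d = nrm E (x \<ominus>\<^bsub>E\<^esub> y)"
    define s where "s = nrm E (x \<oplus>\<^bsub>E\<^esub> y)"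
    have ds: "0 \<le> d" "0 \<le> s" using x y nrm_nonneg by (auto simp: d_def s_def)
    have s2: "s \<le> 2 * r" using nrm_triangle[OF x y] xy by (simp add: s_def r_def)
    have d2: "d \<le> 2 * r"
      using nrm_triangle[of x "\<ominus>\<^bsub>E\<^esub> y"] x y xy nrm_uminus[OF y] by (simp add: d_def r_def a_minus_def)
    have main: "d powr p \<le> \<epsilon> * (r powr p + r powr p) + K * (r powr p - s powr p / 2 powr p)"
      using QSLp_midpoint_bound[OF p E K(2,1) less_imp_le[OF \<open>\<epsilon> > 0\<close>] x y] xy
      by (simp add: d_def r_def s_def)
    have "d \<le> \<delta> * r + K' * (2 * r - s)"
    proof (cases "d \<le> \<delta> * r")
      case True
      then show ?thesis using K' s2 by (simp add: add_increasing2)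
    next
      case False
      then have rpos: "r > 0" using d2 r ds by (cases "r = 0") auto
      \<comment> \<open>\<open>\<sigma>\<close> is the norm of the sum relative to its largest
        possible value \<open>2 * r\<close>. Once \<open>1 \<le> K' * (1 - \<sigma>)\<close>, the
        defect term alone is at least \<open>2 * r\<close>, hence at least \<open>d\<close>.\<close>
      define \<sigma> where "\<sigma> = s / (2 * r)"
      have \<sigma>: "0 \<le> \<sigma>" "s = 2 * r * \<sigma>" using rpos ds by (auto simp: \<sigma>_def)
      have "(\<delta> * r) powr p \<le> d powr p" using False \<delta> r p by (intro powr_mono2) auto
      then have "\<delta> powr p * r powr p \<le> d powr p" using \<delta> r by (simp add: powr_mult)
      also have "\<dots> \<le> \<delta> powr p / 2 * r powr p + K * (r powr p - s powr p / 2 powr p)"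
        using main by (simp add: \<epsilon>_def)
      also have "s powr p / 2 powr p = r powr p * \<sigma> powr p"
        using \<sigma> rpos by (simp add: powr_mult)
      finally have "r powr p * (\<delta> powr p / 2) \<le> r powr p * (K * (1 - \<sigma> powr p))"
        by (simp add: algebra_simps)
      then have "\<delta> powr p / 2 \<le> K * (1 - \<sigma> powr p)"
        using rpos by (subst (asm) mult_le_cancel_left_pos) auto
      also have "\<dots> \<le> K * (p * (1 - \<sigma>))"
        using powr_Bernoulli[OF \<sigma>(1) p] K by (intro mult_left_mono) (auto simp: algebra_simps)
      finally have "1 \<le> K' * (1 - \<sigma>)"
        using \<delta> by (simp add: K'_def field_simps)
      then have "2 * r * 1 \<le> 2 * r * (K' * (1 - \<sigma>))" using r by (intro mult_left_mono) auto
      also have "\<dots> = K' * (2 * r - s)" using \<sigma> by (simp add: algebra_simps)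
      finally show ?thesis using d2 \<delta> r by (simp add: add_increasing)
    qed
    then show ?thesis by (simp add: d_def r_def s_def)
  qed
  then show ?thesis using K' unfolding convexity_constant_def by blast
qed

text \<open>A series of coefficients with one convexity constant covers both norm conditions. For an
  individual \<open>n\<close> the defect \<open>2 * w n - t n\<close> may be large compared with
  \<open>w n\<close>; what is controlled is the sum of the defects, at most
  \<open>2 * \<epsilon>\<close>, and therefore the defect has to enter linearly.\<close>

lemma almost_invariant_coefficients:
  assumes rep: "\<And>n::nat. representation G T (E n) (\<pi> n)" and C: "C \<subseteq> carrier G" and G: "group G"
    and \<xi>: "\<And>n. \<xi> n \<in> carrier (E n)" and \<eta>: "\<And>n. \<eta> n \<in> bounded_functionals (E n)"
    and convex: "\<And>n. convexity_constant (1/4) K (E n)" and K: "0 \<le> K"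
    and sm: "summable (\<lambda>n. nrm (E n) (\<xi> n) * nrm (dual (E n)) (\<eta> n))"
    and le: "(\<Sum>n. nrm (E n) (\<xi> n) * nrm (dual (E n)) (\<eta> n)) \<le> 1 + \<epsilon>" "\<epsilon> \<le> 1" "8 * K * \<epsilon> \<le> 1"
    and u: "\<And>x. x \<in> carrier G \<Longrightarrow> (\<lambda>n. \<eta> n (\<pi> n x (\<xi> n))) sums indicator C x"
    and xyz: "x \<in> C" "y \<in> C" "z \<in> carrier G" "z \<otimes>\<^bsub>G\<^esub> x \<in> C"
  shows "z \<otimes>\<^bsub>G\<^esub> y \<in> C"
proof (rule ccontr)
  assume neg: "z \<otimes>\<^bsub>G\<^esub> y \<notin> C"
  interpret G: group G by fact
  have [simp]: "x \<in> carrier G" "y \<in> carrier G" "z \<in> carrier G" using xyz C by auto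
  define w where "w = (\<lambda>n. nrm (E n) (\<xi> n) * nrm (dual (E n)) (\<eta> n))"
  define h where "h = (\<lambda>n. nrm (dual (E n)) (\<eta> n))"
  define a where "a = (\<lambda>n. \<pi> n x (\<xi> n))"
  define b where "b = (\<lambda>n. \<pi> n y (\<xi> n))"
  define t where "t = (\<lambda>n. h n * nrm (E n) (a n \<oplus>\<^bsub>E n\<^esub> b n))"
  define d where "d = (\<lambda>n. h n * nrm (E n) (a n \<ominus>\<^bsub>E n\<^esub> b n))"
  have ab: "a n \<in> carrier (E n)" "b n \<in> carrier (E n)"
    "nrm (E n) (a n) = nrm (E n) (\<xi> n)" "nrm (E n) (b n) = nrm (E n) (\<xi> n)" for n
    using representationD(6,7)[OF rep _ \<xi>] by (auto simp: a_def b_def)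
  have N: "cnormed_space (E n)" for n using representationD(2)[OF rep] .
  have h: "0 \<le> h n" for n using cnormed_space.nrm_dual_nonneg[OF N \<eta>] by (simp add: h_def)
  have whn: "w n = nrm (E n) (\<xi> n) * h n" for n by (simp add: w_def h_def)
  have t0: "0 \<le> t n" "t n \<le> 2 * w n" for n
  proof -
    interpret cnormed_space "E n" by (rule N)
    show "0 \<le> t n" using h[of n] ab(1,2)[of n] by (auto simp: t_def intro!: mult_nonneg_nonneg nrm_nonneg)
    have "t n \<le> h n * (nrm (E n) (a n) + nrm (E n) (b n))"
      unfolding t_def using h[of n] nrm_triangle[OF ab(1,2)[of n]] by (intro mult_left_mono) auto
    then show "t n \<le> 2 * w n" by (simp add: ab whn algebra_simps)
  qed
  have d0: "0 \<le> d n" "d n \<le> w n / 4 + K * (2 * w n - t n)" for n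
  proof -
    interpret cnormed_space "E n" by (rule N)
    show "0 \<le> d n" using h[of n] ab(1,2)[of n] by (auto simp: d_def intro!: mult_nonneg_nonneg nrm_nonneg)
    have "nrm (E n) (a n \<ominus>\<^bsub>E n\<^esub> b n) \<le> 1/4 * nrm (E n) (a n)
        + K * (2 * nrm (E n) (a n) - nrm (E n) (a n \<oplus>\<^bsub>E n\<^esub> b n))"
      using convex[of n, unfolded convexity_constant_def, THEN bspec, THEN bspec, THEN mp, OF ab(1,2)[of n]]
      by (simp add: ab)
    then have "d n \<le> h n * (1/4 * nrm (E n) (a n)
        + K * (2 * nrm (E n) (a n) - nrm (E n) (a n \<oplus>\<^bsub>E n\<^esub> b n)))"
      unfolding d_def using h[of n] by (intro mult_left_mono)
    then show "d n \<le> w n / 4 + K * (2 * w n - t n)"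
      by (simp add: ab whn t_def algebra_simps)
  qed
  have smw: "summable w" using sm by (simp add: w_def)
  have smt: "summable t"
    using summable_comparison_test[of t "\<lambda>n. 2 * w n"] t0 smw by (auto intro: summable_mult)
  have smb: "summable (\<lambda>n. w n / 4 + K * (2 * w n - t n))"
    using smw smt by (intro summable_add summable_mult summable_diff summable_divide)
  have smd: "summable d"
    using summable_comparison_test[of d "\<lambda>n. w n / 4 + K * (2 * w n - t n)"] d0 smb by auto
  \<comment> \<open>The values of \<open>\<eta> n\<close> at \<open>a n\<close> and at
    \<open>b n\<close> each sum to 1, as \<open>x\<close> and \<open>y\<close> lie in
    \<open>C\<close>.\<close>
  have "2 \<le> suminf t"
  proof -
    have "(\<lambda>n. \<eta> n (a n) + \<eta> n (b n)) sums (indicator C x + indicator C y)"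
      unfolding a_def b_def by (intro sums_add u) auto
    then have s: "(\<lambda>n. \<eta> n (a n \<oplus>\<^bsub>E n\<^esub> b n)) sums (2::complex)"
      using xyz cnormed_space.bounded_functional_add[OF N \<eta> ab(1,2)] by simp
    have le: "norm (\<eta> n (a n \<oplus>\<^bsub>E n\<^esub> b n)) \<le> t n" for n
    proof -
      interpret cnormed_space "E n" by (rule N)
      show ?thesis
        unfolding t_def h_def using ab(1,2)[of n] by (intro bounded_functional_le \<eta>) auto
    qed
    then have "norm (\<Sum>n. \<eta> n (a n \<oplus>\<^bsub>E n\<^esub> b n)) \<le> suminf t"
      by (intro norm_suminf_le smt)
    then show ?thesis using sums_unique[OF s] by simp
  qed
  have "suminf d \<le> (\<Sum>n. w n / 4 + K * (2 * w n - t n))"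
    using d0 smd smb by (intro suminf_le) auto
  also have "\<dots> = suminf w / 4 + K * (2 * suminf w - suminf t)"
    using smw smt
    by (simp add: suminf_add[symmetric] suminf_mult suminf_diff[symmetric] suminf_divide summable_mult summable_diff summable_divide)
  \<comment> \<open>By \<open>\<epsilon> \<le> 1\<close> the first term is at most 1/2, by
    \<open>8 * K * \<epsilon> \<le> 1\<close> the second is at most 1/4.\<close>
  also have "\<dots> \<le> (1 + \<epsilon>) / 4 + K * (2 * (1 + \<epsilon>) - 2)"
    using le \<open>2 \<le> suminf t\<close> K by (intro add_mono mult_left_mono) (auto simp: w_def)
  also have "\<dots> = (1 + \<epsilon>) / 4 + (8 * K * \<epsilon>) / 4" by (simp add: algebra_simps)
  also have "\<dots> < 1"
  proof -
    have "(1 + s) / 4 + t / 4 < 1" if "s \<le> 1" "t \<le> 1" for s t :: real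
      using that by (simp add: field_simps)
    then show ?thesis using le(2,3) by blast
  qed
  finally have "suminf d < 1" .
  \<comment> \<open>The isometries \<open>\<pi> n z\<close> preserve the norms of the differences,
    yet the resulting series is the indicator at \<open>z \<otimes> x\<close> minus the indicator at
    \<open>z \<otimes> y\<close>, which is 1 under the assumption to be refuted.\<close>
  moreover have "1 \<le> suminf d"
  proof -
    have "(\<lambda>n. \<eta> n (\<pi> n (z \<otimes>\<^bsub>G\<^esub> x) (\<xi> n)) - \<eta> n (\<pi> n (z \<otimes>\<^bsub>G\<^esub> y) (\<xi> n)))
        sums (indicator C (z \<otimes>\<^bsub>G\<^esub> x) - indicator C (z \<otimes>\<^bsub>G\<^esub> y))"
      by (intro sums_diff u) auto
    moreover have e: "\<eta> n (\<pi> n (z \<otimes>\<^bsub>G\<^esub> x) (\<xi> n)) - \<eta> n (\<pi> n (z \<otimes>\<^bsub>G\<^esub> y) (\<xi> n))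
        = \<eta> n (\<pi> n z (a n \<ominus>\<^bsub>E n\<^esub> b n))" for n
    proof -
      interpret cnormed_space "E n" by (rule N)
      have "\<pi> n z (a n \<ominus>\<^bsub>E n\<^esub> b n) = \<pi> n (z \<otimes>\<^bsub>G\<^esub> x) (\<xi> n) \<ominus>\<^bsub>E n\<^esub> \<pi> n (z \<otimes>\<^bsub>G\<^esub> y) (\<xi> n)"
        using representation_minus[OF rep _ ab(1,2), of z n] representationD(10)[OF rep _ _ \<xi>]
        by (simp add: a_def b_def)
      then show ?thesis
        using bounded_functional_diff[OF \<eta>] representationD(6)[OF rep _ \<xi>] by simp
    qed
    ultimately have s: "(\<lambda>n. \<eta> n (\<pi> n z (a n \<ominus>\<^bsub>E n\<^esub> b n))) sums (1::complex)"
      using neg xyz by simp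
    have "norm (\<eta> n (\<pi> n z (a n \<ominus>\<^bsub>E n\<^esub> b n))) \<le> d n" for n
    proof -
      interpret cnormed_space "E n" by (rule N)
      have "a n \<ominus>\<^bsub>E n\<^esub> b n \<in> carrier (E n)" using ab by simp
      then show ?thesis
        using bounded_functional_le[OF \<eta>, of "\<pi> n z (a n \<ominus>\<^bsub>E n\<^esub> b n)"] representationD(6,7)[OF rep]
        by (simp add: d_def h_def)
    qed
    then have "norm (\<Sum>n. \<eta> n (\<pi> n z (a n \<ominus>\<^bsub>E n\<^esub> b n))) \<le> suminf d"
      by (intro norm_suminf_le smd)
    then show ?thesis using sums_unique[OF s] by simp
  qed
  ultimately show False by simp
qed

section \<open>Hilbert spaces\<close>

lemma hilbert_spaceD:
  assumes "hilbert_space H ip"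
  shows "cbanach_space H" "cnormed_space H"
    "\<And>x y z. x \<in> carrier H \<Longrightarrow> y \<in> carrier H \<Longrightarrow> z \<in> carrier H \<Longrightarrow> ip (x \<oplus>\<^bsub>H\<^esub> y) z = ip x z + ip y z"
    "\<And>c x y. x \<in> carrier H \<Longrightarrow> y \<in> carrier H \<Longrightarrow> ip (c \<odot>\<^bsub>H\<^esub> x) y = c * ip x y"
    "\<And>x y. x \<in> carrier H \<Longrightarrow> y \<in> carrier H \<Longrightarrow> ip y x = cnj (ip x y)"
    "\<And>x. x \<in> carrier H \<Longrightarrow> ip x x = complex_of_real ((nrm H x)\<^sup>2)"
  using assms unfolding hilbert_space_def cbanach_space_def by blast+

lemma hilbert_space_right:
  assumes H: "hilbert_space H ip"
  shows "\<And>x y z. x \<in> carrier H \<Longrightarrow> y \<in> carrier H \<Longrightarrow> z \<in> carrier H \<Longrightarrow> ip x (y \<oplus>\<^bsub>H\<^esub> z) = ip x y + ip x z"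
    "\<And>c x y. x \<in> carrier H \<Longrightarrow> y \<in> carrier H \<Longrightarrow> ip x (c \<odot>\<^bsub>H\<^esub> y) = cnj c * ip x y"
proof -
  interpret cnormed_space H by (rule hilbert_spaceD(2)[OF H])
  show "ip x (y \<oplus>\<^bsub>H\<^esub> z) = ip x y + ip x z" if "x \<in> carrier H" "y \<in> carrier H" "z \<in> carrier H" for x y z
  proof -
    have "ip x (y \<oplus>\<^bsub>H\<^esub> z) = cnj (ip (y \<oplus>\<^bsub>H\<^esub> z) x)" using that by (intro hilbert_spaceD(5)[OF H]) auto
    also have "\<dots> = cnj (ip y x) + cnj (ip z x)" using that by (simp add: hilbert_spaceD(3)[OF H])
    also have "\<dots> = ip x y + ip x z"
      using that hilbert_spaceD(5)[OF H, of y x] hilbert_spaceD(5)[OF H, of z x] by simp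
    finally show ?thesis .
  qed
  show "ip x (c \<odot>\<^bsub>H\<^esub> y) = cnj c * ip x y" if "x \<in> carrier H" "y \<in> carrier H" for x y c
  proof -
    have "ip x (c \<odot>\<^bsub>H\<^esub> y) = cnj (ip (c \<odot>\<^bsub>H\<^esub> y) x)" using that by (intro hilbert_spaceD(5)[OF H]) auto
    also have "\<dots> = cnj c * cnj (ip y x)" using that by (simp add: hilbert_spaceD(4)[OF H])
    also have "\<dots> = cnj c * ip x y" using that hilbert_spaceD(5)[OF H, of y x] by simp
    finally show ?thesis .
  qed
qed

text \<open>One expansion yields the Cauchy-Schwarz inequality, the parallelogram law
  (\<open>k = 1\<close> and \<open>k = -1\<close>) and the smoothness of Hilbert spaces.\<close>

lemma hilbert_norm_expand:
  assumes H: "hilbert_space H ip" and x: "x \<in> carrier H" and y: "y \<in> carrier H"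
  shows "(nrm H (x \<oplus>\<^bsub>H\<^esub> k \<odot>\<^bsub>H\<^esub> y))\<^sup>2 = (nrm H x)\<^sup>2 + 2 * Re (k * ip y x) + (cmod k)\<^sup>2 * (nrm H y)\<^sup>2"
proof -
  interpret cnormed_space H by (rule hilbert_spaceD(2)[OF H])
  have "complex_of_real ((nrm H (x \<oplus>\<^bsub>H\<^esub> k \<odot>\<^bsub>H\<^esub> y))\<^sup>2)
      = ip x x + cnj k * ip x y + k * ip y x + k * cnj k * ip y y"
    using x y
    by (simp add: hilbert_spaceD(6)[OF H, symmetric] hilbert_spaceD(3,4)[OF H] hilbert_space_right[OF H] algebra_simps
        del: of_real_power)
  also have "cnj k * ip x y = cnj (k * ip y x)"
    using hilbert_spaceD(5)[OF H y x] by simp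
  finally have "Re (complex_of_real ((nrm H (x \<oplus>\<^bsub>H\<^esub> k \<odot>\<^bsub>H\<^esub> y))\<^sup>2))
      = Re (ip x x + cnj (k * ip y x) + k * ip y x + k * cnj k * ip y y)"
    by (simp only:)
  then show ?thesis
    unfolding hilbert_spaceD(6)[OF H x] hilbert_spaceD(6)[OF H y] complex_norm_square[symmetric] by simp
qed

lemma hilbert_Cauchy_Schwarz:
  assumes H: "hilbert_space H ip" and x: "x \<in> carrier H" and y: "y \<in> carrier H"
  shows "cmod (ip x y) \<le> nrm H x * nrm H y"
proof -
  interpret cnormed_space H by (rule hilbert_spaceD(2)[OF H])
  show ?thesis
  proof (cases "nrm H x = 0")
    case True
    then have "x = \<zero>\<^bsub>H\<^esub>" using x nrm_eq_0_iff by simp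
    then have "ip x y = ip (0 \<odot>\<^bsub>H\<^esub> x) y" using x smult_l_null[of x] by simp
    then show ?thesis using True x y by (simp add: hilbert_spaceD(4)[OF H])
  next
    case False
    define N where "N = (nrm H x)\<^sup>2"
    have N: "N > 0" using False by (simp add: N_def)
    \<comment> \<open>With this \<open>k\<close> the combination of \<open>y\<close> with
      \<open>k\<close> times \<open>x\<close> is orthogonal to \<open>x\<close>.\<close>
    define k where "k = - cnj (ip x y) / N"
    have "0 \<le> (nrm H (y \<oplus>\<^bsub>H\<^esub> k \<odot>\<^bsub>H\<^esub> x))\<^sup>2" by simp
    also have "\<dots> = (nrm H y)\<^sup>2 + 2 * Re (k * ip x y) + (cmod k)\<^sup>2 * N"
      using hilbert_norm_expand[OF H y x] by (simp add: N_def)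
    also have "k * ip x y = - complex_of_real ((cmod (ip x y))\<^sup>2 / N)"
      using complex_norm_square[of "ip x y"] by (simp add: k_def mult.commute)
    also have "cmod k = cmod (ip x y) / N" using N by (simp add: k_def norm_divide)
    finally have "0 \<le> (nrm H y)\<^sup>2 - (cmod (ip x y))\<^sup>2 / N"
      using N by (simp add: power_divide power2_eq_square)
    then have "(cmod (ip x y))\<^sup>2 \<le> (nrm H x * nrm H y)\<^sup>2"
      using N by (simp add: field_simps power_mult_distrib N_def)
    then show ?thesis
      by (rule power2_le_imp_le) (simp add: x y nrm_nonneg)
  qed
qed

lemma hilbert_functional:
  assumes H: "hilbert_space H ip" and y: "y \<in> carrier H"
  shows "(\<lambda>x\<in>carrier H. ip x y) \<in> bounded_functionals H"
    and "nrm (dual H) (\<lambda>x\<in>carrier H. ip x y) \<le> nrm H y"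
proof -
  interpret cnormed_space H by (rule hilbert_spaceD(2)[OF H])
  show "(\<lambda>x\<in>carrier H. ip x y) \<in> bounded_functionals H"
    using y hilbert_spaceD(3,4)[OF H] hilbert_Cauchy_Schwarz[OF H]
    by (intro bounded_functionalsI[where B = "nrm H y"]) (auto simp: mult.commute)
  show "nrm (dual H) (\<lambda>x\<in>carrier H. ip x y) \<le> nrm H y"
    using y hilbert_Cauchy_Schwarz[OF H] by (intro nrm_dual_le nrm_nonneg) (auto simp: mult.commute)
qed

text \<open>The parallelogram law gives \<open>d^2 = (2r - s)(2r + s) \<le> 4r(2r - s)\<close>, and
  the right side is \<open>4AB\<close> for \<open>A = r/4\<close> and \<open>B = 4(2r - s)\<close>,
  hence at most \<open>(A + B)^2\<close>. The two constants are therefore reciprocal. The direct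
  argument avoids identifying an abstract Hilbert space with an L_2-space.\<close>

lemma hilbert_convexity_constant:
  assumes H: "hilbert_space H ip"
  shows "convexity_constant (1/4) 4 H"
  unfolding convexity_constant_def
proof (intro ballI impI)
  interpret cnormed_space H by (rule hilbert_spaceD(2)[OF H])
  fix x y assume x: "x \<in> carrier H" and y: "y \<in> carrier H" and xy: "nrm H x = nrm H y"
  have par: "(nrm H (x \<ominus>\<^bsub>H\<^esub> y))\<^sup>2 = 4 * (nrm H x)\<^sup>2 - (nrm H (x \<oplus>\<^bsub>H\<^esub> y))\<^sup>2"
    using hilbert_norm_expand[OF H x y, of 1] hilbert_norm_expand[OF H x y, of "-1"] x y xy
    by (simp add: minus_eq_smult smult_one[simplified])
  define r s d where "r = nrm H x" and "s = nrm H (x \<oplus>\<^bsub>H\<^esub> y)" and "d = nrm H (x \<ominus>\<^bsub>H\<^esub> y)"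
  have nn: "0 \<le> r" "0 \<le> s" "0 \<le> d" using x y by (auto simp: r_def s_def d_def intro!: nrm_nonneg)
  have s2: "s \<le> 2 * r" using nrm_triangle[OF x y] xy by (simp add: s_def r_def)
  have "d\<^sup>2 = (2 * r - s) * (2 * r + s)"
    using par by (simp add: r_def s_def d_def power2_eq_square algebra_simps)
  also have "\<dots> \<le> (2 * r - s) * (4 * r)" using s2 by (intro mult_left_mono) auto
  also have "\<dots> \<le> (1/4 * r + 4 * (2 * r - s))\<^sup>2"
    using zero_le_power2[of "1/4 * r - 4 * (2 * r - s)"] by (simp add: power2_eq_square algebra_simps)
  finally have "d \<le> 1/4 * r + 4 * (2 * r - s)"
    by (rule power2_le_imp_le) (use s2 nn in simp)
  then show "nrm H (x \<ominus>\<^bsub>H\<^esub> y) \<le> 1 / 4 * nrm H x + 4 * (2 * nrm H x - nrm H (x \<oplus>\<^bsub>H\<^esub> y))"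
    by (simp add: r_def s_def d_def)
qed

text \<open>A functional of norm 1 with value 1 at the unit vector \<open>e\<close> vanishes on the
  orthogonal complement of \<open>e\<close>: a step from \<open>e\<close> in an orthogonal direction
  changes the norm only to second order, while a nonzero value there would change the functional to
  first order. So the functional is the inner product with \<open>e\<close>.\<close>

lemma hilbert_space_smooth:
  assumes H: "hilbert_space H ip"
  shows "smooth H"
  unfolding smooth_def
proof (intro ballI)
  interpret cnormed_space H by (rule hilbert_spaceD(2)[OF H])
  fix \<xi> assume "\<xi> \<in> carrier H - {\<zero>\<^bsub>H\<^esub>}"
  then have \<xi>: "\<xi> \<in> carrier H" "nrm H \<xi> > 0"
    using nrm_eq_0_iff nrm_nonneg by (auto simp: less_le)
  define e where "e = complex_of_real (1 / nrm H \<xi>) \<odot>\<^bsub>H\<^esub> \<xi>"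
  have e: "e \<in> carrier H" "nrm H e = 1" using \<xi> by (auto simp: e_def nrm_smult norm_divide)
  have \<xi>e: "\<xi> = complex_of_real (nrm H \<xi>) \<odot>\<^bsub>H\<^esub> e"
    using \<xi> smult_assoc1[of "complex_of_real (nrm H \<xi>)" "complex_of_real (1 / nrm H \<xi>)" \<xi>]
      smult_one[of \<xi>] by (simp add: e_def)
  have ee: "ip e e = 1" using hilbert_spaceD(6)[OF H e(1)] e by simp
  have uniq: "\<eta> z = ip z e" if \<eta>: "\<eta> \<in> bounded_functionals H" "nrm (dual H) \<eta> = 1" "\<eta> e = 1" and z: "z \<in> carrier H" for \<eta> z
  proof -
    define v where "v = z \<ominus>\<^bsub>H\<^esub> ip z e \<odot>\<^bsub>H\<^esub> e"
    have v: "v \<in> carrier H" using z e by (simp add: v_def)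
    have ve: "ip v e = 0"
      using z e by (simp add: v_def minus_eq_smult hilbert_spaceD(3,4)[OF H] ee)
    define w where "w = \<eta> v"
    define B where "B = (nrm H v)\<^sup>2"
    have bd: "2 * (s * (cmod w)\<^sup>2) \<le> s\<^sup>2 * (cmod w)\<^sup>2 * B" if s: "0 < s" for s :: real
    proof -
      \<comment> \<open>The factor \<open>cnj w\<close> makes \<open>k * w\<close> the nonnegative
        real number \<open>s * (cmod w)^2\<close>, so the modulus of the value at the new vector is
        exact.\<close>
      define k where "k = complex_of_real s * cnj w"
      have "\<eta> (e \<oplus>\<^bsub>H\<^esub> k \<odot>\<^bsub>H\<^esub> v) = 1 + k * w"
        using e v \<eta> by (simp add: bounded_functional_add bounded_functional_smult w_def)
      also have "\<dots> = complex_of_real (1 + s * (cmod w)\<^sup>2)"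
        using complex_norm_square[of w] by (simp add: k_def mult.commute mult.assoc)
      finally have "cmod (\<eta> (e \<oplus>\<^bsub>H\<^esub> k \<odot>\<^bsub>H\<^esub> v)) = 1 + s * (cmod w)\<^sup>2"
        using s by (simp del: of_real_add)
      moreover have "cmod (\<eta> (e \<oplus>\<^bsub>H\<^esub> k \<odot>\<^bsub>H\<^esub> v)) \<le> nrm H (e \<oplus>\<^bsub>H\<^esub> k \<odot>\<^bsub>H\<^esub> v)"
        using bounded_functional_le[OF \<eta>(1), of "e \<oplus>\<^bsub>H\<^esub> k \<odot>\<^bsub>H\<^esub> v"] \<eta>(2) e v by simp
      ultimately have "(1 + s * (cmod w)\<^sup>2)\<^sup>2 \<le> (nrm H (e \<oplus>\<^bsub>H\<^esub> k \<odot>\<^bsub>H\<^esub> v))\<^sup>2"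
        using s by (intro power_mono) auto
      also have "\<dots> = 1 + s\<^sup>2 * (cmod w)\<^sup>2 * B"
        using hilbert_norm_expand[OF H e(1) v, of k] e ve s
        by (simp add: k_def norm_mult B_def power_mult_distrib)
      finally have "1 + 2 * (s * (cmod w)\<^sup>2) + (s * (cmod w)\<^sup>2)\<^sup>2 \<le> 1 + s\<^sup>2 * (cmod w)\<^sup>2 * B"
        by (simp add: power2_sum)
      moreover have "0 \<le> (s * (cmod w)\<^sup>2)\<^sup>2" by simp
      ultimately show ?thesis by linarith
    qed
    have "w = 0"
    proof (rule ccontr)
      assume "w \<noteq> 0"
      then have W: "(cmod w)\<^sup>2 > 0" by simp
      \<comment> \<open>A step so short that the second order term \<open>s * B\<close> stays below
        the first order factor 2; the added 1 covers \<open>B = 0\<close>.\<close>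
      define s where "s = 1 / (B + 1)"
      have B: "0 \<le> B" by (simp add: B_def)
      then have s: "s > 0" by (simp add: s_def)
      have "(s * (cmod w)\<^sup>2) * 2 \<le> (s * (cmod w)\<^sup>2) * (s * B)"
        using bd[OF s] by (simp add: power2_eq_square mult_ac)
      then have "2 \<le> s * B" using s W by (subst (asm) mult_le_cancel_left_pos) auto
      also have "s * B \<le> 1" using B by (simp add: s_def field_simps)
      finally show False by simp
    qed
    then have "0 = \<eta> z - ip z e * \<eta> e"
      using \<eta>(1) z e by (simp add: w_def v_def bounded_functional_diff bounded_functional_smult)
    then show ?thesis using \<eta> by simp
  qed
  let ?\<phi> = "\<lambda>x\<in>carrier H. ip x e"
  have \<phi>: "?\<phi> \<in> bounded_functionals H" by (rule hilbert_functional(1)[OF H e(1)])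
  have "nrm (dual H) ?\<phi> \<le> 1" using hilbert_functional(2)[OF H e(1)] e by simp
  moreover have "1 \<le> nrm (dual H) ?\<phi>" using bounded_functional_le[OF \<phi> e(1)] e ee by simp
  ultimately have "nrm (dual H) ?\<phi> = 1" by simp
  moreover have "?\<phi> \<xi> = complex_of_real (nrm H \<xi>)"
  proof -
    have "ip \<xi> e = complex_of_real (nrm H \<xi>) * ip e e"
      by (subst \<xi>e) (simp add: hilbert_spaceD(4)[OF H] e)
    then show ?thesis using \<xi> ee by simp
  qed
  moreover have "\<eta> = ?\<phi>" if \<eta>: "\<eta> \<in> bounded_functionals H" "nrm (dual H) \<eta> = 1"
    "\<eta> \<xi> = complex_of_real (nrm H \<xi>)" for \<eta>
  proof
    have "\<eta> e = 1" using \<eta> \<xi> by (simp add: e_def bounded_functional_smult)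
    then have "\<eta> z = ip z e" if "z \<in> carrier H" for z using uniq \<eta> that by blast
    moreover have "\<eta> z = undefined" if "z \<notin> carrier H" for z
      using \<eta>(1) that by (auto simp: bounded_functionals_def extensional_def)
    ultimately show "\<eta> z = ?\<phi> z" for z by simp
  qed
  ultimately show "\<exists>!\<eta>. \<eta> \<in> carrier (dual H) \<and> nrm (dual H) \<eta> = 1 \<and> \<eta> \<xi> = complex_of_real (nrm H \<xi>)"
    using \<phi> unfolding carrier_dual by blast
qed

section \<open>Coefficient functions that are indicators\<close>

lemma representation_zero:
  assumes "representation G T E \<pi>" "x \<in> carrier G"
  shows "\<pi> x \<zero>\<^bsub>E\<^esub> = \<zero>\<^bsub>E\<^esub>"
proof -
  interpret cnormed_space E using representationD(2)[OF assms(1)] .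
  show ?thesis
    using representationD(9)[OF assms, of "\<zero>\<^bsub>E\<^esub>" 0] representationD(6)[OF assms, of "\<zero>\<^bsub>E\<^esub>"]
      smult_l_null[of "\<zero>\<^bsub>E\<^esub>"] smult_l_null[of "\<pi> x \<zero>\<^bsub>E\<^esub>"] by simp
qed

lemma (in cnormed_space) dual_add_closed:
  assumes "\<phi> \<in> bounded_functionals E" "\<psi> \<in> bounded_functionals E"
  shows "\<phi> \<oplus>\<^bsub>dual E\<^esub> \<psi> \<in> bounded_functionals E"
proof -
  have "cmod (\<phi> x + \<psi> x) \<le> (nrm (dual E) \<phi> + nrm (dual E) \<psi>) * nrm E x" if "x \<in> carrier E" for x
    using bounded_functional_le[OF assms(1) that] bounded_functional_le[OF assms(2) that]
      norm_triangle_ineq[of "\<phi> x" "\<psi> x"] by (simp add: algebra_simps)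
  then have "(\<lambda>x\<in>carrier E. \<phi> x + \<psi> x) \<in> bounded_functionals E"
    using assms
    by (intro bounded_functionalsI[where B = "nrm (dual E) \<phi> + nrm (dual E) \<psi>"])
      (auto simp: bounded_functional_add bounded_functional_smult algebra_simps)
  then show ?thesis by (simp add: dual_def)
qed

lemma (in cnormed_space) dual_smult_closed:
  assumes "\<phi> \<in> bounded_functionals E"
  shows "c \<odot>\<^bsub>dual E\<^esub> \<phi> \<in> bounded_functionals E"
proof -
  have "cmod (c * \<phi> x) \<le> (cmod c * nrm (dual E) \<phi>) * nrm E x" if "x \<in> carrier E" for x
    using bounded_functional_le[OF assms(1) that] mult_left_mono[of _ _ "cmod c"]
    by (simp add: norm_mult mult.assoc)
  then have "(\<lambda>x\<in>carrier E. c * \<phi> x) \<in> bounded_functionals E"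
    using assms
    by (intro bounded_functionalsI[where B = "cmod c * nrm (dual E) \<phi>"])
      (auto simp: bounded_functional_add bounded_functional_smult algebra_simps)
  then show ?thesis by (simp add: dual_def)
qed

text \<open>The canonical image of \<open>v\<close> in the bidual. Its norm is seen to be 1 without
  the Hahn-Banach theorem, because the given \<open>\<eta>\<close> attains it.\<close>

lemma (in cnormed_space) evaluation_functional:
  assumes v: "v \<in> carrier E" "nrm E v = 1"
    and \<eta>: "\<eta> \<in> bounded_functionals E" "nrm (dual E) \<eta> = 1" "\<eta> v = 1"
  shows "(\<lambda>\<phi>\<in>carrier (dual E). \<phi> v) \<in> carrier (dual (dual E))"
    and "nrm (dual (dual E)) (\<lambda>\<phi>\<in>carrier (dual E). \<phi> v) = 1"
proof -
  have le: "cmod (\<phi> v) \<le> nrm (dual E) \<phi>" if "\<phi> \<in> bounded_functionals E" for \<phi>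
    using bounded_functional_le[OF that v(1)] v by simp
  have "(\<phi> \<oplus>\<^bsub>dual E\<^esub> \<psi>) v = \<phi> v + \<psi> v" "(c \<odot>\<^bsub>dual E\<^esub> \<phi>) v = c * \<phi> v" for \<phi> \<psi> c
    using v by (simp_all add: dual_def)
  then have "(\<lambda>\<phi>\<in>carrier (dual E). \<phi> v) \<in> bounded_functionals (dual E)"
    using le unfolding bounded_functionals_def[of "dual E"]
    by (auto simp: dual_add_closed dual_smult_closed intro!: exI[of _ 1])
  then show "(\<lambda>\<phi>\<in>carrier (dual E). \<phi> v) \<in> carrier (dual (dual E))" by (simp add: dual_def)
  have "Sup {cmod ((\<lambda>\<phi>\<in>carrier (dual E). \<phi> v) \<phi>) |\<phi>. \<phi> \<in> carrier (dual E) \<and> nrm (dual E) \<phi> \<le> 1} = 1"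
    using \<eta> le by (intro cSup_eq_maximum) (force intro!: exI[of _ \<eta>])+
  then show "nrm (dual (dual E)) (\<lambda>\<phi>\<in>carrier (dual E). \<phi> v) = 1"
    by (simp add: dual_def)
qed

text \<open>The functional is the adjoint of \<open>\<pi> x\<close> applied to
  \<open>\<eta>\<close>.\<close>

lemma representation_functional:
  assumes rep: "representation G T E \<pi>" and x: "x \<in> carrier G" and \<eta>: "\<eta> \<in> bounded_functionals E"
  shows "(\<lambda>v\<in>carrier E. \<eta> (\<pi> x v)) \<in> bounded_functionals E"
    and "nrm (dual E) (\<lambda>v\<in>carrier E. \<eta> (\<pi> x v)) \<le> nrm (dual E) \<eta>"
proof -
  interpret cnormed_space E using representationD(2)[OF rep] .
  have le: "cmod (\<eta> (\<pi> x v)) \<le> nrm (dual E) \<eta> * nrm E v" if "v \<in> carrier E" for v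
    using bounded_functional_le[OF \<eta>, of "\<pi> x v"] representationD(6,7)[OF rep x that] by simp
  then show "(\<lambda>v\<in>carrier E. \<eta> (\<pi> x v)) \<in> bounded_functionals E"
    using representationD(6,8,9)[OF rep x]
    by (intro bounded_functionalsI) (auto simp: bounded_functional_add[OF \<eta>] bounded_functional_smult[OF \<eta>])
  show "nrm (dual E) (\<lambda>v\<in>carrier E. \<eta> (\<pi> x v)) \<le> nrm (dual E) \<eta>"
    using le nrm_dual_nonneg[OF \<eta>] by (intro nrm_dual_le) auto
qed

section \<open>From conditions on coefficients to open cosets\<close>

context locally_compact_group
begin

lemma mult_inv_mult_cancel:
  "x \<in> carrier G \<Longrightarrow> y \<in> carrier G \<Longrightarrow> z \<in> carrier G \<Longrightarrow> z \<otimes> x \<otimes> (inv x \<otimes> y) = z \<otimes> y"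
  using inv_mult_cancel[of "inv x" y] by (simp add: m_assoc)

lemma open_left_coset_of_smooth:
  assumes C: "C \<subseteq> carrier G" "C \<noteq> {}" and rep: "representation G T E \<pi>"
    and sm: "smooth E \<or> smooth (dual E)" and coeff: "normalized_coefficient G E \<pi> (indicator C)"
  shows "open_left_coset G T C"
proof -
  interpret cnormed_space E using representationD(2)[OF rep] .
  obtain \<xi> \<eta> where \<xi>: "\<xi> \<in> carrier E" "nrm E \<xi> = 1" and \<eta>: "\<eta> \<in> bounded_functionals E" "nrm (dual E) \<eta> = 1"
    and u: "\<And>x. x \<in> carrier G \<Longrightarrow> indicator C x = \<eta> (\<pi> x \<xi>)"
    using coeff unfolding normalized_coefficient_def carrier_dual by blast
  have C_iff: "x \<in> C \<longleftrightarrow> \<eta> (\<pi> x \<xi>) = 1" if "x \<in> carrier G" for x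
    using u[OF that] by (cases "x \<in> C") auto
  have op: "openin T C"
    using openin_coefficient_eq_1[OF rep topspace_eq \<xi>(1) \<eta>(1) C(1) u] .
  obtain c where c: "c \<in> C" using C by blast
  show ?thesis
  proof (rule open_left_cosetI[OF op c])
    fix x y z assume xyz: "x \<in> C" "y \<in> C" "z \<in> carrier G" "z \<otimes> x \<in> C"
    then have [simp]: "x \<in> carrier G" "y \<in> carrier G" "z \<in> carrier G" using C by auto
    from sm show "z \<otimes> y \<in> C"
    proof
      assume sm: "smooth E"
      define \<phi> where "\<phi> = (\<lambda>x. \<lambda>v\<in>carrier E. \<eta> (\<pi> x v))"
      have \<phi>: "\<phi> w \<in> carrier (dual E) \<and> nrm (dual E) (\<phi> w) = 1 \<and> \<phi> w \<xi> = complex_of_real (nrm E \<xi>)"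
        if w: "w \<in> C" for w
      proof -
        have w': "w \<in> carrier G" using w C by blast
        have b: "\<phi> w \<in> bounded_functionals E" and le: "nrm (dual E) (\<phi> w) \<le> 1"
          using representation_functional[OF rep w' \<eta>(1)] \<eta>(2) by (simp_all add: \<phi>_def)
        have 1: "\<phi> w \<xi> = 1" using C_iff[OF w'] w \<xi> by (simp add: \<phi>_def)
        then have "1 \<le> nrm (dual E) (\<phi> w)"
          using bounded_functional_le[OF b \<xi>(1)] \<xi>(2) by simp
        then show ?thesis using b le 1 \<xi> by simp
      qed
      have "\<xi> \<in> carrier E - {\<zero>\<^bsub>E\<^esub>}" using \<xi> nrm_zero by force
      then have "\<exists>!\<psi>. \<psi> \<in> carrier (dual E) \<and> nrm (dual E) \<psi> = 1 \<and> \<psi> \<xi> = complex_of_real (nrm E \<xi>)"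
        using sm unfolding smooth_def by blast
      then have "\<phi> (z \<otimes> x) = \<phi> x" using \<phi>[OF xyz(4)] \<phi>[OF xyz(1)] by blast
      then have e: "\<eta> (\<pi> (z \<otimes> x) v) = \<eta> (\<pi> x v)" if "v \<in> carrier E" for v
        using that by (simp add: \<phi>_def fun_eq_iff restrict_def) metis
      \<comment> \<open>The adjoint images of \<open>\<eta>\<close> under
        \<open>z \<otimes> x\<close> and under \<open>x\<close> agree; evaluating both at
        \<open>\<pi> (inv x \<otimes> y) \<xi>\<close> replaces \<open>x\<close> by \<open>y\<close>
        in each.\<close>
      have "\<eta> (\<pi> (z \<otimes> x \<otimes> (inv x \<otimes> y)) \<xi>) = \<eta> (\<pi> (x \<otimes> (inv x \<otimes> y)) \<xi>)"
        using e[of "\<pi> (inv x \<otimes> y) \<xi>"] representationD(6,10)[OF rep] \<xi> by simp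
      moreover have e': "x \<otimes> (inv x \<otimes> y) = y"
        using inv_mult_cancel[of "inv x" y] by simp
      moreover have "z \<otimes> x \<otimes> (inv x \<otimes> y) = z \<otimes> y"
        by (simp add: mult_inv_mult_cancel)
      ultimately show ?thesis using C_iff xyz by simp
    next
      assume sm: "smooth (dual E)"
      define \<Phi> where "\<Phi> = (\<lambda>x. \<lambda>\<phi>\<in>carrier (dual E). \<phi> (\<pi> x \<xi>))"
      have \<Phi>: "\<Phi> w \<in> carrier (dual (dual E)) \<and> nrm (dual (dual E)) (\<Phi> w) = 1
          \<and> \<Phi> w \<eta> = complex_of_real (nrm (dual E) \<eta>)" if w: "w \<in> C" for w
      proof -
        have w': "w \<in> carrier G" using w C by blast
        have "\<eta> (\<pi> w \<xi>) = 1" using C_iff[OF w'] w by simp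
        then show ?thesis
          using evaluation_functional[of "\<pi> w \<xi>" \<eta>] representationD(6,7)[OF rep w' \<xi>(1)] \<xi>(2) \<eta>
          by (simp add: \<Phi>_def)
      qed
      have "\<eta> \<noteq> \<zero>\<^bsub>dual E\<^esub>"
        using C_iff[of x] xyz representationD(6)[OF rep _ \<xi>(1), of x] by (auto simp: dual_def)
      then have "\<exists>!\<psi>. \<psi> \<in> carrier (dual (dual E)) \<and> nrm (dual (dual E)) \<psi> = 1
          \<and> \<psi> \<eta> = complex_of_real (nrm (dual E) \<eta>)"
        using sm \<eta>(1) unfolding smooth_def by simp
      \<comment> \<open>Equal evaluations need not be turned into equal vectors: it is enough to
        test them on the adjoint image of \<open>\<eta>\<close> under \<open>z\<close>.\<close>
      then have "\<Phi> x = \<Phi> y" using \<Phi>[OF xyz(1)] \<Phi>[OF xyz(2)] by blast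
      then have "\<phi> (\<pi> x \<xi>) = \<phi> (\<pi> y \<xi>)" if "\<phi> \<in> bounded_functionals E" for \<phi>
        using that by (simp add: \<Phi>_def fun_eq_iff restrict_def) metis
      from this[OF representation_functional(1)[OF rep _ \<eta>(1), of z]]
      have "\<eta> (\<pi> (z \<otimes> x) \<xi>) = \<eta> (\<pi> (z \<otimes> y) \<xi>)"
        using representationD(6,10)[OF rep] \<xi> by simp
      then show ?thesis using C_iff xyz by simp
    qed
  qed
qed

lemma open_left_coset_of_B_p:
  assumes p: "1 < p" and C: "C \<subseteq> carrier G"
    and u: "indicator C \<in> B_p TYPE('a) p G T" and norm: "B_p_norm TYPE('a) p G T \<mu> (indicator C) = 1"
  shows "open_left_coset G T C"
proof -
  let ?S = "{ennreal (\<Sum>n. nrm (E n) (\<xi> n) * nrm (dual (E n)) (\<eta> n)) |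
            (E :: nat \<Rightarrow> 'a cnspace) \<pi> \<xi> \<eta>.
            (\<forall>n. Cyc_p p G T \<mu> (E n) (\<pi> n) \<and> \<xi> n \<in> carrier (E n) \<and> \<eta> n \<in> carrier (dual (E n))) \<and>
            summable (\<lambda>n. nrm (E n) (\<xi> n) * nrm (dual (E n)) (\<eta> n)) \<and>
            (\<forall>x\<in>carrier G. (\<lambda>n. \<eta> n (\<pi> n x (\<xi> n))) sums indicator C x)}"
  obtain K where K: "0 \<le> K" "\<And>E :: 'a cnspace. QSLp p E \<Longrightarrow> convexity_constant (1/4) K E"
    using QSLp_uniformly_convex[OF p, of "1/4"] by auto
  \<comment> \<open>The added 1 keeps the denominator positive for \<open>K = 0\<close> and gives
    \<open>\<epsilon> \<le> 1\<close>.\<close>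
  define \<epsilon> where "\<epsilon> = 1 / (8 * K + 1)"
  have \<epsilon>: "0 < \<epsilon>" "\<epsilon> \<le> 1" "8 * K * \<epsilon> \<le> 1" using K by (auto simp: \<epsilon>_def)
  have "Inf (?S) = 1" using norm by (simp add: B_p_norm_def)
  also have "\<dots> < ennreal (1 + \<epsilon>)" using \<epsilon> by (simp add: ennreal_less_iff flip: ennreal_1)
  finally have "\<exists>s\<in>?S. s < ennreal (1 + \<epsilon>)"
    by (simp only: Inf_less_iff)
  then obtain s where "s \<in> ?S" and s: "s < ennreal (1 + \<epsilon>)" by (rule bexE)
  then obtain E :: "nat \<Rightarrow> 'a cnspace" and \<pi> \<xi> \<eta>
    where s': "s = ennreal (\<Sum>n. nrm (E n) (\<xi> n) * nrm (dual (E n)) (\<eta> n))"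
    and cyc: "\<And>n. Cyc_p p G T \<mu> (E n) (\<pi> n)" and \<xi>: "\<And>n. \<xi> n \<in> carrier (E n)"
    and \<eta>: "\<And>n. \<eta> n \<in> carrier (dual (E n))"
    and sm: "summable (\<lambda>n. nrm (E n) (\<xi> n) * nrm (dual (E n)) (\<eta> n))"
    and sums: "\<And>x. x \<in> carrier G \<Longrightarrow> (\<lambda>n. \<eta> n (\<pi> n x (\<xi> n))) sums indicator C x"
    by blast
  have rep: "representation G T (E n) (\<pi> n)" and Q: "QSLp p (E n)" for n
    using cyc[of n] by (auto simp: Cyc_p_def Rep_p_def)
  have N: "cnormed_space (E n)" for n using representationD(2)[OF rep] .
  have \<eta>': "\<eta> n \<in> bounded_functionals (E n)" for n
    using \<eta>[of n] cnormed_space.carrier_dual[OF N] by simp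
  have le: "(\<Sum>n. nrm (E n) (\<xi> n) * nrm (dual (E n)) (\<eta> n)) \<le> 1 + \<epsilon>"
    using s unfolding s' by (meson ennreal_leI le_cases not_le)
  \<comment> \<open>For the empty set the same representations with zero vectors would be
    admissible, and the infimum would be 0.\<close>
  have ne: "C \<noteq> {}"
  proof
    assume C: "C = {}"
    have z: "\<eta> n (\<pi> n x \<zero>\<^bsub>E n\<^esub>) = 0" if "x \<in> carrier G" for n x
      using representation_zero[OF rep that] cnormed_space.bounded_functional_zero[OF N \<eta>'] by simp
    have "\<zero>\<^bsub>E n\<^esub> \<in> carrier (E n)" for n
    proof -
      interpret cnormed_space "E n" by (rule N)
      show ?thesis by simp
    qed
    then have "ennreal (\<Sum>n. nrm (E n) \<zero>\<^bsub>E n\<^esub> * nrm (dual (E n)) (\<eta> n)) \<in> ?S"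
      using cyc \<eta> z cnormed_space.nrm_zero[OF N] C
      by (intro CollectI exI[of _ E] exI[of _ \<pi>] exI[of _ "\<lambda>n. \<zero>\<^bsub>E n\<^esub>"] exI[of _ \<eta>]) auto
    then have "Inf (?S) \<le> ennreal (\<Sum>n. nrm (E n) \<zero>\<^bsub>E n\<^esub> * nrm (dual (E n)) (\<eta> n))"
      by (rule Inf_lower)
    then show False using \<open>Inf (?S) = 1\<close> cnormed_space.nrm_zero[OF N] by simp
  qed
  then obtain c where c: "c \<in> C" by blast
  \<comment> \<open>Openness is read off from the single coefficient that membership in
    \<open>B_p\<close> provides, not from the series that nearly attains the norm.\<close>
  have "openin T C"
  proof -
    obtain E' :: "'a cnspace" and \<pi>' \<xi>' \<eta>' where *: "representation G T E' \<pi>'" "\<xi>' \<in> carrier E'"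
      "\<eta>' \<in> carrier (dual E')" "\<And>x. x \<in> carrier G \<Longrightarrow> indicator C x = \<eta>' (\<pi>' x \<xi>')"
      using u by (auto simp: B_p_def Rep_p_def)
    show ?thesis
      using openin_coefficient_eq_1[OF *(1) topspace_eq *(2) _ C *(4)] *(3)
        cnormed_space.carrier_dual[OF representationD(2)[OF *(1)]] by simp
  qed
  then show ?thesis using c
  proof (rule open_left_cosetI)
    fix x y z assume "x \<in> C" "y \<in> C" "z \<in> carrier G" "z \<otimes> x \<in> C"
    then show "z \<otimes> y \<in> C"
      using almost_invariant_coefficients[OF rep C is_group \<xi> \<eta>' K(2)[OF Q] K(1) sm le \<epsilon>(2,3) sums] by blast
  qed
qed

lemma open_left_coset_of_fourier_stieltjes:
  assumes C: "C \<subseteq> carrier G" and norm: "fourier_stieltjes_norm TYPE('a) G T (indicator C) = 1"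
  shows "open_left_coset G T C"
proof -
  let ?S = "{ennreal (nrm H \<xi> * nrm H \<eta>) |(H :: 'a cnspace) ip \<pi> \<xi> \<eta>.
            unitary_representation G T H ip \<pi> \<and> \<xi> \<in> carrier H \<and> \<eta> \<in> carrier H \<and>
            (\<forall>x\<in>carrier G. indicator C x = ip (\<pi> x \<xi>) \<eta>)}"
  have "Inf (?S) = 1" using norm by (simp add: fourier_stieltjes_norm_def)
  \<comment> \<open>1/32 is the largest \<open>\<epsilon>\<close> with
    \<open>8 * K * \<epsilon> \<le> 1\<close> for the Hilbert space constant
    \<open>K = 4\<close>.\<close>
  also have "\<dots> < ennreal (1 + 1/32)" by (simp add: ennreal_less_iff flip: ennreal_1)
  finally have "\<exists>s\<in>?S. s < ennreal (1 + 1/32)"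
    by (simp only: Inf_less_iff)
  then obtain s where "s \<in> ?S" and s: "s < ennreal (1 + 1/32)" by (rule bexE)
  then obtain H :: "'a cnspace" and ip \<pi> \<xi> \<eta>
    where s': "s = ennreal (nrm H \<xi> * nrm H \<eta>)" and U: "unitary_representation G T H ip \<pi>"
      and \<xi>: "\<xi> \<in> carrier H" and \<eta>: "\<eta> \<in> carrier H"
      and u: "\<And>x. x \<in> carrier G \<Longrightarrow> indicator C x = ip (\<pi> x \<xi>) \<eta>"
    by blast
  have H: "hilbert_space H ip" and rep: "representation G T H \<pi>"
    using U by (auto simp: unitary_representation_def)
  interpret H: cnormed_space H using hilbert_spaceD(2)[OF H] .
  let ?\<eta> = "\<lambda>v\<in>carrier H. ip v \<eta>"
  have \<eta>': "?\<eta> \<in> bounded_functionals H" "nrm (dual H) ?\<eta> \<le> nrm H \<eta>"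
    using hilbert_functional[OF H \<eta>] .
  have u': "indicator C x = ?\<eta> (\<pi> x \<xi>)" if "x \<in> carrier G" for x
    using u[OF that] representationD(6)[OF rep that \<xi>] by simp
  have "nrm H \<xi> * nrm H \<eta> \<le> 1 + 1/32"
    using s unfolding s' by (meson ennreal_leI le_cases not_le)
  then have le: "nrm H \<xi> * nrm (dual H) ?\<eta> \<le> 1 + 1/32"
    using mult_left_mono[OF \<eta>'(2) H.nrm_nonneg[OF \<xi>]] by linarith
  have "C \<noteq> {}"
  proof
    assume C: "C = {}"
    have "ip (\<pi> x \<zero>\<^bsub>H\<^esub>) \<eta> = 0" if "x \<in> carrier G" for x
      using representation_zero[OF rep that] H.bounded_functional_zero[OF \<eta>'(1)] by simp
    then have "ennreal (nrm H \<zero>\<^bsub>H\<^esub> * nrm H \<eta>) \<in> ?S"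
      using U \<eta> C
      by (intro CollectI exI[of _ H] exI[of _ ip] exI[of _ \<pi>] exI[of _ "\<zero>\<^bsub>H\<^esub>"] exI[of _ \<eta>]) auto
    then have "Inf (?S) \<le> ennreal (nrm H \<zero>\<^bsub>H\<^esub> * nrm H \<eta>)"
      by (rule Inf_lower)
    then show False using \<open>Inf (?S) = 1\<close> by simp
  qed
  then obtain c where c: "c \<in> C" by blast
  have op: "openin T C" using openin_coefficient_eq_1[OF rep topspace_eq \<xi> \<eta>'(1) C u'] .
  \<comment> \<open>A single coefficient becomes a series by filling up with zero vectors.\<close>
  define \<xi>' where "\<xi>' = (\<lambda>n::nat. if n = 0 then \<xi> else \<zero>\<^bsub>H\<^esub>)"
  have \<xi>': "\<xi>' n \<in> carrier H" for n using \<xi> by (simp add: \<xi>'_def)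
  have w: "(\<lambda>n. nrm H (\<xi>' n) * nrm (dual H) ?\<eta>) = (\<lambda>n. if n = 0 then nrm H \<xi> * nrm (dual H) ?\<eta> else 0)"
    by (auto simp: \<xi>'_def)
  have w_sums: "(\<lambda>n. nrm H (\<xi>' n) * nrm (dual H) ?\<eta>) sums (nrm H \<xi> * nrm (dual H) ?\<eta>)"
    unfolding w by (rule sums_single)
  have sums: "(\<lambda>n. ?\<eta> (\<pi> x (\<xi>' n))) sums indicator C x" if x: "x \<in> carrier G" for x
  proof -
    have "(\<lambda>n. ?\<eta> (\<pi> x (\<xi>' n))) = (\<lambda>n. if n = 0 then ?\<eta> (\<pi> x \<xi>) else 0)"
      using representation_zero[OF rep x] H.bounded_functional_zero[OF \<eta>'(1)] by (auto simp: \<xi>'_def)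
    then show ?thesis
      unfolding u'[OF x] using sums_single[of 0 "\<lambda>_. ?\<eta> (\<pi> x \<xi>)"] by simp
  qed
  show ?thesis using op c
  proof (rule open_left_cosetI)
    fix x y z assume "x \<in> C" "y \<in> C" "z \<in> carrier G" "z \<otimes> x \<in> C"
    then show "z \<otimes> y \<in> C"
      using almost_invariant_coefficients[of G T "\<lambda>_. H" "\<lambda>_. \<pi>" C \<xi>' "\<lambda>_. ?\<eta>" 4 "1/32" x y z,
          OF rep C is_group \<xi>' \<eta>'(1) hilbert_convexity_constant[OF H] _ sums_summable[OF w_sums] _ _ _ sums]
        le sums_unique[OF w_sums] by simp
  qed
qed

end

section \<open>The spaces \<open>l\<^sub>p(I)\<close>\<close>

text \<open>Vanishing off \<open>I\<close> makes a function determined by its values on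
  \<open>I\<close>, so that coordinate maps can be bijections onto this set.\<close>

definition ellfun :: "real \<Rightarrow> 'i set \<Rightarrow> ('i \<Rightarrow> complex) set" where
  "ellfun p I = {f. (\<forall>i. i \<notin> I \<longrightarrow> f i = 0) \<and> (\<lambda>i. cmod (f i) powr p) summable_on I}"

definition ellnorm :: "real \<Rightarrow> 'i set \<Rightarrow> ('i \<Rightarrow> complex) \<Rightarrow> real" where
  "ellnorm p I f = (\<Sum>\<^sub>\<infinity>i\<in>I. cmod (f i) powr p) powr (1 / p)"

lemma ellnorm_nonneg [simp]: "0 \<le> ellnorm p I f"
  by (simp add: ellnorm_def)

lemma ellnorm_powr: "1 < p \<Longrightarrow> ellnorm p I f powr p = (\<Sum>\<^sub>\<infinity>i\<in>I. cmod (f i) powr p)"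
  by (simp add: ellnorm_def powr_powr infsum_nonneg)

text \<open>As for midpoints: divide by the convex combination \<open>m\<close> and add the weighted
  tangent inequalities, whose linear terms cancel.\<close>

lemma powr_convex_combination:
  fixes a b s t p :: real
  assumes "1 < p" "0 \<le> a" "0 \<le> b" "0 \<le> s" "0 \<le> t" "s + t = 1"
  shows "(s * a + t * b) powr p \<le> s * a powr p + t * b powr p"
proof (cases "s * a + t * b = 0")
  case True
  then show ?thesis using assms by simp
next
  case False
  define m where "m = s * a + t * b"
  have m: "m > 0" using False assms by (simp add: m_def less_le)
  have "s * (1 + p * (a / m - 1)) + t * (1 + p * (b / m - 1)) \<le> s * (a / m) powr p + t * (b / m) powr p"
    using assms m by (intro add_mono mult_left_mono powr_Bernoulli) auto
  also have "s * (1 + p * (a / m - 1)) + t * (1 + p * (b / m - 1))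
      = (s + t) + p * ((s * a + t * b) / m - (s + t))"
    by (simp add: algebra_simps add_divide_distrib)
  also have "\<dots> = 1" using m assms by (simp add: m_def)
  finally have "1 \<le> (s * a powr p + t * b powr p) / m powr p"
    using m assms by (simp add: powr_divide add_divide_distrib)
  then have "m powr p \<le> s * a powr p + t * b powr p"
    using m by (simp add: field_simps)
  then show ?thesis by (simp add: m_def)
qed

lemma ellfunD:
  assumes "f \<in> ellfun p I"
  shows "i \<notin> I \<Longrightarrow> f i = 0" "(\<lambda>i. cmod (f i) powr p) summable_on I"
  using assms by (auto simp: ellfun_def)

text \<open>Bounds on finite partial sums give membership and norm at once. Minkowski's inequality,
  completeness and the approximation by finite supports are all reduced to finite sums through
  it.\<close>

lemma ellfun_bounded:
  assumes p: "1 < p" and supp: "\<And>i. i \<notin> I \<Longrightarrow> f i = 0" and B: "0 \<le> B"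
    and le: "\<And>F. finite F \<Longrightarrow> F \<subseteq> I \<Longrightarrow> (\<Sum>i\<in>F. cmod (f i) powr p) \<le> B powr p"
  shows "f \<in> ellfun p I" "ellnorm p I f \<le> B"
proof -
  have s: "(\<lambda>i. cmod (f i) powr p) summable_on I"
    using le by (intro nonneg_bdd_above_summable_on) (auto intro!: bdd_aboveI[of _ "B powr p"])
  then show "f \<in> ellfun p I" using supp by (simp add: ellfun_def)
  have "(\<Sum>\<^sub>\<infinity>i\<in>I. cmod (f i) powr p) \<le> B powr p"
    by (intro infsum_le_finite_sums s le)
  then have "ellnorm p I f \<le> (B powr p) powr (1 / p)"
    unfolding ellnorm_def using p by (intro powr_mono2 infsum_nonneg) auto
  then show "ellnorm p I f \<le> B" using p B by (simp add: powr_powr)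
qed

lemma sum_le_ellnorm:
  assumes p: "1 < p" and f: "f \<in> ellfun p I" and F: "finite F" "F \<subseteq> I"
  shows "(\<Sum>i\<in>F. cmod (f i) powr p) \<le> ellnorm p I f powr p"
  unfolding ellnorm_powr[OF p] by (rule finite_sum_le_infsum[OF ellfunD(2)[OF f] F]) auto

lemma cmod_le_ellnorm:
  assumes p: "1 < p" and f: "f \<in> ellfun p I"
  shows "cmod (f i) \<le> ellnorm p I f"
proof (cases "i \<in> I")
  case True
  have "cmod (f i) powr p \<le> ellnorm p I f powr p"
    using sum_le_ellnorm[OF p f, of "{i}"] True by simp
  then show ?thesis
    using powr_less_mono2[of p "ellnorm p I f" "cmod (f i)"] p by (cases "ellnorm p I f < cmod (f i)") auto
qed (simp add: ellfunD(1)[OF f])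

lemma ellnorm_eq_0_iff:
  assumes p: "1 < p" and f: "f \<in> ellfun p I"
  shows "ellnorm p I f = 0 \<longleftrightarrow> f = (\<lambda>_. 0)"
proof
  assume "ellnorm p I f = 0"
  then show "f = (\<lambda>_. 0)" using cmod_le_ellnorm[OF p f] by (auto simp: fun_eq_iff)
qed (use p in \<open>simp add: ellnorm_def\<close>)

lemma ellfun_smult:
  assumes p: "1 < p" and f: "f \<in> ellfun p I"
  shows "(\<lambda>i. c * f i) \<in> ellfun p I" "ellnorm p I (\<lambda>i. c * f i) = cmod c * ellnorm p I f"
proof -
  have e: "(\<lambda>i. cmod (c * f i) powr p) = (\<lambda>i. cmod c powr p * cmod (f i) powr p)"
    by (simp add: norm_mult powr_mult)
  show "(\<lambda>i. c * f i) \<in> ellfun p I"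
    using f unfolding ellfun_def by (simp add: e summable_on_cmult_right)
  show "ellnorm p I (\<lambda>i. c * f i) = cmod c * ellnorm p I f"
    unfolding ellnorm_def e infsum_cmult_right' using p
    by (subst powr_mult) (auto simp: powr_powr infsum_nonneg)
qed

text \<open>Minkowski's inequality by convexity instead of Hoelder's inequality:
  \<open>(f + g) / s\<close> is the convex combination of the unit vectors \<open>f / A\<close> and
  \<open>g / B\<close> with weights \<open>A / s\<close> and \<open>B / s\<close>. The divisions
  force separate cases for norm 0.\<close>

lemma ellfun_add:
  assumes p: "1 < p" and f: "f \<in> ellfun p I" and g: "g \<in> ellfun p I"
  shows "(\<lambda>i. f i + g i) \<in> ellfun p I" "ellnorm p I (\<lambda>i. f i + g i) \<le> ellnorm p I f + ellnorm p I g"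
proof -
  define A where "A = ellnorm p I f"
  define B where "B = ellnorm p I g"
  have *: "(\<lambda>i. f i + g i) \<in> ellfun p I \<and> ellnorm p I (\<lambda>i. f i + g i) \<le> A + B"
  proof -
    consider "A = 0" | "B = 0" | "A > 0" "B > 0"
      unfolding A_def B_def using ellnorm_nonneg[of p I f] ellnorm_nonneg[of p I g] by linarith
    then show ?thesis
    proof cases
      case 1
      then have "f = (\<lambda>_. 0)" using ellnorm_eq_0_iff[OF p f] by (simp add: A_def)
      then show ?thesis using g 1 by (simp add: B_def)
    next
      case 2
      then have "g = (\<lambda>_. 0)" using ellnorm_eq_0_iff[OF p g] by (simp add: B_def)
      then show ?thesis using f 2 by (simp add: A_def)
    next
      case 3
      define s where "s = A + B"
      have s: "s > 0" using 3 by (simp add: s_def)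
      have pt: "cmod (f i + g i) powr p \<le>
          s powr p * (A / s * (cmod (f i) powr p / A powr p) + B / s * (cmod (g i) powr p / B powr p))" for i
      proof -
        have "cmod (f i + g i) \<le> cmod (f i) + cmod (g i)" by (rule norm_triangle_ineq)
        also have "\<dots> = s * (A / s * (cmod (f i) / A) + B / s * (cmod (g i) / B))"
          using 3 s by (simp add: field_simps)
        finally have "cmod (f i + g i) powr p \<le> (s * (A / s * (cmod (f i) / A) + B / s * (cmod (g i) / B))) powr p"
          using p by (intro powr_mono2) auto
        also have "\<dots> = s powr p * (A / s * (cmod (f i) / A) + B / s * (cmod (g i) / B)) powr p"
          by (rule powr_mult)
        also have "\<dots> \<le> s powr p * (A / s * (cmod (f i) / A) powr p + B / s * (cmod (g i) / B) powr p)"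
        proof (intro mult_left_mono powr_convex_combination p)
          show "A / s + B / s = 1" using s unfolding add_divide_distrib[symmetric] by (simp add: s_def)
        qed (use 3 s in auto)
        finally show ?thesis using 3 by (simp add: powr_divide)
      qed
      have "(\<Sum>i\<in>F. cmod (f i + g i) powr p) \<le> s powr p" if F: "finite F" "F \<subseteq> I" for F
      proof -
        have "(\<Sum>i\<in>F. cmod (f i + g i) powr p) \<le> (\<Sum>i\<in>F.
            s powr p * (A / s * (cmod (f i) powr p / A powr p) + B / s * (cmod (g i) powr p / B powr p)))"
          by (intro sum_mono pt)
        also have "\<dots> = s powr p * (A / s * ((\<Sum>i\<in>F. cmod (f i) powr p) / A powr p)
            + B / s * ((\<Sum>i\<in>F. cmod (g i) powr p) / B powr p))"
          by (simp add: sum.distrib flip: sum_distrib_left sum_divide_distrib)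
        also have "\<dots> \<le> s powr p * (A / s * (A powr p / A powr p) + B / s * (B powr p / B powr p))"
          unfolding A_def[of] B_def[of]
          using 3 s sum_le_ellnorm[OF p f F] sum_le_ellnorm[OF p g F]
          by (intro mult_left_mono add_mono divide_right_mono) (auto simp: A_def B_def)
        also have "\<dots> = s powr p" using 3 s by (simp add: s_def flip: add_divide_distrib)
        finally show ?thesis .
      qed
      then show ?thesis
        using ellfun_bounded[OF p, of I "\<lambda>i. f i + g i" s] ellfunD(1)[OF f] ellfunD(1)[OF g] s
        by (simp add: s_def)
    qed
  qed
  then show "(\<lambda>i. f i + g i) \<in> ellfun p I" "ellnorm p I (\<lambda>i. f i + g i) \<le> ellnorm p I f + ellnorm p I g"
    by (simp_all add: A_def B_def)
qed

lemma ellfun_zero: "(\<lambda>_. 0) \<in> ellfun p I"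
  by (simp add: ellfun_def)

lemma ellfun_finite_support:
  assumes "finite F" "F \<subseteq> I" "\<And>i. i \<notin> F \<Longrightarrow> f i = 0"
  shows "f \<in> ellfun p I"
proof -
  have "(\<lambda>i. cmod (f i) powr p) summable_on I \<longleftrightarrow> (\<lambda>i. cmod (f i) powr p) summable_on F"
    using assms by (intro summable_on_cong_neutral) auto
  then show ?thesis using assms by (auto simp: ellfun_def)
qed

text \<open>
  A space is identified with \<open>l\<^sub>p(I)\<close> through coordinates, since \<open>l\<^sub>p(I)\<close> is needed both inside a
  prescribed carrier type and in the guise of \<open>Lp\<close> of a counting measure.
\<close>

locale lp_space =
  fixes E :: "'a cnspace" and coord :: "'a \<Rightarrow> 'i \<Rightarrow> complex" and p :: real and I :: "'i set"
  assumes p: "1 < p"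
    and bij: "bij_betw coord (carrier E) (ellfun p I)"
    and zero: "\<zero>\<^bsub>E\<^esub> \<in> carrier E" "coord \<zero>\<^bsub>E\<^esub> = (\<lambda>_. 0)"
    and add: "x \<in> carrier E \<Longrightarrow> y \<in> carrier E \<Longrightarrow> x \<oplus>\<^bsub>E\<^esub> y \<in> carrier E"
      "x \<in> carrier E \<Longrightarrow> y \<in> carrier E \<Longrightarrow> coord (x \<oplus>\<^bsub>E\<^esub> y) = (\<lambda>i. coord x i + coord y i)"
    and smult: "x \<in> carrier E \<Longrightarrow> c \<odot>\<^bsub>E\<^esub> x \<in> carrier E"
      "x \<in> carrier E \<Longrightarrow> coord (c \<odot>\<^bsub>E\<^esub> x) = (\<lambda>i. c * coord x i)"
    and nrm: "x \<in> carrier E \<Longrightarrow> nrm E x = ellnorm p I (coord x)"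
begin

definition vec :: "('i \<Rightarrow> complex) \<Rightarrow> 'a" where
  "vec = inv_into (carrier E) coord"

lemma coord_ellfun: "x \<in> carrier E \<Longrightarrow> coord x \<in> ellfun p I"
  using bij by (auto simp: bij_betw_def)

lemma vec_carrier: "f \<in> ellfun p I \<Longrightarrow> vec f \<in> carrier E"
  using bij unfolding vec_def bij_betw_def by (metis inv_into_into)

lemma coord_vec: "f \<in> ellfun p I \<Longrightarrow> coord (vec f) = f"
  using bij unfolding vec_def bij_betw_def by (metis f_inv_into_f)

lemma vec_coord: "x \<in> carrier E \<Longrightarrow> vec (coord x) = x"
  using bij unfolding vec_def bij_betw_def by simp

lemma coord_inject: "x \<in> carrier E \<Longrightarrow> y \<in> carrier E \<Longrightarrow> coord x = coord y \<longleftrightarrow> x = y"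
  using vec_coord by metis

text \<open>Every law is checked after applying the injective map \<open>coord\<close>, where it is
  an identity of functions or a fact about \<open>ellnorm\<close>.\<close>

lemma cnormed_space: "cnormed_space E"
proof -
  have "abelian_group E"
  proof (rule abelian_groupI)
    fix x assume x: "x \<in> carrier E"
    have "((-1) \<odot>\<^bsub>E\<^esub> x) \<oplus>\<^bsub>E\<^esub> x = \<zero>\<^bsub>E\<^esub>"
      using x by (subst coord_inject[symmetric]) (auto simp: zero add smult)
    then show "\<exists>y\<in>carrier E. y \<oplus>\<^bsub>E\<^esub> x = \<zero>\<^bsub>E\<^esub>" using smult(1)[OF x] by blast
    show "\<zero>\<^bsub>E\<^esub> \<oplus>\<^bsub>E\<^esub> x = x"
      using x by (subst coord_inject[symmetric]) (auto simp: zero add)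
    fix y assume y: "y \<in> carrier E"
    show "x \<oplus>\<^bsub>E\<^esub> y = y \<oplus>\<^bsub>E\<^esub> x"
      using x y by (subst coord_inject[symmetric]) (auto simp: add)
    fix z assume z: "z \<in> carrier E"
    show "x \<oplus>\<^bsub>E\<^esub> y \<oplus>\<^bsub>E\<^esub> z = x \<oplus>\<^bsub>E\<^esub> (y \<oplus>\<^bsub>E\<^esub> z)"
      using x y z by (subst coord_inject[symmetric]) (auto simp: add add.assoc)
  qed (auto simp: zero add)
  then have "module complex_field E"
  proof (intro moduleI)
    show "cring complex_field" by (rule cring_from_type_algebra)
    fix a b x assume x: "x \<in> carrier E"
    show "(a \<oplus>\<^bsub>complex_field\<^esub> b) \<odot>\<^bsub>E\<^esub> x = a \<odot>\<^bsub>E\<^esub> x \<oplus>\<^bsub>E\<^esub> b \<odot>\<^bsub>E\<^esub> x"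
      using x by (subst coord_inject[symmetric]) (auto simp: add smult algebra_simps)
    show "a \<otimes>\<^bsub>complex_field\<^esub> b \<odot>\<^bsub>E\<^esub> x = a \<odot>\<^bsub>E\<^esub> (b \<odot>\<^bsub>E\<^esub> x)"
      using x by (subst coord_inject[symmetric]) (auto simp: add smult algebra_simps)
    show "\<one>\<^bsub>complex_field\<^esub> \<odot>\<^bsub>E\<^esub> x = x"
      using x by (subst coord_inject[symmetric]) (auto simp: add smult algebra_simps)
    fix y assume y: "y \<in> carrier E"
    show "a \<odot>\<^bsub>E\<^esub> (x \<oplus>\<^bsub>E\<^esub> y) = a \<odot>\<^bsub>E\<^esub> x \<oplus>\<^bsub>E\<^esub> a \<odot>\<^bsub>E\<^esub> y"
      using x y by (subst coord_inject[symmetric]) (auto simp: add smult algebra_simps)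
  qed (auto simp: smult)
  then show ?thesis
  proof (intro cnormed_space.intro cnormed_space_axioms.intro)
    fix x assume x: "x \<in> carrier E"
    note ell = coord_ellfun[OF x]
    show "0 \<le> nrm E x" by (simp add: nrm[OF x])
    show "nrm E x = 0 \<longleftrightarrow> x = \<zero>\<^bsub>E\<^esub>"
      using ellnorm_eq_0_iff[OF p ell] coord_inject[OF x zero(1)] by (simp add: nrm[OF x] zero)
    show "nrm E (c \<odot>\<^bsub>E\<^esub> x) = cmod c * nrm E x" for c
      using ellfun_smult(2)[OF p ell] x by (simp add: nrm smult)
    fix y assume y: "y \<in> carrier E"
    show "nrm E (x \<oplus>\<^bsub>E\<^esub> y) \<le> nrm E x + nrm E y"
      using ellfun_add(2)[OF p ell coord_ellfun[OF y]] x y by (simp add: nrm add)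
  qed
qed

end

sublocale lp_space \<subseteq> cnormed_space E
  by (rule cnormed_space)

context lp_space
begin

lemma coord_minus:
  "x \<in> carrier E \<Longrightarrow> y \<in> carrier E \<Longrightarrow> coord (x \<ominus>\<^bsub>E\<^esub> y) = (\<lambda>i. coord x i - coord y i)"
  by (simp add: minus_eq_smult add smult)

lemma cbanach_space: "cbanach_space E"
proof (intro cbanach_space.intro cbanach_space_axioms.intro cnormed_space)
  show "metric.mcomplete"
    unfolding metric.mcomplete_def
  proof (intro allI impI)
    fix \<sigma> :: "nat \<Rightarrow> 'a" assume \<sigma>: "metric.MCauchy \<sigma>"
    then have carr: "\<sigma> n \<in> carrier E" for n
      by (auto simp: metric.MCauchy_def)
    have cauchy: "\<exists>N. \<forall>m\<ge>N. \<forall>n\<ge>N. nrm E (\<sigma> m \<ominus>\<^bsub>E\<^esub> \<sigma> n) < e" if "e > 0" for e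
      using \<sigma> that carr unfolding metric.MCauchy_def ndist_def by simp
    have pt: "cmod (coord x i) \<le> nrm E x" if "x \<in> carrier E" for x i
      using cmod_le_ellnorm[OF p coord_ellfun[OF that]] by (simp add: nrm that)
    have "convergent (\<lambda>n. coord (\<sigma> n) i)" for i
    proof (intro Cauchy_convergent CauchyI)
      fix e :: real assume "e > 0"
      then obtain N where N: "\<forall>m\<ge>N. \<forall>n\<ge>N. nrm E (\<sigma> m \<ominus>\<^bsub>E\<^esub> \<sigma> n) < e" using cauchy by blast
      have "norm (coord (\<sigma> m) i - coord (\<sigma> n) i) < e" if "m \<ge> N" "n \<ge> N" for m n
        using N that pt[of "\<sigma> m \<ominus>\<^bsub>E\<^esub> \<sigma> n" i] carr by (force simp: coord_minus)
      then show "\<exists>M. \<forall>m\<ge>M. \<forall>n\<ge>M. norm (coord (\<sigma> m) i - coord (\<sigma> n) i) < e" by blast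
    qed
    then obtain f where f: "\<And>i. (\<lambda>n. coord (\<sigma> n) i) \<longlonglongrightarrow> f i"
      unfolding convergent_def by metis
    \<comment> \<open>The Cauchy bound passes to the pointwise limit because only finitely many
      coordinates are involved at a time.\<close>
    have diff: "(\<lambda>i. coord (\<sigma> m) i - f i) \<in> ellfun p I \<and> ellnorm p I (\<lambda>i. coord (\<sigma> m) i - f i) \<le> e"
      if e: "e > 0" and N: "\<forall>m\<ge>N. \<forall>n\<ge>N. nrm E (\<sigma> m \<ominus>\<^bsub>E\<^esub> \<sigma> n) < e" and m: "m \<ge> N" for e N m
    proof -
      have "coord (\<sigma> m) i - f i = 0" if "i \<notin> I" for i
      proof -
        have "coord (\<sigma> n) i = 0" for n using ellfunD(1)[OF coord_ellfun[OF carr]] that by blast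
        then show ?thesis using LIMSEQ_unique[OF f[of i]] by simp
      qed
      moreover have "(\<Sum>i\<in>F. cmod (coord (\<sigma> m) i - f i) powr p) \<le> e powr p" if F: "finite F" "F \<subseteq> I" for F
      proof (rule tendsto_upperbound)
        show "(\<lambda>n. \<Sum>i\<in>F. cmod (coord (\<sigma> m) i - coord (\<sigma> n) i) powr p)
            \<longlonglongrightarrow> (\<Sum>i\<in>F. cmod (coord (\<sigma> m) i - f i) powr p)"
          using p by (intro tendsto_sum tendsto_powr2 tendsto_norm tendsto_diff tendsto_const f) auto
        have "(\<Sum>i\<in>F. cmod (coord (\<sigma> m) i - coord (\<sigma> n) i) powr p) \<le> e powr p" if n: "n \<ge> N" for n
        proof -
          have c: "\<sigma> m \<ominus>\<^bsub>E\<^esub> \<sigma> n \<in> carrier E" using carr by simp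
          have "(\<Sum>i\<in>F. cmod (coord (\<sigma> m) i - coord (\<sigma> n) i) powr p) \<le> nrm E (\<sigma> m \<ominus>\<^bsub>E\<^esub> \<sigma> n) powr p"
            using sum_le_ellnorm[OF p coord_ellfun[OF c] F] by (simp add: nrm[OF c] coord_minus carr)
          also have "\<dots> \<le> e powr p"
            using N m n p nrm_nonneg[OF c] by (intro powr_mono2) (auto intro: less_imp_le)
          finally show ?thesis .
        qed
        then show "\<forall>\<^sub>F n in sequentially. (\<Sum>i\<in>F. cmod (coord (\<sigma> m) i - coord (\<sigma> n) i) powr p) \<le> e powr p"
          by (auto simp: eventually_sequentially)
      qed simp
      ultimately show ?thesis
        using ellfun_bounded[OF p, of I "\<lambda>i. coord (\<sigma> m) i - f i" e] e by simp
    qed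
    obtain N1 where N1: "\<forall>m\<ge>N1. \<forall>n\<ge>N1. nrm E (\<sigma> m \<ominus>\<^bsub>E\<^esub> \<sigma> n) < 1" using cauchy[of 1] by auto
    \<comment> \<open>The limit is a term of the sequence minus its distance vector to the limit, a
      difference of two elements of \<open>l_p\<close>.\<close>
    have "(\<lambda>i. coord (\<sigma> N1) i + (-1) * (coord (\<sigma> N1) i - f i)) \<in> ellfun p I"
      using diff[OF _ N1, of N1] coord_ellfun[OF carr]
      by (intro ellfun_add(1)[OF p] ellfun_smult(1)[OF p]) auto
    then have fell: "f \<in> ellfun p I" by simp
    have "limitin metric.mtopology \<sigma> (vec f) sequentially"
      unfolding metric.limit_metric_sequentially
    proof (intro conjI allI impI vec_carrier fell)
      fix e :: real assume e: "e > 0"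
      then obtain N where N: "\<forall>m\<ge>N. \<forall>n\<ge>N. nrm E (\<sigma> m \<ominus>\<^bsub>E\<^esub> \<sigma> n) < e / 2"
        using cauchy[of "e / 2"] by auto
      have "ndist E (\<sigma> n) (vec f) < e" if "n \<ge> N" for n
        using diff[OF _ N that] e vec_carrier[OF fell] carr
        by (simp add: ndist_def nrm coord_minus coord_vec[OF fell])
      then show "\<exists>N. \<forall>n\<ge>N. \<sigma> n \<in> carrier E \<and> ndist E (\<sigma> n) (vec f) < e" using carr by blast
    qed
    then show "\<exists>x. limitin metric.mtopology \<sigma> x sequentially" by blast
  qed
qed

end

section \<open>Realising \<open>l_p(I)\<close> as a \<open>QSLp\<close> space\<close>

lemma lp_space_isometric:
  assumes "lp_space E c p I" "lp_space F d p I"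
  shows "isometrically_isomorphic E F"
proof -
  interpret E: lp_space E c p I by fact
  interpret F: lp_space F d p I by fact
  have lin: "linear_isometry E F (\<lambda>x. F.vec (c x))"
    unfolding linear_isometry_def
  proof (intro conjI ballI allI Pi_I)
    fix x assume x: "x \<in> carrier E"
    note cx = E.coord_ellfun[OF x]
    show "F.vec (c x) \<in> carrier F" using F.vec_carrier[OF cx] .
    show "nrm F (F.vec (c x)) = nrm E x"
      using F.vec_carrier[OF cx] by (simp add: F.nrm E.nrm x F.coord_vec[OF cx])
    show "F.vec (c (k \<odot>\<^bsub>E\<^esub> x)) = k \<odot>\<^bsub>F\<^esub> F.vec (c x)" for k
      using cx F.vec_carrier[OF cx] E.coord_ellfun[OF E.smult(1)[OF x]] x F.vec_carrier
      by (subst F.coord_inject[symmetric]) (auto simp: F.smult F.coord_vec simp flip: E.smult(2))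
    fix y assume y: "y \<in> carrier E"
    note cy = E.coord_ellfun[OF y]
    show "F.vec (c (x \<oplus>\<^bsub>E\<^esub> y)) = F.vec (c x) \<oplus>\<^bsub>F\<^esub> F.vec (c y)"
      using cx cy F.vec_carrier[OF cx] F.vec_carrier[OF cy] E.coord_ellfun[OF E.add(1)[OF x y]] x y F.vec_carrier
      by (subst F.coord_inject[symmetric]) (auto simp: F.add F.coord_vec simp flip: E.add(2))
  qed
  moreover have "bij_betw (\<lambda>x. F.vec (c x)) (carrier E) (carrier F)"
    by (rule bij_betwI[where g = "\<lambda>y. E.vec (d y)"])
      (auto simp: E.coord_ellfun F.coord_ellfun E.vec_carrier F.vec_carrier E.coord_vec F.coord_vec
        E.vec_coord F.vec_coord)
  ultimately show ?thesis unfolding isometrically_isomorphic_def by blast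
qed

lemma (in cnormed_space) isometric_quotient_zero: "isometrically_isomorphic E (quotient_space E {\<zero>\<^bsub>E\<^esub>})"
proof -
  let ?Q = "quotient_space E {\<zero>\<^bsub>E\<^esub>}"
  have "linear_isometry E ?Q (\<lambda>x. {x})"
    unfolding linear_isometry_def
    by (auto simp: quotient_space_def A_RCOSETS_def RCOSETS_def a_r_coset_def r_coset_def
        set_add_def set_mult_def)
  moreover have "bij_betw (\<lambda>x. {x}) (carrier E) (carrier ?Q)"
    by (rule bij_betwI[where g = the_elem])
      (auto simp: quotient_space_def A_RCOSETS_def RCOSETS_def a_r_coset_def r_coset_def)
  ultimately show ?thesis unfolding isometrically_isomorphic_def by blast
qed

lemma isometrically_isomorphic_trans:
  assumes "isometrically_isomorphic E F" "isometrically_isomorphic F K"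
  shows "isometrically_isomorphic E K"
proof -
  obtain f g where f: "linear_isometry E F f" "bij_betw f (carrier E) (carrier F)"
    and g: "linear_isometry F K g" "bij_betw g (carrier F) (carrier K)"
    using assms unfolding isometrically_isomorphic_def by blast
  have "linear_isometry E K (g \<circ> f)"
    using f(1) g(1) unfolding linear_isometry_def by (auto simp: Pi_iff)
  then show ?thesis
    using bij_betw_trans[OF f(2) g(2)] unfolding isometrically_isomorphic_def by blast
qed

lemma ae_class_count_space: "ae_class (count_space Y) f = {g. \<forall>x\<in>Y. g x = f x}"
  by (auto simp: ae_class_def AE_count_space)

lemma integrable_count_space_iff:
  fixes f :: "'a \<Rightarrow> real"
  assumes "\<And>x. 0 \<le> f x"
  shows "integrable (count_space Y) f \<longleftrightarrow> f summable_on Y"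
  using abs_summable_equivalent[of f Y] assms by (simp add: abs_summable_on_def)

lemma integral_count_space_eq_infsum:
  fixes f :: "'a \<Rightarrow> real"
  assumes "f summable_on Y" "\<And>x. 0 \<le> f x"
  shows "(\<integral>x. f x \<partial>count_space Y) = infsum f Y"
  using infsetsum_infsum[of f Y] integrable_count_space_iff[of f Y] assms
  by (simp add: abs_summable_on_def infsetsum_def)

text \<open>The atoms form a copy of \<open>I\<close> under \<open>\<iota>\<close>, since the type
  of the measure space will be prescribed. For a counting measure almost everywhere equality is
  equality on all atoms, so it does not matter which representative \<open>SOME\<close>
  picks.\<close>

lemma lp_space_Lp_count_space:
  fixes \<iota> :: "'i \<Rightarrow> 'b"
  assumes p: "1 < p" and \<iota>: "inj_on \<iota> I"
  shows "lp_space (Lp p (count_space (\<iota> ` I))) (\<lambda>A i. if i \<in> I then (SOME f. f \<in> A) (\<iota> i) else 0) p I"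
proof -
  let ?M = "count_space (\<iota> ` I)"
  define coord where "coord = (\<lambda>(A :: ('b \<Rightarrow> complex) set) i. if i \<in> I then (SOME f. f \<in> A) (\<iota> i) else 0)"
  have coord: "coord (ae_class ?M f) = (\<lambda>i. if i \<in> I then f (\<iota> i) else 0)" for f
  proof -
    have "f \<in> ae_class ?M f" by (simp add: ae_class_count_space)
    then have "(SOME g. g \<in> ae_class ?M f) \<in> ae_class ?M f" by (auto simp: some_in_eq)
    then show ?thesis by (auto simp: coord_def ae_class_count_space fun_eq_iff)
  qed
  have summ: "(\<lambda>x. cmod (f x) powr p) summable_on \<iota> ` I \<longleftrightarrow> (\<lambda>i. if i \<in> I then f (\<iota> i) else 0) \<in> ellfun p I" for f
    unfolding summable_on_reindex[OF \<iota>] ellfun_def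
    by (auto simp: o_def cong: summable_on_cong)
  have carr: "carrier (Lp p ?M) = {ae_class ?M f |f. (\<lambda>i. if i \<in> I then f (\<iota> i) else 0) \<in> ellfun p I}"
    by (simp add: carrier_Lp integrable_count_space_iff summ)
  have eq: "ae_class ?M f = ae_class ?M g \<longleftrightarrow>
      (\<lambda>i. if i \<in> I then f (\<iota> i) else 0) = (\<lambda>i. if i \<in> I then g (\<iota> i) else 0)" for f g
  proof
    assume "ae_class ?M f = ae_class ?M g"
    then show "(\<lambda>i. if i \<in> I then f (\<iota> i) else 0) = (\<lambda>i. if i \<in> I then g (\<iota> i) else 0)"
      using coord[of f] coord[of g] by simp
  next
    assume "(\<lambda>i. if i \<in> I then f (\<iota> i) else 0) = (\<lambda>i. if i \<in> I then g (\<iota> i) else 0)"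
    then have "\<forall>i\<in>I. f (\<iota> i) = g (\<iota> i)" by (auto simp: fun_eq_iff split: if_splits)
    then show "ae_class ?M f = ae_class ?M g" by (auto simp: ae_class_count_space)
  qed
  have "lp_space (Lp p ?M) coord p I"
  proof
    show "1 < p" by fact
    show "bij_betw coord (carrier (Lp p ?M)) (ellfun p I)"
    proof (rule bij_betw_imageI)
      show "inj_on coord (carrier (Lp p ?M))"
      proof (rule inj_onI)
        fix A B assume "A \<in> carrier (Lp p ?M)" "B \<in> carrier (Lp p ?M)" and AB: "coord A = coord B"
        then obtain f g where "A = ae_class ?M f" "B = ae_class ?M g" unfolding carr by blast
        then show "A = B" using AB eq[of f g] by (simp only: coord)
      qed
      show "coord ` carrier (Lp p ?M) = ellfun p I"
      proof (intro equalityI subsetI)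
        fix h assume h: "h \<in> ellfun p I"
        define f where "f = (\<lambda>x. h (inv_into I \<iota> x))"
        have "(\<lambda>i. if i \<in> I then f (\<iota> i) else 0) = h"
          using \<iota> ellfunD(1)[OF h] by (auto simp: f_def fun_eq_iff)
        then show "h \<in> coord ` carrier (Lp p ?M)"
          using h coord[of f] unfolding carr by (intro image_eqI[of _ _ "ae_class ?M f"]) auto
      qed (auto simp: carr coord)
    qed
    show "\<zero>\<^bsub>Lp p ?M\<^esub> \<in> carrier (Lp p ?M)"
      unfolding carr zero_Lp by (intro CollectI exI[of _ "\<lambda>_. 0"]) (simp add: ellfun_zero)
    show "coord \<zero>\<^bsub>Lp p ?M\<^esub> = (\<lambda>_. 0)" by (simp add: zero_Lp coord fun_eq_iff)
  next
    fix A B assume "A \<in> carrier (Lp p ?M)" "B \<in> carrier (Lp p ?M)"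
    then obtain f g where f: "A = ae_class ?M f" "(\<lambda>i. if i \<in> I then f (\<iota> i) else 0) \<in> ellfun p I"
      and g: "B = ae_class ?M g" "(\<lambda>i. if i \<in> I then g (\<iota> i) else 0) \<in> ellfun p I"
      unfolding carr by blast
    have fg: "(\<lambda>i. if i \<in> I then f (\<iota> i) + g (\<iota> i) else 0)
        = (\<lambda>i. (if i \<in> I then f (\<iota> i) else 0) + (if i \<in> I then g (\<iota> i) else 0))" by auto
    have AB: "A \<oplus>\<^bsub>Lp p ?M\<^esub> B = ae_class ?M (\<lambda>x. f x + g x)"
      using f g by (simp add: add_Lp)
    show "A \<oplus>\<^bsub>Lp p ?M\<^esub> B \<in> carrier (Lp p ?M)"
      unfolding AB carr using ellfun_add(1)[OF p f(2) g(2)]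
      by (intro CollectI exI[of _ "\<lambda>x. f x + g x"]) (simp add: fg)
    show "coord (A \<oplus>\<^bsub>Lp p ?M\<^esub> B) = (\<lambda>i. coord A i + coord B i)"
      unfolding AB by (auto simp: coord f(1) g(1))
  next
    fix A c assume "A \<in> carrier (Lp p ?M)"
    then obtain f where f: "A = ae_class ?M f" "(\<lambda>i. if i \<in> I then f (\<iota> i) else 0) \<in> ellfun p I"
      unfolding carr by blast
    have cf: "(\<lambda>i. if i \<in> I then c * f (\<iota> i) else 0) = (\<lambda>i. c * (if i \<in> I then f (\<iota> i) else 0))" by auto
    have cA: "c \<odot>\<^bsub>Lp p ?M\<^esub> A = ae_class ?M (\<lambda>x. c * f x)"
      using f by (simp add: smult_Lp)
    show "c \<odot>\<^bsub>Lp p ?M\<^esub> A \<in> carrier (Lp p ?M)"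
      unfolding cA carr using ellfun_smult(1)[OF p f(2)]
      by (intro CollectI exI[of _ "\<lambda>x. c * f x"]) (simp add: cf)
    show "coord (c \<odot>\<^bsub>Lp p ?M\<^esub> A) = (\<lambda>i. c * coord A i)"
      unfolding cA by (auto simp: coord f(1))
    have "nrm (Lp p ?M) A = (\<Sum>\<^sub>\<infinity>x\<in>\<iota> ` I. cmod (f x) powr p) powr (1 / p)"
      unfolding f(1) using f(2) by (simp add: nrm_Lp integral_count_space_eq_infsum summ)
    also have "\<dots> = ellnorm p I (coord A)"
      unfolding ellnorm_def f(1) coord infsum_reindex[OF \<iota>]
      by (simp add: o_def cong: infsum_cong)
    finally show "nrm (Lp p ?M) A = ellnorm p I (coord A)" .
  qed
  then show ?thesis by (simp add: coord_def)
qed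

text \<open>The subspace is everything and the kernel is zero. The map \<open>\<iota>\<close> codes
  indices in the type of the vectors, because that is where \<open>QSLp\<close> looks for the
  measure.\<close>

lemma (in lp_space) QSLp:
  fixes \<iota> :: "'i \<Rightarrow> 'a"
  assumes \<iota>: "inj_on \<iota> I"
  shows "QSLp p E"
proof -
  let ?L = "Lp p (count_space (\<iota> ` I))"
  interpret L: lp_space ?L "\<lambda>A i. if i \<in> I then (SOME f. f \<in> A) (\<iota> i) else 0" p I
    by (rule lp_space_Lp_count_space[OF p \<iota>])
  have sub: "subspace_of ?L (carrier ?L) = ?L" by (simp add: subspace_of_def)
  have "closed_subspace (carrier ?L) ?L"
    unfolding closed_subspace_def using L.carrier_is_submodule L.metric.closedin_mspace by simp
  moreover have "closed_subspace {\<zero>\<^bsub>?L\<^esub>} ?L"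
    unfolding closed_subspace_def
  proof
    show "submodule {\<zero>\<^bsub>?L\<^esub>} complex_field ?L"
      by (rule L.submoduleI) (auto simp: L.smult_r_null)
    show "closedin (norm_topology ?L) {\<zero>\<^bsub>?L\<^esub>}"
      using Hausdorff_imp_t1_space[OF L.metric.Hausdorff_space_mtopology] by (simp add: t1_space_closedin_singleton)
  qed
  moreover have "isometrically_isomorphic E (quotient_space ?L {\<zero>\<^bsub>?L\<^esub>})"
    using isometrically_isomorphic_trans[OF lp_space_isometric[OF lp_space_axioms L.lp_space_axioms]
        L.isometric_quotient_zero] .
  ultimately show ?thesis
    unfolding QSLp_def using cbanach_space sub by metis
qed

text \<open>Transport of structure along an injection \<open>J\<close>, which puts
  \<open>l_p(I)\<close> into the type prescribed for Banach spaces; \<open>c\<close> undoes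
  \<open>J\<close>.\<close>

definition lp_model :: "(('i \<Rightarrow> complex) \<Rightarrow> 'a) \<Rightarrow> real \<Rightarrow> 'i set \<Rightarrow> 'a cnspace" where
  "lp_model J p I = (let c = inv_into (ellfun p I) J in
     \<lparr>carrier = J ` ellfun p I,
      mult = undefined, one = undefined,
      zero = J (\<lambda>_. 0),
      add = (\<lambda>v w. J (\<lambda>i. c v i + c w i)),
      smult = (\<lambda>k v. J (\<lambda>i. k * c v i)),
      nrm = (\<lambda>v. ellnorm p I (c v))\<rparr>)"

lemma lp_space_lp_model:
  assumes p: "1 < p" and J: "inj_on J (ellfun p I)"
  shows "lp_space (lp_model J p I) (inv_into (ellfun p I) J) p I"
proof -
  let ?c = "inv_into (ellfun p I) J"
  have c: "?c (J f) = f" if "f \<in> ellfun p I" for f using J that by simp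
  show ?thesis
  proof
    show "bij_betw ?c (carrier (lp_model J p I)) (ellfun p I)"
      unfolding lp_model_def Let_def using bij_betw_inv_into[OF inj_on_imp_bij_betw[OF J]] by simp
  qed (auto simp: lp_model_def Let_def p c ellfun_zero ellfun_add(1)[OF p] ellfun_smult(1)[OF p])
qed

text \<open>The tail of a convergent sum of p-th powers is small. Truncations are used twice, for
  strong continuity and for the density of the orbit of a basis vector.\<close>

lemma (in lp_space) finite_approximation:
  assumes v: "v \<in> carrier E" and e: "e > 0"
  shows "\<exists>F. finite F \<and> F \<subseteq> I \<and> nrm E (v \<ominus>\<^bsub>E\<^esub> vec (\<lambda>i. if i \<in> F then coord v i else 0)) \<le> e"
proof -
  let ?g = "\<lambda>i. cmod (coord v i) powr p"
  have sm: "?g summable_on I" using ellfunD(2)[OF coord_ellfun[OF v]] .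
  have "e powr p > 0" using e by simp
  then obtain F where F: "finite F" "F \<subseteq> I" "dist (sum ?g F) (infsum ?g I) \<le> e powr p"
    using has_sum_finite_approximation[OF has_sum_infsum[OF sm]] by blast
  let ?f = "\<lambda>i. if i \<in> F then coord v i else 0"
  have f: "?f \<in> ellfun p I" by (rule ellfun_finite_support[OF F(1,2)]) simp
  have c: "v \<ominus>\<^bsub>E\<^esub> vec ?f \<in> carrier E" using v vec_carrier[OF f] by simp
  have "ellnorm p I (\<lambda>i. coord v i - ?f i) \<le> e"
  proof (rule ellfun_bounded(2)[OF p])
    fix i assume "i \<notin> I"
    then show "coord v i - ?f i = 0" using ellfunD(1)[OF coord_ellfun[OF v]] by simp
  next
    fix D assume D: "finite D" "D \<subseteq> I"
    have "(\<Sum>i\<in>D. cmod (coord v i - ?f i) powr p) = (\<Sum>i\<in>D - F. ?g i)"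
      using D by (intro sum.mono_neutral_cong_right) auto
    also have "\<dots> = sum ?g ((D - F) \<union> F) - sum ?g F"
      using D F by (subst sum.union_disjoint) auto
    also have "\<dots> \<le> infsum ?g I - sum ?g F"
      using D F by (intro diff_right_mono finite_sum_le_infsum sm) auto
    also have "\<dots> \<le> e powr p" using F(3) by (simp add: dist_real_def)
    finally show "(\<Sum>i\<in>D. cmod (coord v i - ?f i) powr p) \<le> e powr p" .
  qed (use e in auto)
  then show ?thesis
    using F(1,2) by (intro exI[of _ F]) (simp add: nrm[OF c] coord_minus v vec_carrier[OF f] coord_vec[OF f])
qed

lemma (in lp_space) coordinate_functional:
  assumes i: "i \<in> I"
  shows "(\<lambda>v\<in>carrier E. coord v i) \<in> bounded_functionals E"
    and "nrm (dual E) (\<lambda>v\<in>carrier E. coord v i) \<le> 1"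
proof -
  have le: "cmod (coord v i) \<le> 1 * nrm E v" if "v \<in> carrier E" for v
    using cmod_le_ellnorm[OF p coord_ellfun[OF that]] by (simp add: nrm that)
  show "(\<lambda>v\<in>carrier E. coord v i) \<in> bounded_functionals E"
    by (rule bounded_functionalsI[where B = 1]) (use le in \<open>auto simp: add smult\<close>)
  show "nrm (dual E) (\<lambda>v\<in>carrier E. coord v i) \<le> 1"
    by (rule nrm_dual_le) (use le in auto)
qed

definition (in lp_space) basis :: "'i \<Rightarrow> 'a" where
  "basis i = vec (indicator {i})"

lemma (in lp_space) basis:
  assumes i: "i \<in> I"
  shows "basis i \<in> carrier E" "coord (basis i) = indicator {i}" "nrm E (basis i) = 1"
proof -
  have f: "indicator {i} \<in> ellfun p I" by (rule ellfun_finite_support[of "{i}"]) (use i in auto)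
  show c: "basis i \<in> carrier E" and cc: "coord (basis i) = indicator {i}"
    using vec_carrier[OF f] coord_vec[OF f] by (simp_all add: basis_def)
  have "(\<Sum>\<^sub>\<infinity>j\<in>I. cmod (indicator {i} j :: complex) powr p) = (\<Sum>\<^sub>\<infinity>j\<in>{i}. cmod (indicator {i} j :: complex) powr p)"
    using i p by (intro infsum_cong_neutral) auto
  then show "nrm E (basis i) = 1" by (simp add: nrm[OF c] cc ellnorm_def)
qed

lemma (in lp_space) coord_finsum:
  assumes "finite A" "\<And>a. a \<in> A \<Longrightarrow> f a \<in> carrier E"
  shows "coord (finsum E f A) j = (\<Sum>a\<in>A. coord (f a) j)"
  using assms
proof (induction A)
  case empty
  then show ?case by (simp add: zero)
next
  case (insert a A)
  then have "finsum E f (insert a A) = f a \<oplus>\<^bsub>E\<^esub> finsum E f A" "finsum E f A \<in> carrier E"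
    by (auto intro!: M.finsum_insert M.finsum_closed)
  then show ?case using insert by (simp add: add)
qed

section \<open>Permutation representations\<close>

text \<open>Open stabilisers are what makes the representation strongly continuous: the orbit map of
  each basis vector is locally constant. An abstract action keeps the cosets out of the
  analysis.\<close>

locale permutation_representation =
  G: locally_compact_group G T + lp_space E coord p I
  for G :: "('g, 'r) monoid_scheme" (structure) and T :: "'g topology"
    and E :: "'a cnspace" and coord :: "'a \<Rightarrow> 'i \<Rightarrow> complex" and p I +
  fixes act :: "'g \<Rightarrow> 'i \<Rightarrow> 'i"
  assumes act_closed: "g \<in> carrier G \<Longrightarrow> i \<in> I \<Longrightarrow> act g i \<in> I"
    and act_one: "i \<in> I \<Longrightarrow> act \<one> i = i"
    and act_mult: "g \<in> carrier G \<Longrightarrow> h \<in> carrier G \<Longrightarrow> i \<in> I \<Longrightarrow> act (g \<otimes> h) i = act g (act h i)"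
    and open_stabilizer: "i \<in> I \<Longrightarrow> openin T {g \<in> carrier G. act g i = i}"
begin

lemma act_inv: "g \<in> carrier G \<Longrightarrow> i \<in> I \<Longrightarrow> act (inv g) (act g i) = i"
  "g \<in> carrier G \<Longrightarrow> i \<in> I \<Longrightarrow> act g (act (inv g) i) = i"
  using act_mult[of "inv g" g i] act_mult[of g "inv g" i] act_one by auto

lemma bij_act: "g \<in> carrier G \<Longrightarrow> bij_betw (act g) I I"
  by (rule bij_betwI[where g = "act (inv g)"]) (auto simp: act_closed act_inv)

text \<open>The inverse makes this a left action, and the value 0 off \<open>I\<close> keeps the
  result in \<open>ellfun\<close>.\<close>

definition translate :: "'g \<Rightarrow> ('i \<Rightarrow> complex) \<Rightarrow> 'i \<Rightarrow> complex" where
  "translate g f = (\<lambda>i. if i \<in> I then f (act (inv g) i) else 0)"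

lemma translate_ellfun:
  assumes g: "g \<in> carrier G" and f: "f \<in> ellfun p I"
  shows "translate g f \<in> ellfun p I" "ellnorm p I (translate g f) = ellnorm p I f"
proof -
  have b: "bij_betw (act (inv g)) I I" using bij_act g by simp
  have "(\<lambda>i. cmod (translate g f i) powr p) summable_on I"
    using summable_on_reindex_bij_betw[OF b, of "\<lambda>i. cmod (f i) powr p"] ellfunD(2)[OF f]
    by (simp add: translate_def cong: summable_on_cong)
  then show "translate g f \<in> ellfun p I" by (simp add: ellfun_def translate_def)
  show "ellnorm p I (translate g f) = ellnorm p I f"
    using infsum_reindex_bij_betw[OF b, of "\<lambda>i. cmod (f i) powr p"]
    by (simp add: ellnorm_def translate_def cong: infsum_cong)
qed

lemma translate_mult:
  "g \<in> carrier G \<Longrightarrow> h \<in> carrier G \<Longrightarrow> translate (g \<otimes> h) f = translate g (translate h f)"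
  by (auto simp: translate_def fun_eq_iff G.inv_mult_group act_mult act_closed)

lemma translate_one: "f \<in> ellfun p I \<Longrightarrow> translate \<one> f = f"
  by (auto simp: translate_def fun_eq_iff act_one ellfunD(1))

text \<open>Restricted to the carrier because the elements of \<open>BijGroup\<close> are
  extensional functions.\<close>

definition rep :: "'g \<Rightarrow> 'a \<Rightarrow> 'a" where
  "rep g = (\<lambda>v\<in>carrier E. vec (translate g (coord v)))"

lemma rep_carrier: "g \<in> carrier G \<Longrightarrow> v \<in> carrier E \<Longrightarrow> rep g v \<in> carrier E"
  by (simp add: rep_def vec_carrier translate_ellfun coord_ellfun)

lemma coord_rep: "g \<in> carrier G \<Longrightarrow> v \<in> carrier E \<Longrightarrow> coord (rep g v) = translate g (coord v)"
  by (simp add: rep_def coord_vec translate_ellfun coord_ellfun)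

lemma rep_mult:
  "g \<in> carrier G \<Longrightarrow> h \<in> carrier G \<Longrightarrow> v \<in> carrier E \<Longrightarrow> rep (g \<otimes> h) v = rep g (rep h v)"
  by (subst coord_inject[symmetric]) (simp_all add: rep_carrier coord_rep translate_mult)

lemma rep_one: "v \<in> carrier E \<Longrightarrow> rep \<one> v = v"
  by (subst coord_inject[symmetric]) (simp_all add: rep_carrier coord_rep translate_one coord_ellfun)

lemma linear_isometry_rep: "g \<in> carrier G \<Longrightarrow> linear_isometry E E (rep g)"
  unfolding linear_isometry_def
proof (intro conjI ballI allI Pi_I)
  fix v assume g: "g \<in> carrier G" and v: "v \<in> carrier E"
  show "rep g v \<in> carrier E" using rep_carrier g v .
  show "nrm E (rep g v) = nrm E v"
    using g v by (simp add: nrm rep_carrier coord_rep translate_ellfun coord_ellfun)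
  show "rep g (c \<odot>\<^bsub>E\<^esub> v) = c \<odot>\<^bsub>E\<^esub> rep g v" for c
    using g v by (subst coord_inject[symmetric]) (auto simp: rep_carrier smult coord_rep translate_def)
  fix w assume w: "w \<in> carrier E"
  show "rep g (v \<oplus>\<^bsub>E\<^esub> w) = rep g v \<oplus>\<^bsub>E\<^esub> rep g w"
    using g v w by (subst coord_inject[symmetric]) (auto simp: rep_carrier add coord_rep translate_def)
qed

lemma group_action_rep: "group_action G (carrier E) rep"
proof (intro group_action.intro group_hom.intro group_hom_axioms.intro homI)
  show "group G" by (rule G.is_group)
  show "group (BijGroup (carrier E))" by (rule group_BijGroup)
  have B: "rep g \<in> Bij (carrier E)" if g: "g \<in> carrier G" for g
  proof -
    have "bij_betw (rep g) (carrier E) (carrier E)"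
      by (rule bij_betwI[where g = "rep (inv g)"])
        (use g in \<open>auto simp: rep_carrier rep_one simp flip: rep_mult\<close>)
    then show ?thesis by (simp add: Bij_def rep_def)
  qed
  fix g h assume g: "g \<in> carrier G" and h: "h \<in> carrier G"
  show "rep g \<in> carrier (BijGroup (carrier E))" using B[OF g] by (simp add: BijGroup_def)
  have "rep (g \<otimes> h) = compose (carrier E) (rep g) (rep h)"
  proof (rule extensionalityI[of _ "carrier E"])
    show "rep (g \<otimes> h) \<in> extensional (carrier E)" by (simp add: rep_def)
  qed (use g h in \<open>auto simp: compose_def rep_mult\<close>)
  then show "rep (g \<otimes> h) = rep g \<otimes>\<^bsub>BijGroup (carrier E)\<^esub> rep h"
    using B[OF g] B[OF h] by (simp add: BijGroup_def)
qed

text \<open>Since the operators are isometries, \<open>v\<close> may be replaced by a nearby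
  finitely supported \<open>w\<close> at the price of two errors \<open>e / 3\<close>; the orbit map
  of \<open>w\<close> is locally constant and adds no third one.\<close>

lemma continuous_map_rep:
  assumes v: "v \<in> carrier E"
  shows "continuous_map T (norm_topology E) (\<lambda>g. rep g v)"
  unfolding continuous_map_norm_topology G.topspace_eq
proof (intro conjI ballI allI impI Pi_I rep_carrier v)
  fix g and e :: real assume g: "g \<in> carrier G" and e: "e > 0"
  obtain F where F: "finite F" "F \<subseteq> I"
    and near: "nrm E (v \<ominus>\<^bsub>E\<^esub> vec (\<lambda>i. if i \<in> F then coord v i else 0)) \<le> e / 3"
    using finite_approximation[OF v, of "e / 3"] e by auto
  define f where "f = (\<lambda>i. if i \<in> F then coord v i else 0)"
  define w where "w = vec f"
  have f: "f \<in> ellfun p I" unfolding f_def by (rule ellfun_finite_support[OF F]) simp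
  have w: "w \<in> carrier E" "coord w = f" using vec_carrier[OF f] coord_vec[OF f] by (simp_all add: w_def)
  \<comment> \<open>Every element of \<open>U\<close> acts on \<open>F\<close> as \<open>g\<close>
    does. The intersection with \<open>topspace T\<close> matters when \<open>F\<close> is
    empty.\<close>
  define U where "U = (\<Inter>i\<in>F. g <# {h \<in> carrier G. act h i = i}) \<inter> topspace T"
  have "openin T U" unfolding U_def
    using F g open_stabilizer by (intro openin_INT G.openin_left_coset) auto
  moreover have "g \<in> U"
    using g F act_one G.topspace_eq by (auto simp: U_def l_coset_def intro!: bexI[of _ \<one>])
  moreover have "nrm E (rep h v \<ominus>\<^bsub>E\<^esub> rep g v) < e" if h: "h \<in> U" for h
  proof -
    have hG: "h \<in> carrier G" using h G.topspace_eq by (simp add: U_def)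
    have hi: "act h i = act g i" if "i \<in> F" for i
    proof -
      have "h \<in> g <# {h \<in> carrier G. act h i = i}" using h that by (simp add: U_def)
      then obtain k where "k \<in> carrier G" "act k i = i" "h = g \<otimes> k"
        by (auto simp: l_coset_def)
      then show ?thesis using act_mult[OF g, of k i] that F by auto
    qed
    \<comment> \<open>Translation reads \<open>f\<close> at preimages, so agreement on
      \<open>F\<close> has to become agreement of the inverses wherever one of them lands in
      \<open>F\<close>.\<close>
    have flip: "act (inv h) i = act (inv g) i" if "i \<in> I" "act (inv h) i \<in> F \<or> act (inv g) i \<in> F" for i
      using that(2)
    proof
      assume "act (inv h) i \<in> F"
      from hi[OF this] have "i = act g (act (inv h) i)" using act_inv hG that by simp
      then have "act (inv g) i = act (inv g) (act g (act (inv h) i))" by simp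
      then show ?thesis using act_inv(1)[OF g, of "act (inv h) i"] act_closed hG that by simp
    next
      assume "act (inv g) i \<in> F"
      from hi[OF this] have "i = act h (act (inv g) i)" using act_inv g that by simp
      then have "act (inv h) i = act (inv h) (act h (act (inv g) i))" by simp
      then show ?thesis using act_inv(1)[OF hG, of "act (inv g) i"] act_closed g that by simp
    qed
    have "translate h f = translate g f"
      unfolding translate_def f_def by (rule ext) (use flip in \<open>simp, metis\<close>)
    then have hw: "rep h w = rep g w"
      using w g hG coord_inject[OF rep_carrier rep_carrier, of h w g w] by (simp add: coord_rep)
    have eq: "nrm E (rep k v \<ominus>\<^bsub>E\<^esub> rep k w) \<le> e / 3" if k: "k \<in> carrier G" for k
    proof -
      note L = linear_isometry_rep[OF k, unfolded linear_isometry_def]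
      have "rep k (v \<ominus>\<^bsub>E\<^esub> w) = rep k v \<ominus>\<^bsub>E\<^esub> rep k w"
        using L v w k by (simp add: minus_eq_smult rep_carrier)
      moreover have "nrm E (rep k (v \<ominus>\<^bsub>E\<^esub> w)) = nrm E (v \<ominus>\<^bsub>E\<^esub> w)"
        using L v w by simp
      ultimately show ?thesis using near by (simp add: w_def f_def)
    qed
    have "nrm E (rep h v \<ominus>\<^bsub>E\<^esub> rep g v)
        \<le> nrm E (rep h v \<ominus>\<^bsub>E\<^esub> rep h w) + nrm E (rep g w \<ominus>\<^bsub>E\<^esub> rep g v)"
      using nrm_minus_triangle[of "rep h v" "rep h w" "rep g v"] hG g v w by (simp add: rep_carrier hw)
    also have "\<dots> \<le> e / 3 + e / 3"
      using eq[OF hG] eq[OF g] nrm_minus_commute[of "rep g w" "rep g v"] g v w by (simp add: rep_carrier)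
    also have "\<dots> < e" using e by simp
    finally show ?thesis .
  qed
  ultimately show "\<exists>U. openin T U \<and> g \<in> U \<and> (\<forall>y\<in>U. nrm E (rep y v \<ominus>\<^bsub>E\<^esub> rep g v) < e)" by blast
qed

lemma representation_rep: "representation G T E rep"
  unfolding representation_def
  using cbanach_space group_action_rep linear_isometry_rep continuous_map_rep by blast

lemma rep_basis:
  assumes g: "g \<in> carrier G" and i: "i \<in> I"
  shows "rep g (basis i) = basis (act g i)"
proof -
  have "translate g (indicator {i}) = indicator {act g i}"
    unfolding translate_def
    using g i act_inv[OF g] act_closed[OF g i] by (auto simp: fun_eq_iff indicator_def)
  then show ?thesis
    using g i by (subst coord_inject[symmetric]) (simp_all add: rep_carrier basis act_closed coord_rep)
qed

text \<open>A nonempty transporter is a left coset of a stabiliser.\<close>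

lemma open_transporter:
  assumes "i \<in> I" "j \<in> I" "g \<in> carrier G" "act g i = j"
  shows "openin T {h \<in> carrier G. act h i = j}"
proof -
  have "{h \<in> carrier G. act h i = j} = g <# {h \<in> carrier G. act h i = i}"
  proof (intro equalityI subsetI)
    fix h assume h: "h \<in> {h \<in> carrier G. act h i = j}"
    then have "inv g \<otimes> h \<in> {h \<in> carrier G. act h i = i}" "h = g \<otimes> (inv g \<otimes> h)"
      using assms act_mult[of "inv g" h i] act_inv G.inv_mult_cancel[of "inv g" h] by auto
    then show "h \<in> g <# {h \<in> carrier G. act h i = i}" unfolding l_coset_def by blast
  qed (use assms in \<open>auto simp: l_coset_def act_mult\<close>)
  then show ?thesis using G.openin_left_coset[OF open_stabilizer] assms by simp
qed

end

section \<open>Haar measure of open sets\<close>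

context locally_compact_group
begin

text \<open>If a nonempty open set were null, finitely many of its translates would cover any given
  compact set and make it null; inner regularity would then make the whole group null.\<close>

lemma haar_open_pos:
  assumes \<mu>: "left_haar_measure G T \<mu>" and U: "openin T U" "u \<in> U"
  shows "emeasure \<mu> U \<noteq> 0"
proof
  assume 0: "emeasure \<mu> U = 0"
  have sp: "space \<mu> = carrier G" and st: "sets \<mu> = sigma_sets (carrier G) {U. openin T U}"
    and ne: "emeasure \<mu> (carrier G) \<noteq> 0"
    and inv: "\<And>g A. g \<in> carrier G \<Longrightarrow> A \<in> sets \<mu> \<Longrightarrow> emeasure \<mu> (g <# A) = emeasure \<mu> A"
    and reg: "\<And>U. openin T U \<Longrightarrow> emeasure \<mu> U = (SUP K\<in>{K. compactin T K \<and> K \<subseteq> U}. emeasure \<mu> K)"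
    using \<mu> unfolding left_haar_measure_def by blast+
  have os: "V \<in> sets \<mu>" if "openin T V" for V using that st by (auto intro: sigma_sets.Basic)
  have u: "u \<in> carrier G" using U openin_subset topspace_eq by blast
  have "emeasure \<mu> K = 0" if K: "compactin T K" for K
  proof -
    have "\<exists>\<F>. finite \<F> \<and> \<F> \<subseteq> (\<lambda>g. g <# U) ` carrier G \<and> K \<subseteq> \<Union> \<F>"
    proof (rule compactinD[OF K])
      show "openin T V" if "V \<in> (\<lambda>g. g <# U) ` carrier G" for V
        using that U openin_left_coset by blast
      show "K \<subseteq> \<Union> ((\<lambda>g. g <# U) ` carrier G)"
      proof
        fix k assume "k \<in> K"
        then have k: "k \<in> carrier G" using compactin_subset_topspace[OF K] topspace_eq by blast
        then have "k = (k \<otimes> inv u) \<otimes> u" using u by (simp add: m_assoc)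
        then have m: "k \<in> (k \<otimes> inv u) <# U" using U by (auto simp: l_coset_def)
        show "k \<in> \<Union> ((\<lambda>g. g <# U) ` carrier G)"
          by (rule UN_I[where a = "k \<otimes> inv u"]) (use k u m in simp_all)
      qed
    qed
    then obtain \<F> where \<F>: "finite \<F>" "\<F> \<subseteq> (\<lambda>g. g <# U) ` carrier G" "K \<subseteq> \<Union> \<F>" by blast
    have null: "V \<in> null_sets \<mu>" if "V \<in> \<F>" for V
      using that \<F> inv os[OF U(1)] 0 os[OF openin_left_coset[OF U(1)]] by (auto simp: null_sets_def)
    have "\<Union> \<F> \<in> null_sets \<mu>"
      using null_sets_UN'[of \<F> "\<lambda>V. V" \<mu>] null \<F>(1) by (simp add: countable_finite)
    then show ?thesis
      using \<F>(3) by (metis emeasure_mono le_zero_eq null_setsD1 null_setsD2)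
  qed
  then have "(SUP K\<in>{K. compactin T K \<and> K \<subseteq> carrier G}. emeasure \<mu> K) \<le> 0"
    by (intro SUP_least) simp
  then show False using reg[of "carrier G"] ne openin_topspace[of T] topspace_eq by simp
qed

text \<open>The open set itself may have infinite measure, so integrable functions are built on a
  compact part of it, which inner regularity supplies with positive measure.\<close>

lemma haar_compact_subset:
  assumes \<mu>: "left_haar_measure G T \<mu>" and U: "openin T U" "u \<in> U"
  shows "\<exists>K. K \<subseteq> U \<and> K \<in> sets \<mu> \<and> emeasure \<mu> K \<noteq> \<infinity> \<and> 0 < measure \<mu> K"
proof -
  have st: "sets \<mu> = sigma_sets (carrier G) {U. openin T U}"
    and fin: "\<And>K. compactin T K \<Longrightarrow> emeasure \<mu> K < \<infinity>"
    and reg: "emeasure \<mu> U = (SUP K\<in>{K. compactin T K \<and> K \<subseteq> U}. emeasure \<mu> K)"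
    using \<mu> U unfolding left_haar_measure_def by blast+
  have "0 < (SUP K\<in>{K. compactin T K \<and> K \<subseteq> U}. emeasure \<mu> K)"
    using haar_open_pos[OF assms] unfolding reg by (simp add: zero_less_iff_neq_zero)
  then obtain K where K: "compactin T K" "K \<subseteq> U" "0 < emeasure \<mu> K"
    unfolding less_SUP_iff by blast
  have "openin T (carrier G - K)"
    using compactin_imp_closedin[OF Hausdorff K(1)] topspace_eq by (simp add: closedin_def)
  then have "carrier G - (carrier G - K) \<in> sets \<mu>"
    unfolding st by (intro sigma_sets.Compl sigma_sets.Basic) simp
  moreover have "carrier G - (carrier G - K) = K"
    using compactin_subset_topspace[OF K(1)] topspace_eq by blast
  moreover have "0 < measure \<mu> K"
    using K(3) fin[OF K(1)] by (simp add: measure_def enn2real_positive_iff)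
  ultimately show ?thesis using K fin[OF K(1)] by (intro exI[of _ K]) auto
qed

end

section \<open>Cyclicity for transitive actions\<close>

context permutation_representation
begin

text \<open>
  The orbit map of a basis vector is locally constant, so multiplied by a combination of indicators of
  compact sets, one inside each transporter, it is a simple function whose integral can be read off.
\<close>

lemma finite_support_in_L1_orbit:
  assumes \<mu>: "left_haar_measure G T \<mu>" and i0: "i0 \<in> I"
    and trans: "\<And>j. j \<in> I \<Longrightarrow> \<exists>g\<in>carrier G. act g i0 = j"
    and F: "finite F" "F \<subseteq> I" and c0: "\<And>j. j \<in> F \<Longrightarrow> c j \<noteq> 0"
  shows "vec (\<lambda>j. if j \<in> F then c j else 0) \<in> L1_orbit \<mu> E rep (basis i0)"
proof -
  have sp: "space \<mu> = carrier G" using \<mu> unfolding left_haar_measure_def by blast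
  have "\<exists>K. K \<subseteq> {g \<in> carrier G. act g i0 = j} \<and> K \<in> sets \<mu> \<and> emeasure \<mu> K \<noteq> \<infinity> \<and> 0 < measure \<mu> K"
    if j: "j \<in> I" for j
  proof -
    obtain g where g: "g \<in> carrier G" "act g i0 = j" using trans[OF j] by (rule bexE)
    show ?thesis
      by (rule G.haar_compact_subset[OF \<mu> open_transporter[OF i0 j g]]) (use g in simp)
  qed
  then have "\<forall>j\<in>I. \<exists>K. K \<subseteq> {g \<in> carrier G. act g i0 = j} \<and> K \<in> sets \<mu> \<and> emeasure \<mu> K \<noteq> \<infinity> \<and> 0 < measure \<mu> K"
    by (rule ballI)
  from bchoice[OF this] obtain K where "\<forall>j\<in>I. K j \<subseteq> {g \<in> carrier G. act g i0 = j} \<and> K j \<in> sets \<mu> \<and>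
      emeasure \<mu> (K j) \<noteq> \<infinity> \<and> 0 < measure \<mu> (K j)" by (rule exE)
  then have K: "\<And>j. j \<in> I \<Longrightarrow> K j \<subseteq> {g \<in> carrier G. act g i0 = j}" "\<And>j. j \<in> I \<Longrightarrow> K j \<in> sets \<mu>"
    "\<And>j. j \<in> I \<Longrightarrow> emeasure \<mu> (K j) \<noteq> \<infinity>" "\<And>j. j \<in> I \<Longrightarrow> 0 < measure \<mu> (K j)"
    by simp_all
  \<comment> \<open>Division by the measure normalises: the integral of the constant
    \<open>a j\<close> over \<open>K j\<close> is \<open>c j\<close>.\<close>
  define a where "a = (\<lambda>j. c j / complex_of_real (measure \<mu> (K j)))"
  define f where "f = (\<lambda>x. \<Sum>j\<in>F. a j * indicator (K j) x)"
  define b where "b = (\<lambda>j. a j \<odot>\<^bsub>E\<^esub> basis j)"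
  define \<Phi> where "\<Phi> = (\<lambda>x. f x \<odot>\<^bsub>E\<^esub> rep x (basis i0))"
  have act_K: "act x i0 = j" "x \<in> carrier G" if "x \<in> K j" "j \<in> I" for x j using K(1) that by blast+
  have K_disj: "k = j" if "x \<in> K j" "x \<in> K k" "j \<in> F" "k \<in> F" for x j k
    using act_K(1)[of x j] act_K(1)[of x k] that F(2) by auto
  have f_K: "f x = a j" if xj: "x \<in> K j" and j: "j \<in> F" for x j
  proof -
    have "f x = (\<Sum>k\<in>F. if k = j then a j else 0)"
      unfolding f_def
    proof (intro sum.cong refl)
      fix k assume k: "k \<in> F"
      show "a k * indicator (K k) x = (if k = j then a j else 0)"
      proof (cases "x \<in> K k")
        case True
        then show ?thesis using K_disj[OF xj True j k] by simp
      next
        case False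
        then show ?thesis using xj by auto
      qed
    qed
    then show ?thesis using j F by simp
  qed
  have f_0: "f x = 0" if "\<And>j. j \<in> F \<Longrightarrow> x \<notin> K j" for x
    unfolding f_def using that by (intro sum.neutral) auto
  have b: "b j \<in> carrier E" "coord (b j) = (\<lambda>i. a j * indicator {j} i)" if "j \<in> F" for j
    using that F basis[of j] by (auto simp: b_def smult)
  have a0: "a j \<noteq> 0" if "j \<in> F" for j using that F c0 K(4)[of j] by (auto simp: a_def)
  \<comment> \<open>Distinct nonzero values make the level sets of \<open>\<Phi>\<close> exactly the
    sets \<open>K j\<close>; here it matters that all coefficients are nonzero.\<close>
  have b_inj: "j = k" if bb: "b j = b k" and j: "j \<in> F" and k: "k \<in> F" for j k
  proof (rule ccontr)
    assume "j \<noteq> k"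
    then have "coord (b k) j = 0" using b(2)[OF k] by simp
    moreover have "coord (b j) j = a j" using b(2)[OF j] by simp
    ultimately show False using bb a0[OF j] by simp
  qed
  have b_ne: "b j \<noteq> \<zero>\<^bsub>E\<^esub>" if j: "j \<in> F" for j
  proof
    assume "b j = \<zero>\<^bsub>E\<^esub>"
    then have "coord (b j) j = 0" by (simp add: zero)
    then show False using b(2)[OF j] a0[OF j] by simp
  qed
  have \<Phi>_K: "\<Phi> x = b j" if xj: "x \<in> K j" and j: "j \<in> F" for x j
  proof -
    have "j \<in> I" using j F by blast
    then show ?thesis
      using act_K[OF xj] rep_basis[OF _ i0, of x] by (simp add: \<Phi>_def b_def f_K[OF xj j])
  qed
  have \<Phi>_0: "\<Phi> x = \<zero>\<^bsub>E\<^esub>" if "\<And>j. j \<in> F \<Longrightarrow> x \<notin> K j" "x \<in> carrier G" for x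
    using f_0[OF that(1)] rep_carrier[OF that(2) basis(1)[OF i0]] smult_l_null by (simp add: \<Phi>_def)
  have \<Phi>_carrier: "\<Phi> \<in> space \<mu> \<rightarrow> carrier E"
    using rep_carrier basis(1)[OF i0] by (auto simp: \<Phi>_def sp smult)
  have \<Phi>_range: "\<Phi> ` space \<mu> \<subseteq> insert \<zero>\<^bsub>E\<^esub> (b ` F)"
  proof
    fix v assume "v \<in> \<Phi> ` space \<mu>"
    then obtain x where x: "x \<in> carrier G" "v = \<Phi> x" using sp by auto
    show "v \<in> insert \<zero>\<^bsub>E\<^esub> (b ` F)"
    proof (cases "\<exists>j\<in>F. x \<in> K j")
      case True
      then obtain j where j: "j \<in> F" "x \<in> K j" by blast
      then show ?thesis using \<Phi>_K[OF j(2,1)] x by simp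
    next
      case False
      then have "\<Phi> x = \<zero>\<^bsub>E\<^esub>" by (intro \<Phi>_0 x) blast
      then show ?thesis using x by simp
    qed
  qed
  have pre_b: "{x \<in> space \<mu>. \<Phi> x = b j} = K j" if j: "j \<in> F" for j
  proof (intro equalityI subsetI)
    fix x assume x: "x \<in> {x \<in> space \<mu>. \<Phi> x = b j}"
    have "\<exists>k\<in>F. x \<in> K k"
    proof (rule ccontr)
      assume "\<not> (\<exists>k\<in>F. x \<in> K k)"
      then have "\<Phi> x = \<zero>\<^bsub>E\<^esub>" using x sp by (intro \<Phi>_0) auto
      then show False using b_ne[OF j] x by simp
    qed
    then obtain k where k: "k \<in> F" "x \<in> K k" by blast
    then have "b j = b k" using \<Phi>_K[OF k(2,1)] x by simp
    then show "x \<in> K j" using b_inj[OF _ j k(1)] k by simp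
  next
    fix x assume x: "x \<in> K j"
    have "j \<in> I" using j F by blast
    then show "x \<in> {x \<in> space \<mu>. \<Phi> x = b j}"
      using act_K(2)[OF x] \<Phi>_K[OF x j] sp by simp
  qed
  have nz: "{x \<in> space \<mu>. \<Phi> x \<noteq> \<zero>\<^bsub>E\<^esub>} = (\<Union>j\<in>F. K j)"
  proof (intro equalityI subsetI)
    fix x assume x: "x \<in> {x \<in> space \<mu>. \<Phi> x \<noteq> \<zero>\<^bsub>E\<^esub>}"
    show "x \<in> (\<Union>j\<in>F. K j)"
    proof (rule ccontr)
      assume "x \<notin> (\<Union>j\<in>F. K j)"
      then have "\<Phi> x = \<zero>\<^bsub>E\<^esub>" using x sp by (intro \<Phi>_0) auto
      then show False using x by simp
    qed
  next
    fix x assume "x \<in> (\<Union>j\<in>F. K j)"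
    then obtain j where j: "j \<in> F" "x \<in> K j" by blast
    have "j \<in> I" using j F by blast
    then show "x \<in> {x \<in> space \<mu>. \<Phi> x \<noteq> \<zero>\<^bsub>E\<^esub>}"
      using act_K(2)[OF j(2)] \<Phi>_K[OF j(2,1)] b_ne[OF j(1)] sp by simp
  qed
  have fin_nz: "emeasure \<mu> (\<Union>j\<in>F. K j) \<noteq> \<infinity>"
  proof -
    have "emeasure \<mu> (\<Union>j\<in>F. K j) \<le> (\<Sum>j\<in>F. emeasure \<mu> (K j))"
      using F K by (intro emeasure_subadditive_finite) auto
    also have "\<dots> < \<infinity>" using F K(3) by (auto simp: less_top[symmetric])
    finally show ?thesis by simp
  qed
  have simple: "simple_integrable_in E \<mu> \<Phi>"
    unfolding simple_integrable_in_def simple_function_def nz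
  proof (intro conjI \<Phi>_carrier fin_nz ballI)
    show "finite (\<Phi> ` space \<mu>)" by (rule finite_subset[OF \<Phi>_range]) (simp add: F)
    fix v assume "v \<in> \<Phi> ` space \<mu>"
    then consider "v = \<zero>\<^bsub>E\<^esub>" | j where "j \<in> F" "v = b j" using \<Phi>_range by blast
    then show "\<Phi> -` {v} \<inter> space \<mu> \<in> sets \<mu>"
    proof cases
      case 1
      then have "\<Phi> -` {v} \<inter> space \<mu> = space \<mu> - (\<Union>j\<in>F. K j)" using nz by blast
      then show ?thesis using F K(2) by (auto intro!: sets.Diff sets.finite_UN)
    next
      case 2
      then have "\<Phi> -` {v} \<inter> space \<mu> = K j" using pre_b[of j] by blast
      then show ?thesis using F K(2) 2 by auto
    qed
  qed
  let ?w = "\<lambda>j. if j \<in> F then c j else 0"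
  have w: "?w \<in> ellfun p I" by (rule ellfun_finite_support[OF F]) simp
  have int: "simple_integral_in E \<mu> \<Phi> = vec ?w"
  proof -
    let ?V = "\<Phi> ` space \<mu>"
    let ?h = "\<lambda>v. complex_of_real (measure \<mu> {x \<in> space \<mu>. \<Phi> x = v}) \<odot>\<^bsub>E\<^esub> v"
    have finV: "finite ?V" by (rule finite_subset[OF \<Phi>_range]) (simp add: F)
    have Vc: "v \<in> carrier E" if "v \<in> ?V" for v using that \<Phi>_carrier by blast
    have hc: "?h v \<in> carrier E" if "v \<in> ?V" for v using Vc[OF that] by (rule smult)
    have "K j \<noteq> {}" if "j \<in> F" for j using K(4)[of j] that F by auto
    then have K_ne: "\<exists>x. x \<in> K j" if "j \<in> F" for j using that by blast
    have bV: "b ` F \<subseteq> ?V"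
    proof
      fix v assume "v \<in> b ` F"
      then obtain j where j: "j \<in> F" "v = b j" by blast
      obtain x where x: "x \<in> K j" using K_ne[OF j(1)] by blast
      have "j \<in> I" using j F by blast
      then show "v \<in> ?V"
        using \<Phi>_K[OF x j(1)] act_K(2)[OF x] j sp by (intro image_eqI[of _ _ x]) auto
    qed
    have "coord (simple_integral_in E \<mu> \<Phi>) i = ?w i" for i
    proof -
      have "coord (simple_integral_in E \<mu> \<Phi>) i = (\<Sum>v\<in>?V. coord (?h v) i)"
        unfolding simple_integral_in_def using finV hc by (rule coord_finsum)
      \<comment> \<open>The only other possible value of \<open>\<Phi>\<close> is the zero vector,
        which contributes nothing whatever the measure of its level set.\<close>
      also have "\<dots> = (\<Sum>v\<in>b ` F. coord (?h v) i)"
        using finV bV \<Phi>_range by (intro sum.mono_neutral_right) (auto simp: smult zero)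
      also have "\<dots> = (\<Sum>j\<in>F. coord (?h (b j)) i)"
        using b_inj by (intro sum.reindex_cong[of b]) (auto simp: inj_on_def)
      also have "\<dots> = (\<Sum>j\<in>F. if i = j then c j else 0)"
      proof (intro sum.cong refl)
        fix j assume j: "j \<in> F"
        have "measure \<mu> (K j) > 0" using K(4) j F by blast
        then show "coord (?h (b j)) i = (if i = j then c j else 0)"
          using j by (simp add: pre_b smult b a_def indicator_def)
      qed
      also have "\<dots> = ?w i" using F by simp
      finally show ?thesis .
    qed
    then have "coord (simple_integral_in E \<mu> \<Phi>) = coord (vec ?w)"
      using coord_vec[OF w] by auto
    moreover have "simple_integral_in E \<mu> \<Phi> \<in> carrier E"
      unfolding simple_integral_in_def using hc by (intro M.finsum_closed) auto
    ultimately show ?thesis using coord_inject vec_carrier[OF w] by blast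
  qed
  have diff0: "nrm E (\<Phi> x \<ominus>\<^bsub>E\<^esub> \<Phi> x) = 0" if "x \<in> space \<mu>" for x
    using \<Phi>_carrier that nrm_minus_eq_0_iff[of "\<Phi> x" "\<Phi> x"] by auto
  have "has_bochner_integral_in E \<mu> \<Phi> (vec ?w)"
    unfolding has_bochner_integral_in_def
  \<comment> \<open>\<open>\<Phi>\<close> is itself simple, so the constant sequence approximates it
    and the Bochner integral is the finite sum.\<close>
  proof (intro conjI \<Phi>_carrier exI[of _ "\<lambda>_. \<Phi>"] allI simple)
    show "(\<lambda>x. nrm E (\<Phi> x \<ominus>\<^bsub>E\<^esub> \<Phi> x)) \<in> borel_measurable \<mu>"
      by (subst measurable_cong[OF diff0]) auto
    have "(\<integral>\<^sup>+x. ennreal (nrm E (\<Phi> x \<ominus>\<^bsub>E\<^esub> \<Phi> x)) \<partial>\<mu>) = (\<integral>\<^sup>+x. 0 \<partial>\<mu>)"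
      by (intro nn_integral_cong) (simp add: diff0)
    then show "(\<lambda>i::nat. \<integral>\<^sup>+x. ennreal (nrm E (\<Phi> x \<ominus>\<^bsub>E\<^esub> \<Phi> x)) \<partial>\<mu>) \<longlonglongrightarrow> 0" by simp
    show "limitin (norm_topology E) (\<lambda>i. simple_integral_in E \<mu> \<Phi>) (vec ?w) sequentially"
      unfolding int using vec_carrier[OF w] by simp
  qed
  moreover have "integrable \<mu> f"
    unfolding f_def
  proof (intro Bochner_Integration.integrable_sum integrable_mult_right)
    fix j assume "j \<in> F"
    then have "j \<in> I" using F by blast
    then have "integrable \<mu> (indicator (K j) :: 'g \<Rightarrow> real)"
      using K(2,3)[of j] by (intro integrable_real_indicator) (auto simp: less_top)
    then have "integrable \<mu> (\<lambda>x. complex_of_real (indicator (K j) x))" by (rule integrable_of_real)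
    moreover have "(\<lambda>x. complex_of_real (indicator (K j) x)) = indicator (K j)"
      by (auto simp: indicator_def)
    ultimately show "integrable \<mu> (indicator (K j) :: 'g \<Rightarrow> complex)" by simp
  qed
  ultimately show ?thesis unfolding L1_orbit_def \<Phi>_def by blast
qed

lemma cyclic_basis:
  assumes \<mu>: "left_haar_measure G T \<mu>" and i0: "i0 \<in> I"
    and trans: "\<And>j. j \<in> I \<Longrightarrow> \<exists>g\<in>carrier G. act g i0 = j"
  shows "norm_topology E closure_of L1_orbit \<mu> E rep (basis i0) = carrier E"
proof (intro equalityI subsetI)
  fix v assume "v \<in> norm_topology E closure_of L1_orbit \<mu> E rep (basis i0)"
  then show "v \<in> carrier E" using closure_of_subset_topspace[of "norm_topology E"] by auto
next
  fix v assume v: "v \<in> carrier E"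
  have "\<exists>y\<in>L1_orbit \<mu> E rep (basis i0). y \<in> metric.mball v r" if r: "r > 0" for r
  proof -
    obtain F where F: "finite F" "F \<subseteq> I"
      and near: "nrm E (v \<ominus>\<^bsub>E\<^esub> vec (\<lambda>i. if i \<in> F then coord v i else 0)) \<le> r / 2"
      using finite_approximation[OF v, of "r / 2"] r by auto
    \<comment> \<open>Zero coordinates are dropped to meet the requirement of nonzero coefficients;
      the truncation does not change.\<close>
    define F' where "F' = {i \<in> F. coord v i \<noteq> 0}"
    have e: "(\<lambda>i. if i \<in> F then coord v i else 0) = (\<lambda>i. if i \<in> F' then coord v i else 0)"
      by (auto simp: F'_def)
    have F': "finite F'" "F' \<subseteq> I" "\<And>j. j \<in> F' \<Longrightarrow> coord v j \<noteq> 0" using F by (auto simp: F'_def)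
    let ?w = "vec (\<lambda>i. if i \<in> F' then coord v i else 0)"
    have "?w \<in> L1_orbit \<mu> E rep (basis i0)"
      by (rule finite_support_in_L1_orbit[OF \<mu> i0]) (use trans F' in auto)
    moreover have "?w \<in> carrier E" by (intro vec_carrier ellfun_finite_support[OF F'(1,2)]) simp
    then have "?w \<in> metric.mball v r"
      using near r v unfolding e by (simp add: ndist_def)
    ultimately show ?thesis by blast
  qed
  then show "v \<in> norm_topology E closure_of L1_orbit \<mu> E rep (basis i0)"
    using v unfolding metric.metric_closure_of by blast
qed

end

section \<open>The Hilbert space case \<open>p = 2\<close>\<close>

lemma ellfun_2_mult_summable:
  assumes "f \<in> ellfun 2 I" "g \<in> ellfun 2 I"
  shows "(\<lambda>i. f i * cnj (g i)) summable_on I"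
proof (rule abs_summable_summable)
  have "(\<lambda>i. cmod (f i) powr 2 + cmod (g i) powr 2) summable_on I"
    using assms by (intro summable_on_add ellfunD(2)) 
  moreover have "cmod (f i * cnj (g i)) \<le> cmod (f i) powr 2 + cmod (g i) powr 2" for i
  proof -
    have "0 \<le> cmod (f i) * cmod (g i)" by simp
    moreover have "2 * (cmod (f i) * cmod (g i)) \<le> (cmod (f i))\<^sup>2 + (cmod (g i))\<^sup>2"
      using sum_squares_bound[of "cmod (f i)" "cmod (g i)"] by (simp add: mult.assoc)
    ultimately have "cmod (f i) * cmod (g i) \<le> (cmod (f i))\<^sup>2 + (cmod (g i))\<^sup>2" by linarith
    then show ?thesis by (simp add: norm_mult)
  qed
  ultimately show "(\<lambda>i. norm (f i * cnj (g i))) summable_on I"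
    by (rule Infinite_Sum.abs_summable_on_comparison_test')
qed

lemma (in lp_space) hilbert_space:
  assumes p2: "p = 2"
  shows "hilbert_space E (\<lambda>x y. \<Sum>\<^sub>\<infinity>i\<in>I. coord x i * cnj (coord y i))"
  unfolding hilbert_space_def
proof (intro conjI ballI allI cbanach_space)
  fix x y z c assume x: "x \<in> carrier E" and y: "y \<in> carrier E"
  have s: "(\<lambda>i. coord x i * cnj (coord y i)) summable_on I" if "x \<in> carrier E" "y \<in> carrier E" for x y
    using coord_ellfun[OF that(1)] coord_ellfun[OF that(2)] p2 by (intro ellfun_2_mult_summable) auto
  show "(\<Sum>\<^sub>\<infinity>i\<in>I. coord (c \<odot>\<^bsub>E\<^esub> x) i * cnj (coord y i)) = c * (\<Sum>\<^sub>\<infinity>i\<in>I. coord x i * cnj (coord y i))" for c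
    using x by (simp add: smult mult.assoc infsum_cmult_right')
  show "(\<Sum>\<^sub>\<infinity>i\<in>I. coord y i * cnj (coord x i)) = cnj (\<Sum>\<^sub>\<infinity>i\<in>I. coord x i * cnj (coord y i))"
    by (simp add: mult.commute flip: infsum_cnj)
  show "(\<Sum>\<^sub>\<infinity>i\<in>I. coord (x \<oplus>\<^bsub>E\<^esub> y) i * cnj (coord z i))
      = (\<Sum>\<^sub>\<infinity>i\<in>I. coord x i * cnj (coord z i)) + (\<Sum>\<^sub>\<infinity>i\<in>I. coord y i * cnj (coord z i))"
    if z: "z \<in> carrier E" for z
    using infsum_add[OF s[OF x z] s[OF y z]] x y by (simp add: add algebra_simps)
next
  fix x assume x: "x \<in> carrier E"
  have "(\<Sum>\<^sub>\<infinity>i\<in>I. coord x i * cnj (coord x i)) = (\<Sum>\<^sub>\<infinity>i\<in>I. complex_of_real (cmod (coord x i) powr p))"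
    by (intro infsum_cong) (simp add: p2 flip: complex_norm_square)
  also have "\<dots> = complex_of_real (\<Sum>\<^sub>\<infinity>i\<in>I. cmod (coord x i) powr p)"
    using ellfunD(2)[OF coord_ellfun[OF x]] by (intro infsumI has_sum_of_real_iff[THEN iffD2] has_sum_infsum)
  also have "(\<Sum>\<^sub>\<infinity>i\<in>I. cmod (coord x i) powr p) = (nrm E x)\<^sup>2"
    using ellnorm_powr[OF p, of I "coord x"] x p2 by (simp add: nrm)
  finally show "(\<Sum>\<^sub>\<infinity>i\<in>I. coord x i * cnj (coord x i)) = complex_of_real ((nrm E x)\<^sup>2)" .
qed

lemma (in permutation_representation) unitary_representation:
  assumes p2: "p = 2"
  shows "unitary_representation G T E (\<lambda>x y. \<Sum>\<^sub>\<infinity>i\<in>I. coord x i * cnj (coord y i)) rep"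
  unfolding unitary_representation_def
proof (intro conjI ballI hilbert_space[OF p2] representation_rep)
  fix g x y assume g: "g \<in> carrier G" and x: "x \<in> carrier E" and y: "y \<in> carrier E"
  have "bij_betw (act (inv g)) I I" using bij_act g by simp
  from infsum_reindex_bij_betw[OF this, of "\<lambda>i. coord x i * cnj (coord y i)"]
  show "(\<Sum>\<^sub>\<infinity>i\<in>I. coord (rep g x) i * cnj (coord (rep g y) i)) = (\<Sum>\<^sub>\<infinity>i\<in>I. coord x i * cnj (coord y i))"
    using g x y by (simp add: coord_rep translate_def cong: infsum_cong)
qed

section \<open>The action on the cosets of an open subgroup\<close>

lemma (in locally_compact_group) permutation_representation_cosets:
  assumes H: "subgroup H G" "openin T H" and E: "lp_space E coord p (lcosets\<^bsub>G\<^esub> H)"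
  shows "permutation_representation G T E coord p (lcosets\<^bsub>G\<^esub> H) (\<lambda>g c. g <#\<^bsub>G\<^esub> c)"
proof -
  have sub: "H \<subseteq> carrier G" using H by (simp add: subgroup.subset)
  have mem: "\<exists>a\<in>carrier G. c = a <# H" if "c \<in> lcosets H" for c
    using that by (auto simp: LCOSETS_def)
  \<comment> \<open>The stabiliser of \<open>a <# H\<close> is the preimage of the open set
    \<open>a <# H\<close> under right multiplication by \<open>a\<close>.\<close>
  have stab: "openin T {g \<in> carrier G. g <# (a <# H) = a <# H}" if a: "a \<in> carrier G" for a
  proof -
    have "continuous_map T T (\<lambda>x. x \<otimes> a)"
      using continuous_map_compose[OF _ continuous_mult, of T "\<lambda>x. (x, a)"] topspace_eq a
      by (simp add: o_def continuous_map_pairedI)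
    then have "openin T {g \<in> topspace T. g \<otimes> a \<in> a <# H}"
      by (rule openin_continuous_map_preimage) (use openin_left_coset H a in blast)
    moreover have "g <# (a <# H) = a <# H \<longleftrightarrow> g \<otimes> a \<in> a <# H" if g: "g \<in> carrier G" for g
    proof
      assume "g <# (a <# H) = a <# H"
      then have "(g \<otimes> a) <# H = a <# H" using lcos_m_assoc[OF sub g a] by simp
      then show "g \<otimes> a \<in> a <# H" using lcos_self[of "g \<otimes> a" H] g a H by simp
    next
      assume "g \<otimes> a \<in> a <# H"
      then have "a <# H = (g \<otimes> a) <# H" using l_repr_independence a H by blast
      then show "g <# (a <# H) = a <# H" using lcos_m_assoc[OF sub g a] by simp
    qed
    ultimately show ?thesis
      unfolding topspace_eq by (simp cong: conj_cong)
  qed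
  interpret E: lp_space E coord p "lcosets H" by fact
  show ?thesis
  proof
    fix g c assume g: "g \<in> carrier G" and c: "c \<in> lcosets H"
    then obtain a where a: "a \<in> carrier G" "c = a <# H" using mem by blast
    show "g <# c \<in> lcosets H" using a g lcos_m_assoc[OF sub g a(1)] by (auto simp: LCOSETS_def)
    fix h assume h: "h \<in> carrier G"
    show "g \<otimes> h <# c = g <# (h <# c)"
      using lcos_m_assoc[OF l_coset_subset_G[OF sub a(1)] g h] a by simp
  next
    fix c assume c: "c \<in> lcosets H"
    then obtain a where a: "a \<in> carrier G" "c = a <# H" using mem by blast
    show "\<one> <# c = c" using lcos_mult_one[OF l_coset_subset_G[OF sub a(1)]] a by simp
    show "openin T {g \<in> carrier G. g <# c = c}" using stab[OF a(1)] a by simp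
  qed
qed

lemma (in permutation_representation) coefficient_basis:
  assumes "g \<in> carrier G" "i \<in> I" "j \<in> I"
  shows "(\<lambda>v\<in>carrier E. coord v j) (rep g (basis i)) = indicator {j} (act g i)"
  using assms basis(1,2)[of "act g i"] by (auto simp: rep_basis act_closed indicator_def)

text \<open>A function on the coset space is coded as a function on \<open>G\<close> that is
  constant on left cosets; this fits into the left summand of the universe whatever
  \<open>'u\<close> is.\<close>

definition coset_function :: "('g, 'r) monoid_scheme \<Rightarrow> 'g set \<Rightarrow> ('g set \<Rightarrow> complex) \<Rightarrow> ('g, 'u) universe" where
  "coset_function G H f = Inl (\<lambda>g. if g \<in> carrier G then f (g <#\<^bsub>G\<^esub> H) else 0)"

lemma inj_on_coset_function: "inj_on (coset_function G H) (ellfun p (lcosets\<^bsub>G\<^esub> H))"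
proof (rule inj_onI)
  fix f f' assume f: "f \<in> ellfun p (lcosets\<^bsub>G\<^esub> H)" "f' \<in> ellfun p (lcosets\<^bsub>G\<^esub> H)"
    and "coset_function G H f = coset_function G H f'"
  then have e: "f (g <#\<^bsub>G\<^esub> H) = f' (g <#\<^bsub>G\<^esub> H)" if "g \<in> carrier G" for g
    using that by (auto simp: coset_function_def dest!: fun_cong[where x = g])
  show "f = f'"
  proof
    show "f c = f' c" for c
      using e ellfunD(1)[OF f(1)] ellfunD(1)[OF f(2)]
      by (cases "c \<in> lcosets\<^bsub>G\<^esub> H") (auto simp: LCOSETS_def)
  qed
qed

lemma (in lp_space) basis_coefficient_norm:
  assumes "i \<in> I" "j \<in> I"
  shows "nrm E (basis i) * nrm (dual E) (\<lambda>v\<in>carrier E. coord v j) \<le> 1"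
  using basis(3)[OF assms(1)] coordinate_functional(2)[OF assms(2)] by simp

text \<open>The coset \<open>C\<close> is itself a point of the coset space, and \<open>g\<close>
  lies in \<open>C\<close> iff \<open>g\<close> moves the base point \<open>H\<close> to
  \<open>C\<close>. So the indicator of \<open>C\<close> is the indicator of one point along an
  orbit.\<close>

lemma (in locally_compact_group) coset_representation:
  fixes C :: "'g set"
  assumes C: "open_left_coset G T C" and p: "1 < p"
  obtains I and act :: "'g \<Rightarrow> 'g set \<Rightarrow> 'g set" and E :: "('g, 'u) universe cnspace" and coord i j
  where "permutation_representation G T E coord p I act" "i \<in> I" "j \<in> I"
    "\<And>k. k \<in> I \<Longrightarrow> \<exists>g\<in>carrier G. act g i = k"
    "\<And>g. g \<in> carrier G \<Longrightarrow> indicator C g = (indicator {j} (act g i) :: complex)"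
    "QSLp p E"
proof -
  obtain H a where H: "subgroup H G" "openin T H" and a: "a \<in> carrier G" and CaH: "C = a <# H"
    using C unfolding open_left_coset_def by blast
  have sub: "H \<subseteq> carrier G" using H by (simp add: subgroup.subset)
  define J where "J = (coset_function G H :: _ \<Rightarrow> ('g, 'u) universe)"
  have lp: "lp_space (lp_model J p (lcosets H)) (inv_into (ellfun p (lcosets H)) J) p (lcosets H)"
    unfolding J_def by (rule lp_space_lp_model[OF p inj_on_coset_function])
  interpret permutation_representation G T "lp_model J p (lcosets H)" "inv_into (ellfun p (lcosets H)) J"
    p "lcosets H" "\<lambda>g c. g <#\<^bsub>G\<^esub> c"
    by (rule permutation_representation_cosets[OF H lp])
  show thesis
  proof (rule that)
    show "permutation_representation G T (lp_model J p (lcosets H)) (inv_into (ellfun p (lcosets H)) J)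
      p (lcosets H) (\<lambda>g c. g <#\<^bsub>G\<^esub> c)" by (rule permutation_representation_axioms)
    show "H \<in> lcosets H" using lcos_mult_one[OF sub] by (auto simp: LCOSETS_def)
    show "C \<in> lcosets H" using a CaH by (auto simp: LCOSETS_def)
    show "\<exists>g\<in>carrier G. g <# H = k" if "k \<in> lcosets H" for k using that by (auto simp: LCOSETS_def)
    show "indicator C g = (indicator {C} (g <# H) :: complex)" if g: "g \<in> carrier G" for g
    proof -
      have "g \<in> C \<longleftrightarrow> g <# H = C"
        unfolding CaH using l_repr_independence[OF _ a H(1), of g] lcos_self[OF g H(1)] by blast
      then show ?thesis by (simp add: indicator_def)
    qed
    \<comment> \<open>The atoms of the counting measure must live in the type of the vectors, so
      each coset is coded by its indicator function; this coding is unrelated to that of the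
      vectors.\<close>
    have "inj_on (\<lambda>c. Inl (indicator c) :: ('g, 'u) universe) (lcosets H)"
    proof (rule inj_onI)
      fix c d assume "(Inl (indicator c) :: ('g, 'u) universe) = Inl (indicator d)"
      then have e: "indicator c x = (indicator d x :: complex)" for x by (simp only: sum.inject)
      have "x \<in> c \<longleftrightarrow> x \<in> d" for x
        using e[of x] by (cases "x \<in> c"; cases "x \<in> d") auto
      then show "c = d" by blast
    qed
    then show "QSLp p (lp_model J p (lcosets H))" by (rule QSLp)
  qed
qed

section \<open>Norms of the indicator of an open coset\<close>

lemma unitary_coefficient_norm_ge:
  assumes U: "unitary_representation G T H ip \<pi>" and \<xi>: "\<xi> \<in> carrier H" and \<eta>: "\<eta> \<in> carrier H"
    and x: "x \<in> carrier G" and u: "u x = ip (\<pi> x \<xi>) \<eta>" "u x = 1"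
  shows "1 \<le> nrm H \<xi> * nrm H \<eta>"
proof -
  have H: "hilbert_space H ip" and rep: "representation G T H \<pi>"
    using U by (auto simp: unitary_representation_def)
  have "1 = cmod (ip (\<pi> x \<xi>) \<eta>)" using u by simp
  also have "\<dots> \<le> nrm H (\<pi> x \<xi>) * nrm H \<eta>"
    using hilbert_Cauchy_Schwarz[OF H _ \<eta>] representationD(6)[OF rep x \<xi>] by blast
  finally show ?thesis using representationD(7)[OF rep x \<xi>] by simp
qed

text \<open>Since the operators are isometries, the total weight bounds the value at every point of
  \<open>G\<close>; a point of the coset gives the lower bound for the norm.\<close>

lemma coefficient_sum_norm_ge:
  assumes rep: "\<And>n::nat. representation G T (E n) (\<pi> n)"
    and \<xi>: "\<And>n. \<xi> n \<in> carrier (E n)" and \<eta>: "\<And>n. \<eta> n \<in> carrier (dual (E n))"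
    and sm: "summable (\<lambda>n. nrm (E n) (\<xi> n) * nrm (dual (E n)) (\<eta> n))"
    and x: "x \<in> carrier G" and u: "(\<lambda>n. \<eta> n (\<pi> n x (\<xi> n))) sums 1"
  shows "1 \<le> (\<Sum>n. nrm (E n) (\<xi> n) * nrm (dual (E n)) (\<eta> n))"
proof -
  have le: "cmod (\<eta> n (\<pi> n x (\<xi> n))) \<le> nrm (E n) (\<xi> n) * nrm (dual (E n)) (\<eta> n)" for n
  proof -
    interpret cnormed_space "E n" using representationD(2)[OF rep] .
    show ?thesis
      using bounded_functional_le[of "\<eta> n" "\<pi> n x (\<xi> n)"] \<eta>[of n] representationD(6,7)[OF rep x \<xi>]
      by (simp add: mult.commute)
  qed
  have "1 = cmod (\<Sum>n. \<eta> n (\<pi> n x (\<xi> n)))" using sums_unique[OF u] by simp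
  also have "\<dots> \<le> (\<Sum>n. nrm (E n) (\<xi> n) * nrm (dual (E n)) (\<eta> n))"
    by (rule norm_suminf_le[OF le sm])
  finally show ?thesis .
qed

context locally_compact_group
begin

text \<open>Everything comes from the permutation representation with \<open>p = 2\<close>: it is
  unitary, its coefficient of two unit basis vectors attains the infimum, and since Hilbert spaces
  are smooth the same coefficient is a normalized one of the required kind.\<close>

lemma fourier_stieltjes_of_open_left_coset:
  fixes C :: "'g set"
  assumes C: "open_left_coset G T C"
  shows "indicator C \<in> fourier_stieltjes TYPE(('g, 'u) universe) G T"
    and "fourier_stieltjes_norm TYPE(('g, 'u) universe) G T (indicator C) = 1"
    and "\<exists>(E :: ('g, 'u) universe cnspace) \<pi>. representation G T E \<pi> \<and>
               (smooth E \<or> smooth (dual E)) \<and> normalized_coefficient G E \<pi> (indicator C)"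
proof -
  obtain I and act :: "'g \<Rightarrow> 'g set \<Rightarrow> 'g set" and E :: "('g, 'u) universe cnspace" and coord i j
    where P: "permutation_representation G T E coord 2 I act" and i: "i \<in> I" and j: "j \<in> I"
      and trans: "\<And>k. k \<in> I \<Longrightarrow> \<exists>g\<in>carrier G. act g i = k"
      and u: "\<And>g. g \<in> carrier G \<Longrightarrow> indicator C g = (indicator {j} (act g i) :: complex)"
    by (rule coset_representation[OF C, of 2]) (simp, rule that)
  interpret permutation_representation G T E coord 2 I act by (rule P)
  obtain g where g: "g \<in> carrier G" "act g i = j" using trans[OF j] by blast
  let ?ip = "\<lambda>x y. \<Sum>\<^sub>\<infinity>i\<in>I. coord x i * cnj (coord y i)"
  have U: "unitary_representation G T E ?ip rep" by (rule unitary_representation) simp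
  have coeff: "indicator C h = ?ip (rep h (basis i)) (basis j)" if h: "h \<in> carrier G" for h
  proof -
    have k: "act h i \<in> I" using act_closed[OF h i] .
    have "?ip (rep h (basis i)) (basis j) = (\<Sum>\<^sub>\<infinity>l\<in>I. indicator {act h i} l * cnj (indicator {j} l))"
      using h i k by (simp add: rep_basis basis(2) j)
    also have "\<dots> = (\<Sum>\<^sub>\<infinity>l\<in>{j}. indicator {act h i} l * cnj (indicator {j} l))"
      using j by (intro infsum_cong_neutral) auto
    also have "\<dots> = indicator {j} (act h i)" by (auto simp: indicator_def)
    finally show ?thesis using u[OF h] by simp
  qed
  show "indicator C \<in> fourier_stieltjes TYPE(('g, 'u) universe) G T"
    unfolding fourier_stieltjes_def using U coeff basis(1)[OF i] basis(1)[OF j] by blast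
  have "fourier_stieltjes_norm TYPE(('g, 'u) universe) G T (indicator C)
      \<le> ennreal (nrm E (basis i) * nrm E (basis j))"
    unfolding fourier_stieltjes_norm_def
    by (rule Inf_lower) (use U coeff basis(1)[OF i] basis(1)[OF j] in blast)
  moreover have "1 \<le> fourier_stieltjes_norm TYPE(('g, 'u) universe) G T (indicator C)"
    unfolding fourier_stieltjes_norm_def
  proof (rule Inf_greatest)
    have C1: "indicator C g = (1 :: complex)" using u[OF g(1)] g by simp
    fix s assume "s \<in> {ennreal (nrm H \<xi> * nrm H \<eta>) |(H :: ('g, 'u) universe cnspace) ip \<pi> \<xi> \<eta>.
            Defs.unitary_representation G T H ip \<pi> \<and> \<xi> \<in> carrier H \<and> \<eta> \<in> carrier H \<and>
            (\<forall>x\<in>carrier G. indicator C x = ip (\<pi> x \<xi>) \<eta>)}"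
    then obtain H :: "('g, 'u) universe cnspace" and ip \<pi> \<xi> \<eta>
      where s: "s = ennreal (nrm H \<xi> * nrm H \<eta>)" and "Defs.unitary_representation G T H ip \<pi>" "\<xi> \<in> carrier H"
        "\<eta> \<in> carrier H" "indicator C g = ip (\<pi> g \<xi>) \<eta>"
      using g by blast
    then have "1 \<le> nrm H \<xi> * nrm H \<eta>"
      using unitary_coefficient_norm_ge[of G T H ip \<pi> \<xi> \<eta> g "indicator C"] g C1 by blast
    then show "1 \<le> s" unfolding s using ennreal_leI[of 1] by simp
  qed
  ultimately show "fourier_stieltjes_norm TYPE(('g, 'u) universe) G T (indicator C) = 1"
    using basis(3) i j by simp
  show "\<exists>(E :: ('g, 'u) universe cnspace) \<pi>. representation G T E \<pi> \<and>
               (smooth E \<or> smooth (dual E)) \<and> normalized_coefficient G E \<pi> (indicator C)"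
  proof (intro exI conjI disjI1)
    show "representation G T E rep" by (rule representation_rep)
    show "smooth E" by (rule hilbert_space_smooth[OF hilbert_space]) simp
    let ?\<phi> = "\<lambda>v\<in>carrier E. coord v j"
    have \<phi>: "?\<phi> \<in> bounded_functionals E" by (rule coordinate_functional(1)[OF j])
    have "1 \<le> nrm (dual E) ?\<phi>"
      using bounded_functional_le[OF \<phi> basis(1)[OF j]] basis[OF j] by simp
    then have "nrm (dual E) ?\<phi> = 1" using coordinate_functional(2)[OF j] by simp
    moreover have "indicator C h = ?\<phi> (rep h (basis i))" if "h \<in> carrier G" for h
      using coefficient_basis[OF that i j] u[OF that] by simp
    ultimately show "normalized_coefficient G E rep (indicator C)"
      unfolding normalized_coefficient_def carrier_dual using \<phi> basis(1,3)[OF i] by blast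
  qed
qed

text \<open>One cyclic representation attains the infimum; its cyclicity comes from the transitivity
  of the action and from the Haar measure.\<close>

lemma B_p_of_open_left_coset:
  fixes C :: "'g set"
  assumes C: "open_left_coset G T C" and p: "1 < p" and \<mu>: "left_haar_measure G T \<mu>"
  shows "indicator C \<in> B_p TYPE(('g, 'u) universe) p G T"
    and "B_p_norm TYPE(('g, 'u) universe) p G T \<mu> (indicator C) = 1"
proof -
  obtain I and act :: "'g \<Rightarrow> 'g set \<Rightarrow> 'g set" and E :: "('g, 'u) universe cnspace" and coord i j
    where P: "permutation_representation G T E coord p I act" and i: "i \<in> I" and j: "j \<in> I"
      and trans: "\<And>k. k \<in> I \<Longrightarrow> \<exists>g\<in>carrier G. act g i = k"
      and u: "\<And>g. g \<in> carrier G \<Longrightarrow> indicator C g = (indicator {j} (act g i) :: complex)"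
      and Q: "QSLp p E"
    by (rule coset_representation[OF C p]) (rule that)
  interpret permutation_representation G T E coord p I act by (rule P)
  obtain g where g: "g \<in> carrier G" "act g i = j" using trans[OF j] by blast
  have R: "Rep_p p G T E rep" using Q representation_rep by (simp add: Rep_p_def)
  then have cyc: "Cyc_p p G T \<mu> E rep"
    using cyclic_basis[OF \<mu> i trans] basis(1)[OF i] by (auto simp: Cyc_p_def)
  let ?\<phi> = "\<lambda>v\<in>carrier E. coord v j"
  have \<phi>: "?\<phi> \<in> bounded_functionals E" by (rule coordinate_functional(1)[OF j])
  have coeff: "indicator C h = ?\<phi> (rep h (basis i))" if "h \<in> carrier G" for h
    using coefficient_basis[OF that i j] u[OF that] by simp
  show "indicator C \<in> B_p TYPE(('g, 'u) universe) p G T"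
    unfolding B_p_def using R \<phi> coeff basis(1)[OF i] carrier_dual by blast
  let ?S = "{ennreal (\<Sum>n. nrm (E n) (\<xi> n) * nrm (dual (E n)) (\<eta> n)) |
            (E :: nat \<Rightarrow> ('g, 'u) universe cnspace) \<pi> \<xi> \<eta>.
            (\<forall>n. Cyc_p p G T \<mu> (E n) (\<pi> n) \<and> \<xi> n \<in> carrier (E n) \<and> \<eta> n \<in> carrier (dual (E n))) \<and>
            summable (\<lambda>n. nrm (E n) (\<xi> n) * nrm (dual (E n)) (\<eta> n)) \<and>
            (\<forall>x\<in>carrier G. (\<lambda>n. \<eta> n (\<pi> n x (\<xi> n))) sums indicator C x)}"
  \<comment> \<open>The series has this coefficient at index 0 and zero vectors afterwards; the
    representation is repeated in every term, since each term must be cyclic.\<close>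
  define \<xi> where "\<xi> = (\<lambda>n::nat. if n = 0 then basis i else \<zero>\<^bsub>E\<^esub>)"
  have \<xi>: "\<xi> n \<in> carrier E" for n using basis(1)[OF i] by (simp add: \<xi>_def)
  have "(\<lambda>n. nrm E (\<xi> n) * nrm (dual E) ?\<phi>) = (\<lambda>n. if n = 0 then nrm E (basis i) * nrm (dual E) ?\<phi> else 0)"
    by (auto simp: \<xi>_def)
  then have w: "(\<lambda>n. nrm E (\<xi> n) * nrm (dual E) ?\<phi>) sums (nrm E (basis i) * nrm (dual E) ?\<phi>)"
    using sums_single[of 0 "\<lambda>_. nrm E (basis i) * nrm (dual E) ?\<phi>"] by simp
  have sums: "(\<lambda>n. ?\<phi> (rep x (\<xi> n))) sums indicator C x" if x: "x \<in> carrier G" for x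
  proof -
    have "(\<lambda>n. ?\<phi> (rep x (\<xi> n))) = (\<lambda>n. if n = 0 then ?\<phi> (rep x (basis i)) else 0)"
      using representation_zero[OF representation_rep x] bounded_functional_zero[OF \<phi>] by (auto simp: \<xi>_def)
    then show ?thesis
      unfolding coeff[OF x] using sums_single[of 0 "\<lambda>_. ?\<phi> (rep x (basis i))"] by simp
  qed
  have "ennreal (\<Sum>n. nrm E (\<xi> n) * nrm (dual E) ?\<phi>) \<in> ?S"
    by (intro CollectI exI[of _ "\<lambda>_. E"] exI[of _ "\<lambda>_. rep"] exI[of _ \<xi>] exI[of _ "\<lambda>_. ?\<phi>"])
      (use cyc \<xi> \<phi> sums sums_summable[OF w] carrier_dual in simp)
  then have "Inf ?S \<le> ennreal (\<Sum>n. nrm E (\<xi> n) * nrm (dual E) ?\<phi>)" by (rule Inf_lower)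
  also have "\<dots> \<le> ennreal 1"
    using basis_coefficient_norm[OF i j] sums_unique[OF w] by (intro ennreal_leI) simp
  finally have "Inf ?S \<le> 1" by simp
  moreover have "1 \<le> Inf ?S"
  proof (rule Inf_greatest)
    have C1: "indicator C g = (1 :: complex)" using u[OF g(1)] g by simp
    fix s assume "s \<in> ?S"
    then obtain F :: "nat \<Rightarrow> ('g, 'u) universe cnspace" and \<pi> \<xi> \<eta>
      where s: "s = ennreal (\<Sum>n. nrm (F n) (\<xi> n) * nrm (dual (F n)) (\<eta> n))"
        and F: "\<And>n. Cyc_p p G T \<mu> (F n) (\<pi> n)" "\<And>n. \<xi> n \<in> carrier (F n)" "\<And>n. \<eta> n \<in> carrier (dual (F n))"
        and sm: "summable (\<lambda>n. nrm (F n) (\<xi> n) * nrm (dual (F n)) (\<eta> n))"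
        and su: "\<And>x. x \<in> carrier G \<Longrightarrow> (\<lambda>n. \<eta> n (\<pi> n x (\<xi> n))) sums indicator C x"
      by blast
    have "representation G T (F n) (\<pi> n)" for n using F(1)[of n] by (simp add: Cyc_p_def Rep_p_def)
    then have "1 \<le> (\<Sum>n. nrm (F n) (\<xi> n) * nrm (dual (F n)) (\<eta> n))"
      using coefficient_sum_norm_ge[of G T F \<pi> \<xi> \<eta> g] F(2,3) sm g su[OF g(1)] C1 by simp
    then show "1 \<le> s" unfolding s using ennreal_leI[of 1] by simp
  qed
  ultimately show "B_p_norm TYPE(('g, 'u) universe) p G T \<mu> (indicator C) = 1"
    unfolding B_p_norm_def by simp
qed

end

theorem theorem3p5:
  fixes G :: "('g, 'r) monoid_scheme" and T :: "'g topology" and \<mu> :: "'g measure"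
    and p :: real and C :: "'g set"
  assumes "locally_compact_group G T" and "left_haar_measure G T \<mu>"
    and "1 < p" and "C \<subseteq> carrier G"
  shows "(open_left_coset G T C \<longleftrightarrow>
            indicator C \<in> fourier_stieltjes TYPE(('g, 'u) universe) G T \<and>
            fourier_stieltjes_norm TYPE(('g, 'u) universe) G T (indicator C) = 1)
       \<and> (open_left_coset G T C \<longleftrightarrow>
            (\<exists>x\<in>carrier G. indicator C x \<noteq> (0 :: complex)) \<and>
            (\<exists>(E :: ('g, 'u) universe cnspace) \<pi>. representation G T E \<pi> \<and>
               (smooth E \<or> smooth (dual E)) \<and> normalized_coefficient G E \<pi> (indicator C)))
       \<and> (open_left_coset G T C \<longleftrightarrow>
            indicator C \<in> B_p TYPE(('g, 'u) universe) p G T \<and>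
            B_p_norm TYPE(('g, 'u) universe) p G T \<mu> (indicator C) = 1)"
proof -
  interpret locally_compact_group G T by fact
  have nonempty: "\<exists>x\<in>carrier G. indicator C x \<noteq> (0 :: complex)" if "open_left_coset G T C"
  proof -
    obtain H a where "subgroup H G" "a \<in> carrier G" "C = a <#\<^bsub>G\<^esub> H"
      using \<open>open_left_coset G T C\<close> unfolding open_left_coset_def by blast
    then show ?thesis using lcos_self[of a H] by (intro bexI[of _ a]) auto
  qed
  show ?thesis
  proof (intro conjI iffI; (elim conjE)?)
    assume "open_left_coset G T C"
    note C = this
    show "indicator C \<in> fourier_stieltjes TYPE(('g, 'u) universe) G T"
      "fourier_stieltjes_norm TYPE(('g, 'u) universe) G T (indicator C) = 1"
      "\<exists>(E :: ('g, 'u) universe cnspace) \<pi>. representation G T E \<pi> \<and>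
               (smooth E \<or> smooth (dual E)) \<and> normalized_coefficient G E \<pi> (indicator C)"
      using fourier_stieltjes_of_open_left_coset[OF C] by blast+
    show "\<exists>x\<in>carrier G. indicator C x \<noteq> (0 :: complex)" by (rule nonempty[OF C])
    show "indicator C \<in> B_p TYPE(('g, 'u) universe) p G T"
      "B_p_norm TYPE(('g, 'u) universe) p G T \<mu> (indicator C) = 1"
      using B_p_of_open_left_coset[OF C assms(3,2)] by blast+
  next
    assume "fourier_stieltjes_norm TYPE(('g, 'u) universe) G T (indicator C) = 1"
    then show "open_left_coset G T C"
      by (rule open_left_coset_of_fourier_stieltjes[OF assms(4)])
  next
    assume "indicator C \<in> B_p TYPE(('g, 'u) universe) p G T"
      "B_p_norm TYPE(('g, 'u) universe) p G T \<mu> (indicator C) = 1"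
    then show "open_left_coset G T C"
      by (rule open_left_coset_of_B_p[OF assms(3,4)])
  next
    assume "\<exists>x\<in>carrier G. indicator C x \<noteq> (0 :: complex)"
      "\<exists>(E :: ('g, 'u) universe cnspace) \<pi>. representation G T E \<pi> \<and>
               (smooth E \<or> smooth (dual E)) \<and> normalized_coefficient G E \<pi> (indicator C)"
    then show "open_left_coset G T C"
      using open_left_coset_of_smooth[OF assms(4)] by (metis empty_iff indicator_simps(2))
  qed
qed

end
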